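(* Given an arbitrary constant $M$, there are a suitably large constant $\kappa_0>0$ and a constant $C_M$ such that the distance functional $J$ defined with this $\kappa_0$ (see the context) has the following property. For any initial data $\bar u,\bar v\in\mathcal{X}$ with $\|\bar u_x\|_{L^2(\mathbb{R})}\le M$ and $\|\bar v_x\|_{L^2(\mathbb{R})}\le M$, let $u(t)=u(t,\cdot)$ and $v(t)=v(t,\cdot)$ be the corresponding dissipative solutions of $$u_t+\Big(\frac{u^2}{2}\Big)_x=\frac14\Big(\int_{-\infty}^x-\int_x^\infty\Big)u_x^2\,dx$$ with $u(0,\cdot)=\bar u$ and $v(0,\cdot)=\bar v$, given by the explicit construction recalled in the context. Then $$J\big(u(t),v(t)\big)\le e^{C_M t}\,J(\bar u,\bar v)\qquad\text{for all }t\ge0 .$$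
   Context: The space $\mathcal{X}$ is the set of bounded continuous functions $f:\mathbb{R}\to\mathbb{R}$ with distributional derivative $f_x\in L^2(\mathbb{R})$. Constructed (dissipative) solution: given $\bar u\in\mathcal{X}$, for $y\in\mathbb{R}$ set $$\varphi(t,y)=\frac14\int_{\{x:\ \bar u_x(x)>-2/t\}}\operatorname{sign}(y-x)\,\bar u_x^2(x)\,dx\ (t>0),\qquad \varphi(0,y)=\frac14\int_{\mathbb{R}}\operatorname{sign}(y-x)\,\bar u_x^2(x)\,dx,$$ $$\xi(t,y)=y+t\,\bar u(y)+\int_0^t(t-s)\,\varphi(s,y)\,ds,\qquad u\big(t,\xi(t,y)\big)=\bar u(y)+\int_0^t\varphi(s,y)\,ds .$$ For every $t\ge 0$ the map $y\mapsto\xi(t,y)$ is nondecreasing, continuous and onto $\mathbb{R}$, the last formula defines $u(t,\cdot)$ unambiguously on $\mathbb{R}$, and $u(t,\cdot)\in\mathcal{X}$. The function $u$ so obtained is what is called here the dissipative solution corresponding to $\bar u$; the solution $v$ is built in the same way from $\bar v$. Distance on the auxiliary space: for a constant $\kappa_0>0$, let $X=\big(\mathbb{R}^2\times(-\pi/2,\pi/2]\big)\cup\{\infty\}$ with $$d\big((x,u,w),(\tilde x,\tilde u,\tilde w)\big)=\min\Big\{|x-\tilde x|+|u-\tilde u|+\kappa_0|w-\tilde w|,\ \kappa_0\big|\tfrac{\pi}{2}+w\big|+\kappa_0\big|\tfrac{\pi}{2}+\tilde w\big|\Big\},\qquad d\big((x,u,w),\infty\big)=\kappa_0\big|\tfrac{\pi}{2}+w\big|.$$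 Distance functional: let $\mathcal{F}$ be the family of triples $(\psi,\phi_1,\phi_2)$ where $\phi_1,\phi_2:\mathbb{R}\to[0,1]$ are simple Borel measurable maps (finite range, Borel preimages of points) and $\psi:\mathbb{R}\to\mathbb{R}$ is a nondecreasing absolutely continuous surjective map. For $u,v\in\mathcal{X}$, a triple in $\mathcal{F}$ is admissible if $$\phi_1(x)\,u_x^2(x)=\psi'(x)\,\phi_2(\psi(x))\,v_x^2(\psi(x))\quad\text{for a.e. }x\in\mathbb{R}.$$ With $P(x)=(x,u(x),\arctan u_x(x))$ and $Q(x)=(\psi(x),v(\psi(x)),\arctan v_x(\psi(x)))$, its cost is $$J^{(\psi,\phi_1,\phi_2)}(u,v)=\int_{\mathbb{R}} d(P(x),Q(x))\,\phi_1(x)u_x^2(x)\,dx+\int_{\mathbb{R}} d(P(x),\infty)\,(1-\phi_1(x))u_x^2(x)\,dx+\int_{\mathbb{R}} d(Q(x),\infty)\,(1-\phi_2(\psi(x)))\,v_x^2(\psi(x))\,\psi'(x)\,dx,$$ and $J(u,v)=\inf J^{(\psi,\phi_1,\phi_2)}(u,v)$ over all admissible triples. *)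

theory Defs
  imports "HOL-Analysis.Analysis"
begin

section \<open>The space of bounded continuous functions with square integrable derivative\<close>

definition test_fun :: "(real \<Rightarrow> real) \<Rightarrow> bool" where
  "test_fun h \<longleftrightarrow>
     (\<forall>n x. (deriv ^^ n) h differentiable (at x)) \<and> compact (closure {x. h x \<noteq> 0})"

definition L2_fun :: "(real \<Rightarrow> real) \<Rightarrow> bool" where
  "L2_fun g \<longleftrightarrow> g \<in> borel_measurable borel \<and> integrable lborel (\<lambda>x. (g x)\<^sup>2)"

definition L2_norm :: "(real \<Rightarrow> real) \<Rightarrow> real" where
  "L2_norm g = sqrt (LINT x|lborel. (g x)\<^sup>2)"

definition L2_distr_deriv :: "(real \<Rightarrow> real) \<Rightarrow> (real \<Rightarrow> real) \<Rightarrow> bool" where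
  "L2_distr_deriv f g \<longleftrightarrow> L2_fun g \<and>
     (\<forall>h. test_fun h \<longrightarrow> (LINT x|lborel. f x * deriv h x) = - (LINT x|lborel. g x * h x))"

definition X_space :: "(real \<Rightarrow> real) set" where
  "X_space = {f. continuous_on UNIV f \<and> bounded (range f) \<and> (\<exists>g. L2_distr_deriv f g)}"

text \<open>
  A Borel representative of the distributional derivative, which is unique up to null sets.
  Everything below is independent of the choice: composition with a monotone absolutely
  continuous \<open>\<psi>\<close> is harmless because \<open>\<psi>' = 0\<close> almost everywhere on the \<open>\<psi>\<close>-preimage of a null set.
\<close>
definition dx :: "(real \<Rightarrow> real) \<Rightarrow> real \<Rightarrow> real" where
  "dx f = (SOME g. L2_distr_deriv f g)"

lemma dx: "f \<in> X_space \<Longrightarrow> L2_distr_deriv f (dx f)"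
  unfolding X_space_def dx_def by (metis (mono_tags, lifting) mem_Collect_eq someI_ex)


section \<open>Dissipative solutions\<close>

definition active :: "(real \<Rightarrow> real) \<Rightarrow> real \<Rightarrow> real set" where
  "active f t = (if t = 0 then UNIV else {x. dx f x > - 2 / t})"

definition char_speed :: "(real \<Rightarrow> real) \<Rightarrow> real \<Rightarrow> real \<Rightarrow> real" where
  "char_speed f t y = 1 / 4 * (LINT x : active f t | lborel. sgn (y - x) * (dx f x)\<^sup>2)"

definition char_pos :: "(real \<Rightarrow> real) \<Rightarrow> real \<Rightarrow> real \<Rightarrow> real" where
  "char_pos f t y = y + t * f y + (LINT s : {0..t} | lborel. (t - s) * char_speed f s y)"

definition char_val :: "(real \<Rightarrow> real) \<Rightarrow> real \<Rightarrow> real \<Rightarrow> real" where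
  "char_val f t y = f y + (LINT s : {0..t} | lborel. char_speed f s y)"

text \<open>
  Characteristics may merge, so \<open>y\<close> is not determined by \<open>\<xi>(t,y) = x\<close>, but the value carried is.
\<close>
definition dissipative_solution :: "(real \<Rightarrow> real) \<Rightarrow> real \<Rightarrow> real \<Rightarrow> real" where
  "dissipative_solution f t x = (THE w. \<exists>y. char_pos f t y = x \<and> w = char_val f t y)"


section \<open>The auxiliary metric space\<close>

datatype aux_point = Fin real real real | Infty

definition aux_space :: "aux_point set" where
  "aux_space = insert Infty {Fin x u w | x u w. - pi / 2 < w \<and> w \<le> pi / 2}"

fun aux_dist :: "real \<Rightarrow> aux_point \<Rightarrow> aux_point \<Rightarrow> real" where
  "aux_dist k (Fin x u w) (Fin x' u' w') =
     min (\<bar>x - x'\<bar> + \<bar>u - u'\<bar> + k * \<bar>w - w'\<bar>) (k * \<bar>pi / 2 + w\<bar> + k * \<bar>pi / 2 + w'\<bar>)"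
| "aux_dist k (Fin x u w) Infty = k * \<bar>pi / 2 + w\<bar>"
| "aux_dist k Infty (Fin x u w) = k * \<bar>pi / 2 + w\<bar>"
| "aux_dist k Infty Infty = 0"

definition graph_point :: "(real \<Rightarrow> real) \<Rightarrow> real \<Rightarrow> aux_point" where
  "graph_point f x = Fin x (f x) (arctan (dx f x))"

lemma graph_point_in_aux_space: "graph_point f x \<in> aux_space"
  using arctan_lbound[of "dx f x"] arctan_ubound[of "dx f x"]
  by (simp add: graph_point_def aux_space_def)


section \<open>The distance functional\<close>

definition abs_continuous_on :: "real set \<Rightarrow> (real \<Rightarrow> real) \<Rightarrow> bool" where
  "abs_continuous_on S f \<longleftrightarrow>
     (\<forall>e>0. \<exists>d>0. \<forall>n a b.
        (\<forall>i<n. a i \<le> b i \<and> {a i..b i} \<subseteq> S) \<and>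
        disjoint_family_on (\<lambda>i. {a i<..<b i}) {..<n::nat} \<and>
        (\<Sum>i<n. b i - a i) < d
        \<longrightarrow> (\<Sum>i<n. \<bar>f (b i) - f (a i)\<bar>) < e)"

definition transport_triples ::
    "((real \<Rightarrow> real) \<times> (real \<Rightarrow> real) \<times> (real \<Rightarrow> real)) set" where
  "transport_triples = {(\<psi>, \<phi>1, \<phi>2).
     simple_function borel \<phi>1 \<and> range \<phi>1 \<subseteq> {0..1} \<and>
     simple_function borel \<phi>2 \<and> range \<phi>2 \<subseteq> {0..1} \<and>
     mono \<psi> \<and> abs_continuous_on UNIV \<psi> \<and> surj \<psi>}"

definition admissible ::
    "(real \<Rightarrow> real) \<Rightarrow> (real \<Rightarrow> real) \<Rightarrow> ((real \<Rightarrow> real) \<times> (real \<Rightarrow> real) \<times> (real \<Rightarrow> real)) set" where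
  "admissible u v = {(\<psi>, \<phi>1, \<phi>2) \<in> transport_triples.
     AE x in lebesgue. \<phi>1 x * (dx u x)\<^sup>2 = deriv \<psi> x * \<phi>2 (\<psi> x) * (dx v (\<psi> x))\<^sup>2}"

text \<open>
  The integrands are nonnegative almost everywhere. The measure is \<^term>\<open>lebesgue\<close> because
  \<^term>\<open>deriv \<psi>\<close> is unspecified on the null set where \<open>\<psi>\<close> is not differentiable.
\<close>
definition transport_cost ::
    "real \<Rightarrow> (real \<Rightarrow> real) \<Rightarrow> (real \<Rightarrow> real) \<Rightarrow>
     (real \<Rightarrow> real) \<times> (real \<Rightarrow> real) \<times> (real \<Rightarrow> real) \<Rightarrow> ennreal" where
  "transport_cost k u v = (\<lambda>(\<psi>, \<phi>1, \<phi>2).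
     (\<integral>\<^sup>+x. ennreal (aux_dist k (graph_point u x) (graph_point v (\<psi> x))
                    * \<phi>1 x * (dx u x)\<^sup>2) \<partial>lebesgue) +
     (\<integral>\<^sup>+x. ennreal (aux_dist k (graph_point u x) Infty
                    * (1 - \<phi>1 x) * (dx u x)\<^sup>2) \<partial>lebesgue) +
     (\<integral>\<^sup>+x. ennreal (aux_dist k (graph_point v (\<psi> x)) Infty
                    * (1 - \<phi>2 (\<psi> x)) * (dx v (\<psi> x))\<^sup>2 * deriv \<psi> x) \<partial>lebesgue))"

definition J :: "real \<Rightarrow> (real \<Rightarrow> real) \<Rightarrow> (real \<Rightarrow> real) \<Rightarrow> ennreal" where
  "J k u v = (INF p \<in> admissible u v. transport_cost k u v p)"

end

theory Submission
  imports Defs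
begin

text \<open>
  Along characteristics the slope is explicit, so a plan \<open>(\<psi>, \<phi>1, \<phi>2)\<close> at time \<open>0\<close> can be pushed
  forward: particles stay matched as long as both carry energy. The distance of positions and
  values of matched particles grows only through the energy that is not balanced by the plan, and
  every such unit of energy dissipates the term \<open>\<kappa> (\<pi>/2 + arctan u\<^sub>x)\<close> at a definite rate once the
  factor \<open>exp (- t)\<close> is included. With \<open>\<kappa> \<ge> M\<^sup>2\<close> the gain beats the loss, which gives the estimate
  with \<open>C = 1\<close>.

  The pushed-forward coupling is only a monotone relation \<open>{(F y, H y)}\<close>: characteristics may merge.
  Its largest \<open>n\<close>-Lipschitz minorant is an admissible \<open>\<psi>\<close>, and by Lebesgue's differentiation theorem
  it agrees with the relation up to a set of small energy, on which the plan is simply switched off.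
\<close>

subsection \<open>Monotone maps with a density\<close>

text \<open>In the label \<open>y\<close> the slope solves w' = - w^2 / 2, so the energy at a label
  is constant until its slope reaches minus infinity. Matched particles can thus be compared label
  by label, and the only nonlocal quantity is \<rho>, the energy not balanced by the plan,
  integrated over labels and over time with weight exp (- s). It adds at most exp t * \<rho> / 4 to
  a displacement (the 1/4 of the source term), and this is weighted with the matched energy, at most
  the energy E of \<open>u\<close>. After the factor exp (- t) the loss is E * \<rho> / 4. On the
  other side exp (- s) times \<kappa> times the angle above - pi / 2 falls at rate at least \<kappa>
  / 4 * exp (- s) while a particle lives. The requirement is therefore E \<le> \<kappa>. The
  exponent 1 suffices because 1 + s \<le> exp s controls displacements and exp t is a Lipschitz
  constant of the map taking initial to evolved angles.

  Merging makes positions non-injective in the label. Almost all points where injectivity fails have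
  density zero, so most statements about almost every label are guarded by a positive
  density.\<close>

definition has_increments :: "(real \<Rightarrow> real) \<Rightarrow> (real \<Rightarrow> real) \<Rightarrow> bool" where
  "has_increments F f \<longleftrightarrow> f \<in> borel_measurable borel \<and>
     (\<forall>a b. a \<le> b \<longrightarrow> has_bochner_integral lborel (\<lambda>x. indicator {a<..b} x * f x) (F b - F a))"

lemma has_incrementsD:
  assumes "has_increments F f"
  shows "f \<in> borel_measurable borel"
    and "a \<le> b \<Longrightarrow> has_bochner_integral lborel (\<lambda>x. indicator {a<..b} x * f x) (F b - F a)"
  using assms by (auto simp: has_increments_def)

lemma has_increments_uminus:
  assumes "has_increments F f" shows "has_increments (\<lambda>x. - F x) (\<lambda>x. - f x)"
  unfolding has_increments_def
proof (intro conjI allI impI)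
  show "(\<lambda>x. - f x) \<in> borel_measurable borel" using assms by (auto simp: has_increments_def)
  fix a b :: real assume "a \<le> b"
  from has_bochner_integral_minus[OF has_incrementsD(2)[OF assms this]]
  show "has_bochner_integral lborel (\<lambda>x. indicator {a<..b} x * - f x) (- F b - - F a)" by simp
qed

lemma has_increments_add:
  assumes "has_increments F f" "has_increments G g"
  shows "has_increments (\<lambda>x. F x + G x) (\<lambda>x. f x + g x)"
  unfolding has_increments_def
proof (intro conjI allI impI)
  show "(\<lambda>x. f x + g x) \<in> borel_measurable borel" using assms by (auto simp: has_increments_def)
  fix a b :: real assume "a \<le> b"
  from has_bochner_integral_add[OF has_incrementsD(2)[OF assms(1) this] has_incrementsD(2)[OF assms(2) this]]
  show "has_bochner_integral lborel (\<lambda>x. indicator {a<..b} x * (f x + g x)) (F b + G b - (F a + G a))"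
    by (simp add: algebra_simps)
qed

lemma has_increments_linear: "has_increments (\<lambda>x. r * x) (\<lambda>x. r)"
  unfolding has_increments_def
proof (intro conjI allI impI)
  fix a b :: real assume ab: "a \<le> b"
  have "has_bochner_integral lborel (\<lambda>x. indicator {a<..b} x *\<^sub>R r) (measure lborel {a<..b} *\<^sub>R r)"
    by (rule has_bochner_integral_indicator) (use ab in auto)
  with ab show "has_bochner_integral lborel (\<lambda>x. indicator {a<..b} x * r) (r * b - r * a)"
    by (simp add: algebra_simps)
qed auto

lemma has_increments_integrable_on:
  assumes "has_increments F f" "a \<le> b"
  shows "f integrable_on {a..b}" "integral {a..b} f = F b - F a"
proof -
  have eq: "AE x in lborel. indicator {a<..b} x * f x = indicator {a..b} x *\<^sub>R f x"
    using AE_lborel_singleton[of a] by eventually_elim (auto split: split_indicator)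
  have "has_bochner_integral lborel (\<lambda>x. indicator {a..b} x *\<^sub>R f x) (F b - F a)"
    using has_incrementsD[OF assms(1)] assms(2)
    by (subst has_bochner_integral_cong_AE[OF _ _ eq, symmetric]) auto
  then have "set_integrable lborel {a..b} f" "(LINT x:{a..b}|lborel. f x) = F b - F a"
    by (auto simp: set_integrable_def set_lebesgue_integral_def has_bochner_integral_iff)
  then show "f integrable_on {a..b}" "integral {a..b} f = F b - F a"
    using set_borel_integral_eq_integral by force+
qed

lemma has_increments_continuous:
  assumes "has_increments F f" shows "continuous_on UNIV F"
proof -
  have "isCont F x" for x
  proof -
    have "continuous_on {x-1..x+1} (\<lambda>y. F (x-1) + integral {x-1..y} f)"
      using has_increments_integrable_on[OF assms, of "x-1" "x+1"]
      by (intro continuous_intros indefinite_integral_continuous_1) auto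
    then have "continuous_on {x-1..x+1} F"
      by (rule continuous_on_eq) (use has_increments_integrable_on[OF assms] in auto)
    then show ?thesis
      by (rule continuous_on_interior) auto
  qed
  then show ?thesis by (simp add: continuous_on_eq_continuous_at)
qed

lemma has_increments_cmult:
  assumes "has_increments F f" shows "has_increments (\<lambda>x. c * F x) (\<lambda>x. c * f x)"
  unfolding has_increments_def
proof (intro conjI allI impI)
  show "(\<lambda>x. c * f x) \<in> borel_measurable borel" using has_incrementsD(1)[OF assms] by auto
  fix a b :: real assume "a \<le> b"
  from has_bochner_integral_mult_right[OF has_incrementsD(2)[OF assms this], of c]
  show "has_bochner_integral lborel (\<lambda>x. indicator {a<..b} x * (c * f x)) (c * F b - c * F a)"
    by (simp add: algebra_simps)
qed

text \<open>Local absolute continuity of a nondecreasing map, with the density as witness. The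
  extended nonnegative integral keeps integrability conditions out of the change of
  variables.\<close>

definition has_density :: "(real \<Rightarrow> real) \<Rightarrow> (real \<Rightarrow> real) \<Rightarrow> bool" where
  "has_density F f \<longleftrightarrow> mono F \<and> f \<in> borel_measurable borel \<and> (\<forall>x. 0 \<le> f x) \<and>
     (\<forall>a b. a \<le> b \<longrightarrow> (\<integral>\<^sup>+x. ennreal (f x) * indicator {a<..b} x \<partial>lborel) = ennreal (F b - F a))"

lemma has_density_mono: "has_density F f \<Longrightarrow> mono F"
  and has_density_measurable: "has_density F f \<Longrightarrow> f \<in> borel_measurable borel"
  and has_density_nonneg: "has_density F f \<Longrightarrow> 0 \<le> f x"
  and has_density_nn_integral: "has_density F f \<Longrightarrow> a \<le> b \<Longrightarrow>
     (\<integral>\<^sup>+x. ennreal (f x) * indicator {a<..b} x \<partial>lborel) = ennreal (F b - F a)"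
  by (auto simp: has_density_def)

lemma has_density_has_bochner:
  assumes "has_density F f" "a \<le> b"
  shows "has_bochner_integral lborel (\<lambda>x. indicator {a<..b} x * f x) (F b - F a)"
proof (rule has_bochner_integral_nn_integral)
  show "0 \<le> F b - F a" using has_density_mono[OF assms(1)] assms(2) by (simp add: monoD)
  have "(\<integral>\<^sup>+x. ennreal (indicator {a<..b} x * f x) \<partial>lborel) = (\<integral>\<^sup>+x. ennreal (f x) * indicator {a<..b} x \<partial>lborel)"
    by (intro nn_integral_cong) (auto split: split_indicator)
  then show "(\<integral>\<^sup>+x. ennreal (indicator {a<..b} x * f x) \<partial>lborel) = ennreal (F b - F a)"
    using has_density_nn_integral[OF assms] by simp
qed (use has_density_measurable[OF assms(1)] has_density_nonneg[OF assms(1)] in \<open>auto split: split_indicator\<close>)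

lemma has_densityI:
  assumes "f \<in> borel_measurable borel" "\<And>x. 0 \<le> f x"
    and "\<And>a b. a \<le> b \<Longrightarrow> has_bochner_integral lborel (\<lambda>x. indicator {a<..b} x * f x) (F b - F a)"
  shows "has_density F f"
  unfolding has_density_def
proof (intro conjI allI impI)
  have nn: "0 \<le> F b - F a" if "a \<le> b" for a b
  proof -
    have "0 \<le> (LINT x|lborel. indicator {a<..b} x * f x)"
      using assms(2) by (intro integral_nonneg_AE) (auto split: split_indicator)
    then show ?thesis using assms(3)[OF that] by (simp add: has_bochner_integral_iff)
  qed
  show "mono F" using nn by (auto intro!: monoI)
  fix a b :: real assume ab: "a \<le> b"
  have "(\<integral>\<^sup>+x. ennreal (f x) * indicator {a<..b} x \<partial>lborel) = (\<integral>\<^sup>+x. ennreal (indicator {a<..b} x * f x) \<partial>lborel)"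
    by (intro nn_integral_cong) (auto split: split_indicator)
  also have "\<dots> = ennreal (F b - F a)"
    using assms(3)[OF ab] assms(2)
    by (subst nn_integral_eq_integral) (auto simp: has_bochner_integral_iff split: split_indicator)
  finally show "(\<integral>\<^sup>+x. ennreal (f x) * indicator {a<..b} x \<partial>lborel) = ennreal (F b - F a)" .
qed (use assms in auto)

lemma has_density_iff: "has_density F f \<longleftrightarrow> has_increments F f \<and> (\<forall>x. 0 \<le> f x)"
  unfolding has_increments_def
  using has_densityI[of f F] has_density_has_bochner[of F f] has_density_measurable has_density_nonneg by blast

lemma has_density_increments: "has_density F f \<Longrightarrow> has_increments F f"
  by (simp add: has_density_iff)

lemma has_density_continuous: "has_density F f \<Longrightarrow> continuous_on UNIV F"
  by (intro has_increments_continuous has_density_increments)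

subsection \<open>Generalised inverse\<close>

text \<open>Leftmost preimage of \<open>x\<close>. A flat piece of \<open>F\<close> forces some
  choice, but flat pieces have density zero, so integrals do not see which point is taken.\<close>

definition ginv :: "(real \<Rightarrow> real) \<Rightarrow> real \<Rightarrow> real" where
  "ginv F x = Inf {y. x \<le> F y}"

text \<open>The superlevel set is closed and bounded below, so it contains its infimum. This Galois
  connection is the source of the other properties of \<open>ginv\<close>.\<close>

lemma ginv_le_iff:
  assumes "mono F" "continuous_on UNIV F" "surj F"
  shows "ginv F x \<le> y \<longleftrightarrow> x \<le> F y"
proof -
  let ?S = "{y. x \<le> F y}"
  obtain y0 y1 where y: "F y0 = x - 1" "F y1 = x" using \<open>surj F\<close> by (metis surjD)
  have bdd: "bdd_below ?S"
  proof (rule bdd_belowI[of _ y0])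
    fix z assume "z \<in> ?S"
    then show "y0 \<le> z" using monoD[OF \<open>mono F\<close>, of z y0] y by (cases "y0 \<le> z") auto
  qed
  have "closed ?S" using assms(2) by (intro closed_Collect_le) auto
  then have "ginv F x \<in> ?S" unfolding ginv_def
    using closed_contains_Inf[OF _ bdd] y by fastforce
  then show ?thesis
    using monoD[OF \<open>mono F\<close>, of "ginv F x" y] cInf_lower[OF _ bdd, of y] by (auto simp: ginv_def)
qed

lemma ginv_right:
  assumes "mono F" "continuous_on UNIV F" "surj F"
  shows "F (ginv F x) = x"
proof -
  obtain y where y: "F y = x" using \<open>surj F\<close> by (metis surjD)
  have "F (ginv F x) \<le> F y" using ginv_le_iff[OF assms, of x y] y monoD[OF \<open>mono F\<close>] by auto
  moreover have "x \<le> F (ginv F x)" using ginv_le_iff[OF assms, of x "ginv F x"] by simp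
  ultimately show ?thesis using y by simp
qed

lemma mono_ginv:
  assumes "mono F" "continuous_on UNIV F" "surj F"
  shows "mono (ginv F)"
proof (rule monoI)
  fix x y :: real assume "x \<le> y"
  then show "ginv F x \<le> ginv F y" using ginv_right[OF assms, of y] by (simp add: ginv_le_iff[OF assms])
qed

lemma ginv_left: "(\<And>y'. F y' = F y \<Longrightarrow> y' = y) \<Longrightarrow> mono F \<Longrightarrow> continuous_on UNIV F \<Longrightarrow> surj F \<Longrightarrow> ginv F (F y) = y"
  using ginv_right[of F "F y"] by blast

lemma measurable_ginv [measurable (raw)]:
  assumes "has_density F f" "surj F" shows "ginv F \<in> borel_measurable borel"
  by (intro borel_measurable_mono mono_ginv has_density_mono[OF assms(1)] has_density_continuous[OF assms(1)] assms)

lemma has_density_measurable_fun: "has_density F f \<Longrightarrow> F \<in> borel_measurable borel"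
  by (intro borel_measurable_mono has_density_mono)

subsection \<open>Change of variables\<close>

text \<open>The preimage of an open interval (l, u) is the open interval from the rightmost preimage
  of l to the leftmost preimage of u, and its mass is the increment u - l. Flat pieces of
  \<open>F\<close> cause no trouble.\<close>

lemma distr_has_density:
  assumes F: "has_density F f" and surj: "surj F"
  shows "distr (density lborel (\<lambda>x. ennreal (f x))) borel F = lborel"
proof (rule lborel_eqI[symmetric])
  note [measurable] = has_density_measurable[OF F] has_density_measurable_fun[OF F]
  have m: "mono F" and c: "continuous_on UNIV F" using F has_density_mono has_density_continuous by auto
  \<comment> \<open>\<open>ginv\<close> yields leftmost preimages; applied to the graph reflected
    through the origin it yields rightmost ones.\<close>
  define F' where "F' y = - F (- y)" for y
  have F': "mono F'" "continuous_on UNIV F'" "surj F'"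
  proof -
    show "mono F'" using m by (auto simp: F'_def mono_def)
    show "continuous_on UNIV F'" unfolding F'_def
      by (intro continuous_intros continuous_on_compose2[OF c]) auto
    show "surj F'" unfolding F'_def surj_def
    proof
      fix y obtain z where "F z = - y" using surj by (metis surjD)
      then show "\<exists>x. y = - F (- x)" by (intro exI[of _ "- z"]) auto
    qed
  qed
  fix l u :: real assume "\<And>b. b \<in> Basis \<Longrightarrow> l \<bullet> b \<le> u \<bullet> b"
  then have lu: "l \<le> u" by simp
  show "emeasure (distr (density lborel (\<lambda>x. ennreal (f x))) borel F) (box l u) = ennreal (\<Prod>b\<in>Basis. (u - l) \<bullet> b)"
  proof (cases "l = u")
    case False
    define p where "p = - ginv F' (- l)"
    define q where "q = ginv F u"
    have p: "l < F y \<longleftrightarrow> p < y" for y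
      using ginv_le_iff[OF F', of "- l" "- y"] by (auto simp: p_def F'_def)
    have q: "F y < u \<longleftrightarrow> y < q" for y
      using ginv_le_iff[OF m c surj, of u y] by (auto simp: q_def)
    have Fp: "F p = l" using ginv_right[OF F', of "- l"] by (auto simp: p_def F'_def)
    have Fq: "F q = u" using ginv_right[OF m c surj] by (simp add: q_def)
    have "p \<le> q" using p[of q] Fq lu False by auto
    have eq: "F -` box l u = {p<..<q}" by (auto simp: box_real p q)
    have "emeasure (distr (density lborel (\<lambda>x. ennreal (f x))) borel F) (box l u)
       = (\<integral>\<^sup>+x. ennreal (f x) * indicator {p<..<q} x \<partial>lborel)"
      by (subst emeasure_distr) (simp_all add: eq[unfolded box_real] emeasure_density box_real)
    also have "\<dots> = (\<integral>\<^sup>+x. ennreal (f x) * indicator {p<..q} x \<partial>lborel)"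
      using AE_lborel_singleton[of q] by (intro nn_integral_cong_AE) (auto split: split_indicator)
    also have "\<dots> = ennreal (u - l)" using has_density_nn_integral[OF F \<open>p \<le> q\<close>] Fp Fq by simp
    finally show ?thesis by simp
  qed simp
qed simp

lemma nn_integral_has_density:
  assumes F: "has_density F f" and surj: "surj F" and [measurable]: "G \<in> borel_measurable borel"
  shows "(\<integral>\<^sup>+y. G (F y) * ennreal (f y) \<partial>lborel) = (\<integral>\<^sup>+x. G x \<partial>lborel)"
proof -
  note [measurable] = has_density_measurable[OF F] has_density_measurable_fun[OF F]
  have "(\<integral>\<^sup>+x. G x \<partial>lborel) = (\<integral>\<^sup>+x. G x \<partial>distr (density lborel (\<lambda>x. ennreal (f x))) borel F)"
    by (simp add: distr_has_density[OF F surj])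
  also have "\<dots> = (\<integral>\<^sup>+y. ennreal (f y) * G (F y) \<partial>lborel)"
    by (simp add: nn_integral_distr nn_integral_density)
  finally show ?thesis by (simp add: mult.commute)
qed

lemma integral_has_density:
  fixes G :: "real \<Rightarrow> real"
  assumes F: "has_density F f" and surj: "surj F" and [measurable]: "G \<in> borel_measurable borel"
  shows "integrable lborel (\<lambda>y. G (F y) * f y) \<longleftrightarrow> integrable lborel G"
    and "(LINT y|lborel. G (F y) * f y) = (LINT x|lborel. G x)"
proof -
  note [measurable] = has_density_measurable[OF F] has_density_measurable_fun[OF F]
  have "integrable lborel G \<longleftrightarrow> integrable (distr (density lborel (\<lambda>x. ennreal (f x))) borel F) G"
    by (simp add: distr_has_density[OF F surj])
  also have "\<dots> \<longleftrightarrow> integrable lborel (\<lambda>y. G (F y) * f y)"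
    using has_density_nonneg[OF F]
    by (subst integrable_distr_eq) (auto simp: integrable_density mult.commute)
  finally show "integrable lborel (\<lambda>y. G (F y) * f y) \<longleftrightarrow> integrable lborel G" by simp
  have "(LINT x|lborel. G x) = (LINT x|distr (density lborel (\<lambda>x. ennreal (f x))) borel F. G x)"
    by (simp add: distr_has_density[OF F surj])
  also have "\<dots> = (LINT y|lborel. G (F y) * f y)"
    using has_density_nonneg[OF F]
    by (subst integral_distr) (auto simp: integral_density mult.commute)
  finally show "(LINT y|lborel. G (F y) * f y) = (LINT x|lborel. G x)" by simp
qed

text \<open>\<open>F\<close> may map a set of positive measure onto a null set, but then its density
  vanishes almost everywhere on that set; hence the guard \<open>0 < f y\<close>.\<close>

lemma AE_has_density:
  assumes F: "has_density F f" and surj: "surj F" and "AE x in lborel. P x"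
  shows "AE y in lborel. 0 < f y \<longrightarrow> P (F y)"
proof -
  note [measurable] = has_density_measurable[OF F] has_density_measurable_fun[OF F]
  have "AE y in density lborel (\<lambda>x. ennreal (f x)). P (F y)"
    using assms(3) by (intro AE_distrD[where M'=borel and f=F]) (auto simp only: distr_has_density[OF F surj], measurable)
  then show ?thesis by (subst (asm) AE_density) auto
qed

lemma AE_has_density_iff:
  assumes F: "has_density F f" and surj: "surj F" and P: "{x. P x} \<in> sets borel"
  shows "(AE x in lborel. P x) \<longleftrightarrow> (AE y in lborel. 0 < f y \<longrightarrow> P (F y))"
proof -
  note [measurable] = has_density_measurable[OF F] has_density_measurable_fun[OF F]
  have "(AE x in lborel. P x) \<longleftrightarrow> (AE x in distr (density lborel (\<lambda>x. ennreal (f x))) borel F. P x)"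
    by (simp only: distr_has_density[OF F surj])
  also have "\<dots> \<longleftrightarrow> (AE y in density lborel (\<lambda>x. ennreal (f x)). P (F y))"
    by (rule AE_distr_iff) (use P in auto)
  also have "\<dots> \<longleftrightarrow> (AE y in lborel. 0 < f y \<longrightarrow> P (F y))"
    by (subst AE_density) auto
  finally show ?thesis .
qed

lemma AE_has_density_inj:
  assumes F: "has_density F f" and surj: "surj F"
  shows "AE y in lborel. 0 < f y \<longrightarrow> (\<forall>y'. F y' = F y \<longrightarrow> y' = y)"
proof -
  have "countable (F ` \<rat>)" by (intro countable_image countable_rat)
  then have "AE x in lborel. x \<notin> F ` \<rat>"
    by (intro AE_not_in) (rule countable_imp_null_set_lborel)
  from AE_has_density[OF F surj this] show ?thesis
  proof eventually_elim
    case (elim y)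
    show ?case
    proof (intro impI allI, rule ccontr)
      fix y' assume f: "0 < f y" and eq: "F y' = F y" and ne: "y' \<noteq> y"
      obtain q where "q \<in> \<rat>" "min y y' < q" "q < max y y'"
        using Rats_dense_in_real[of "min y y'" "max y y'"] ne
      by (metis linorder_less_linear max.commute max.strict_order_iff min.commute min.strict_order_iff max_def min_def)
      then have "F q = F y"
        using eq monoD[OF has_density_mono[OF F], of "min y y'" q] monoD[OF has_density_mono[OF F], of q "max y y'"]
        by (auto simp: min_def max_def split: if_splits)
      then show False using elim f \<open>q \<in> \<rat>\<close> by (metis imageI)
    qed
  qed
qed

lemma AE_ginv_left:
  assumes F: "has_density F f" and surj: "surj F"
  shows "AE y in lborel. 0 < f y \<longrightarrow> ginv F (F y) = y"
  using AE_has_density_inj[OF F surj]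
  by eventually_elim (auto intro!: ginv_left has_density_mono[OF F] has_density_continuous[OF F] surj)

text \<open>The chain rule. Where the density of \<open>F\<close> is positive, \<open>F\<close> is
  injective almost everywhere, so membership in {a<..b} can be tested after applying
  \<open>F\<close>; then variables are changed.\<close>

lemma has_density_compose:
  assumes p: "has_density \<psi> p" and F: "has_density F f" and surj: "surj F"
  shows "has_density (\<lambda>y. \<psi> (F y)) (\<lambda>y. p (F y) * f y)"
proof -
  note [measurable] = has_density_measurable[OF F] has_density_measurable_fun[OF F] has_density_measurable[OF p]
  have m: "mono F" and m': "mono \<psi>" using F p has_density_mono by auto
  have "(\<integral>\<^sup>+y. ennreal (p (F y) * f y) * indicator {a<..b} y \<partial>lborel) = ennreal (\<psi> (F b) - \<psi> (F a))" if ab: "a \<le> b" for a b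
  proof -
    have "(\<integral>\<^sup>+y. ennreal (p (F y) * f y) * indicator {a<..b} y \<partial>lborel)
        = (\<integral>\<^sup>+y. (ennreal (p (F y)) * indicator {F a<..F b} (F y)) * ennreal (f y) \<partial>lborel)"
    proof (intro nn_integral_cong_AE)
      show "AE y in lborel. ennreal (p (F y) * f y) * indicator {a<..b} y = (ennreal (p (F y)) * indicator {F a<..F b} (F y)) * ennreal (f y)"
        using AE_has_density_inj[OF F surj]
      proof eventually_elim
        case (elim y)
        show ?case
        proof (cases "0 < f y")
          case True
          then have inj: "F y' = F y \<Longrightarrow> y' = y" for y' using elim by blast
          have "y \<in> {a<..b} \<longleftrightarrow> F y \<in> {F a<..F b}"
            using inj[of a] inj[of b] monoD[OF m, of a y] monoD[OF m, of y b] monoD[OF m, of y a] monoD[OF m, of b y]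
            by (force simp: not_less not_le)
          then show ?thesis using has_density_nonneg[OF p] has_density_nonneg[OF F]
            by (auto simp: ennreal_mult split: split_indicator)
        next
          case False
          then have "f y = 0" using has_density_nonneg[OF F, of y] by auto
          then show ?thesis by simp
        qed
      qed
    qed
    also have "\<dots> = (\<integral>\<^sup>+x. ennreal (p x) * indicator {F a<..F b} x \<partial>lborel)"
      by (rule nn_integral_has_density[OF F surj]) measurable
    also have "\<dots> = ennreal (\<psi> (F b) - \<psi> (F a))"
      by (intro has_density_nn_integral[OF p] monoD[OF m] ab)
    finally show ?thesis .
  qed
  then show ?thesis unfolding has_density_def
    using has_density_nonneg[OF p] has_density_nonneg[OF F] monoD[OF m] monoD[OF m'] by (auto intro!: monoI)
qed

subsection \<open>Lebesgue's differentiation theorem\<close>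

text \<open>Vitali covering argument. The bad points lie in the set B where \<open>g\<close> is
  negative, and B is enclosed in an open U that exceeds it little in the measure with density |g|.
  Disjoint intervals inside U on which \<open>G\<close> increases cover almost all bad points. On
  each of them the positive part of \<open>g\<close> outweighs the negative part, but the positive
  part on U lives outside B and is small. Hence the negative mass of the cover is arbitrarily small,
  while \<open>g\<close> is negative at the points covered.\<close>

lemma negligible_increasing_points:
  fixes G g :: "real \<Rightarrow> real" and N :: nat
  assumes G: "has_increments G g"
  shows "negligible {x\<in>{-real N<..<N}. g x < 0 \<and> (\<forall>d>0. \<exists>a b. a < b \<and> a \<le> x \<and> x \<le> b \<and> b - a < d \<and> G a < G b)}"
    (is "negligible ?A")
proof -
  note [measurable] = has_incrementsD(1)[OF G]
  let ?I = "{-real N<..<N}"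
  define B where "B = {x\<in>?I. g x < 0}"
  have [measurable]: "B \<in> sets borel" unfolding B_def by measurable
  \<comment> \<open>The cutoff to a bounded window makes the measure finite, as outer regularity
    requires.\<close>
  define \<nu> where "\<nu> = density lborel (\<lambda>x. ennreal \<bar>g x\<bar> * indicator ?I x)"
  define pos where "pos = density lborel (\<lambda>x. ennreal (g x))"
  define neg where "neg = density lborel (\<lambda>x. ennreal (- g x))"
  have sets: "sets \<nu> = sets borel" "sets pos = sets borel" "sets neg = sets borel"
    by (auto simp: \<nu>_def pos_def neg_def)
  have fin: "emeasure \<nu> (space \<nu>) \<noteq> \<infinity>"
  proof -
    have "integrable lborel (\<lambda>x. indicator {-real N<..N} x * g x)"
      using has_incrementsD(2)[OF G, of "-real N" "real N"] by (auto simp: has_bochner_integral_iff)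
    then have "(\<integral>\<^sup>+x. ennreal (norm (indicator {-real N<..N} x * g x)) \<partial>lborel) < \<infinity>"
      by (simp only: integrable_iff_bounded)
    moreover have "emeasure \<nu> (space \<nu>) \<le> (\<integral>\<^sup>+x. ennreal (norm (indicator {-real N<..N} x * g x)) \<partial>lborel)"
      unfolding \<nu>_def by (subst emeasure_density) (auto intro!: nn_integral_mono split: split_indicator)
    ultimately show ?thesis by auto
  qed
  have ex: "\<exists>W Z. W \<in> sets borel \<and> negligible Z \<and> ?A \<subseteq> (W \<inter> B) \<union> Z \<and> emeasure neg W \<le> ennreal e" if e: "e > 0" for e :: real
  proof -
    have fB: "emeasure \<nu> B \<noteq> \<infinity>" using fin emeasure_space[of \<nu> B] by (auto simp: top_unique)
    then have "emeasure \<nu> B < emeasure \<nu> B + ennreal e"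
      using e by (cases "emeasure \<nu> B") (auto simp: ennreal_plus[symmetric] simp del: ennreal_plus simp: ennreal_less_iff)
    then have "(INF U\<in>{U. B \<subseteq> U \<and> open U}. emeasure \<nu> U) < emeasure \<nu> B + ennreal e"
      using outer_regular[OF sets(1) fin \<open>B \<in> sets borel\<close>] by simp
    then obtain U0 where U0: "B \<subseteq> U0" "open U0" "emeasure \<nu> U0 < emeasure \<nu> B + ennreal e"
      by (auto simp: INF_less_iff)
    define U where "U = U0 \<inter> ?I"
    have U: "B \<subseteq> U" "open U" "U \<subseteq> ?I" "emeasure \<nu> (U - B) \<le> ennreal e"
    proof -
      show "B \<subseteq> U" "open U" "U \<subseteq> ?I" using U0 by (auto simp: U_def B_def)
      have "emeasure \<nu> (U - B) \<le> emeasure \<nu> (U0 - B)"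
        by (intro emeasure_mono) (use U0 sets in \<open>auto simp: U_def\<close>)
      also have "\<dots> = emeasure \<nu> U0 - emeasure \<nu> B"
        using U0 fB by (intro emeasure_Diff) (auto simp: sets)
      also have "\<dots> \<le> ennreal e"
        using U0(3) fB by (simp add: ennreal_minus_le_iff less_imp_le add.commute)
      finally show "emeasure \<nu> (U - B) \<le> ennreal e" .
    qed
    \<comment> \<open>Intervals are coded by their endpoints; \<open>c\<close> and \<open>r\<close>
      present them as balls for the covering theorem.\<close>
    define K where "K = {(a,b). a < b \<and> {a..b} \<subseteq> U \<and> G a < G b}"
    define c where "c = (\<lambda>(a::real,b). (a+b)/2)"
    define r where "r = (\<lambda>(a::real,b). (b-a)/2)"
    have cb: "cball (c p) (r p) = {fst p..snd p}" for p :: "real \<times> real"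
      by (auto simp: c_def r_def cball_def dist_real_def abs_le_iff field_simps split: prod.split)
    obtain C where C: "countable C" "C \<subseteq> K"
       "pairwise (\<lambda>i j. disjnt (cball (c i) (r i)) (cball (c j) (r j))) C"
       "negligible (?A - (\<Union>i \<in> C. cball (c i) (r i)))"
    proof (rule Vitali_covering_theorem_cballs[of K r ?A c])
      show "0 < r i" if "i \<in> K" for i using that by (auto simp: K_def r_def)
      fix x d :: real assume x: "x \<in> ?A" and d: "0 < d"
      then have "x \<in> U" using U by (auto simp: B_def)
      then obtain d' where d': "d' > 0" "ball x d' \<subseteq> U" using U(2) openE by blast
      from x have "\<forall>d>0. \<exists>a b. a < b \<and> a \<le> x \<and> x \<le> b \<and> b - a < d \<and> G a < G b" by auto
      then obtain a b where ab: "a < b" "a \<le> x" "x \<le> b" "b - a < min d d'" "G a < G b"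
        using d d'(1) by (metis min_less_iff_conj)
      then have "{a..b} \<subseteq> U" using d' by (intro order_trans[OF _ d'(2)]) (auto simp: dist_real_def)
      then show "\<exists>i. i \<in> K \<and> x \<in> cball (c i) (r i) \<and> r i < d"
        using ab by (intro exI[of _ "(a,b)"]) (auto simp: K_def cb, auto simp: r_def)
    qed
    define W where "W = (\<Union>i\<in>C. {fst i..snd i})"
    have W [measurable]: "W \<in> sets borel" unfolding W_def by (intro sets.countable_UN' C) auto
    have dis: "disjoint_family_on (\<lambda>i. {fst i..snd i}) C"
      using C(3) by (auto simp: pairwise_def disjnt_def disjoint_family_on_def cb)
    \<comment> \<open>The integral of \<open>g\<close> over the interval is the positive increment
      of \<open>G\<close>, so the negative mass is the smaller one.\<close>
    have one: "emeasure neg {fst i..snd i} \<le> emeasure pos {fst i..snd i}" if "i \<in> C" for i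
    proof -
      obtain a b where i: "i = (a,b)" by fastforce
      have ab: "a < b" "G a < G b" using that C i by (auto simp: K_def)
      let ?f = "\<lambda>x. indicator {a<..b} x * g x"
      have hb: "integrable lborel ?f" "(LINT x|lborel. ?f x) = G b - G a"
        using has_incrementsD(2)[OF G, of a b] ab by (auto simp: has_bochner_integral_iff)
      have p: "emeasure pos {a..b} = (\<integral>\<^sup>+x. ennreal (?f x) \<partial>lborel)"
        unfolding pos_def using AE_lborel_singleton[of a]
        by (subst emeasure_density) (auto intro!: nn_integral_cong_AE split: split_indicator)
      have n: "emeasure neg {a..b} = (\<integral>\<^sup>+x. ennreal (- ?f x) \<partial>lborel)"
        unfolding neg_def using AE_lborel_singleton[of a]
        by (subst emeasure_density) (auto intro!: nn_integral_cong_AE split: split_indicator)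
      have "(\<integral>\<^sup>+x. ennreal (?f x) \<partial>lborel) < \<infinity>" "(\<integral>\<^sup>+x. ennreal (- ?f x) \<partial>lborel) < \<infinity>"
        using hb(1) by (auto simp: real_integrable_def top.not_eq_extremum)
      moreover have "enn2real (\<integral>\<^sup>+x. ennreal (- ?f x) \<partial>lborel) \<le> enn2real (\<integral>\<^sup>+x. ennreal (?f x) \<partial>lborel)"
        using hb(2) ab unfolding real_lebesgue_integral_def[OF hb(1)] by simp
      ultimately show ?thesis unfolding i using p n
        by (auto simp: less_top[symmetric] enn2real_le)
           (metis ennreal_enn2real ennreal_leI infinity_ennreal_def less_top)
    qed
    have "emeasure neg W = (\<integral>\<^sup>+i. emeasure neg {fst i..snd i} \<partial>count_space C)"
      unfolding W_def by (intro emeasure_UN_countable C dis) (auto simp: sets)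
    also have "\<dots> \<le> (\<integral>\<^sup>+i. emeasure pos {fst i..snd i} \<partial>count_space C)"
      by (intro nn_integral_mono) (use one in auto)
    also have "\<dots> = emeasure pos W"
      unfolding W_def by (intro emeasure_UN_countable[symmetric] C dis) (auto simp: sets)
    also have "\<dots> \<le> emeasure \<nu> (U - B)"
    proof -
      have "{fst i..snd i} \<subseteq> U" if "i \<in> C" for i
        using subsetD[OF C(2) that] by (cases i) (simp add: K_def)
      then have "W \<subseteq> U" unfolding W_def by blast
      \<comment> \<open>The positive part of \<open>g\<close> vanishes on B, so inside U it only
        charges U - B.\<close>
      have "ennreal (g x) * indicator W x \<le> ennreal \<bar>g x\<bar> * indicator ?I x * indicator (U - B) x" for x
      proof (cases "x \<in> W \<and> \<not> g x < 0")
        case True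
        then have "x \<in> U" "x \<in> ?I" "x \<notin> B" using \<open>W \<subseteq> U\<close> U(3) by (auto simp: B_def)
        then show ?thesis using True by (simp add: ennreal_leI)
      next
        case False
        then show ?thesis by (auto simp: ennreal_neg)
      qed
      moreover have "U - B \<in> sets borel" using U by auto
      ultimately show ?thesis unfolding pos_def \<nu>_def
        by (subst (1 2) emeasure_density) (auto intro!: nn_integral_mono)
    qed
    also have "\<dots> \<le> ennreal e" by fact
    finally have "emeasure neg W \<le> ennreal e" .
    moreover have "?A \<subseteq> (W \<inter> B) \<union> (?A - (\<Union>i \<in> C. cball (c i) (r i)))"
    proof -
      have "?A \<subseteq> B" unfolding B_def by blast
      moreover have "(\<Union>i \<in> C. cball (c i) (r i)) = W" by (simp only: W_def cb)
      ultimately show ?thesis by blast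
    qed
    ultimately show ?thesis using W C(4) by blast
  qed
  define A where "A = ?A"
  have "\<forall>n. \<exists>W Z. W \<in> sets borel \<and> negligible Z \<and> A \<subseteq> (W \<inter> B) \<union> Z \<and> emeasure neg W \<le> ennreal (1 / Suc n)"
    using ex[folded A_def] by simp
  then obtain W Z where WZ: "\<And>n. W n \<in> sets borel" "\<And>n. negligible (Z n)" "\<And>n. A \<subseteq> (W n \<inter> B) \<union> Z n"
    "\<And>n. emeasure neg (W n) \<le> ennreal (1 / Suc n)" by metis
  note [measurable] = WZ(1)
  \<comment> \<open>The covers for the errors 1 / Suc n are intersected: the negative mass becomes
    zero, and on B this forces Lebesgue measure zero.\<close>
  define W' where "W' = (\<Inter>n. W n) \<inter> B"
  have [measurable]: "W' \<in> sets borel" unfolding W'_def by measurable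
  have "emeasure neg W' \<le> 0"
  proof (rule LIMSEQ_le_const)
    show "(\<lambda>n. ennreal (1 / Suc n)) \<longlonglongrightarrow> 0"
      using tendsto_ennrealI[OF LIMSEQ_Suc[OF lim_1_over_n]] by simp
    have "emeasure neg W' \<le> ennreal (1 / Suc n)" for n
      by (rule order_trans[OF emeasure_mono WZ(4)[of n]]) (auto simp: W'_def sets)
    then show "\<exists>N. \<forall>n\<ge>N. emeasure neg W' \<le> ennreal (1 / Suc n)" by blast
  qed
  then have "(\<integral>\<^sup>+x. ennreal (- g x) * indicator W' x \<partial>lborel) = 0"
    unfolding neg_def by (simp add: emeasure_density)
  then have "AE x in lborel. ennreal (- g x) * indicator W' x = 0"
    by (subst (asm) nn_integral_0_iff_AE) auto
  then have "AE x in lborel. x \<notin> W'"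
    by eventually_elim (auto simp: W'_def B_def ennreal_eq_0_iff split: split_indicator_asm)
  then have "W' \<in> null_sets lborel" by (subst AE_iff_null_sets) auto
  then have "negligible W'" using negligible_iff_null_sets null_sets_completionI by blast
  moreover have "negligible (\<Union>n. Z n)" using WZ(2) by (intro negligible_countable_Union) auto
  moreover have "A \<subseteq> W' \<union> (\<Union>n. Z n)" using WZ(3) unfolding W'_def by blast
  ultimately show ?thesis unfolding A_def[symmetric] by (meson negligible_Un negligible_subset)
qed

lemma negligible_imp_AE_lborel: "negligible S \<Longrightarrow> AE x in lborel. x \<notin> S" for S :: "real set"
proof -
  assume "negligible S"
  then have "S \<in> null_sets lebesgue" by (simp add: negligible_iff_null_sets)
  then have "AE x in lebesgue. x \<notin> S" by (rule AE_not_in)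
  then show ?thesis by (simp add: AE_completion_iff)
qed

lemma AE_eventually_le_zero:
  assumes G: "has_increments G g"
  shows "AE x in lborel. g x < 0 \<longrightarrow> (\<exists>d>0. \<forall>a b. a < b \<longrightarrow> a \<le> x \<longrightarrow> x \<le> b \<longrightarrow> b - a < d \<longrightarrow> G b \<le> G a)"
proof -
  have "AE x in lborel. \<forall>N::nat. x \<notin> {x\<in>{-real N<..<N}. g x < 0 \<and> (\<forall>d>0. \<exists>a b. a < b \<and> a \<le> x \<and> x \<le> b \<and> b - a < d \<and> G a < G b)}"
    unfolding AE_all_countable by (intro allI negligible_imp_AE_lborel negligible_increasing_points G)
  then show ?thesis
  proof eventually_elim
    case (elim x)
    obtain N :: nat where "\<bar>x\<bar> < real N" using reals_Archimedean2 by blast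
    then have "x \<in> {-real N<..<N}" by auto
    then have *: "\<not> (g x < 0 \<and> (\<forall>d>0. \<exists>a b. a < b \<and> a \<le> x \<and> x \<le> b \<and> b - a < d \<and> G a < G b))"
      using elim[rule_format, of N] by blast
    show ?case
    proof
      assume "g x < 0"
      then obtain d where d: "d > 0" "\<not> (\<exists>a b. a < b \<and> a \<le> x \<and> x \<le> b \<and> b - a < d \<and> G a < G b)" using * by blast
      have "G b \<le> G a" if "a < b" "a \<le> x" "x \<le> b" "b - a < d" for a b
        using d(2) that by (meson not_less)
      then show "\<exists>d>0. \<forall>a b. a < b \<longrightarrow> a \<le> x \<longrightarrow> x \<le> b \<longrightarrow> b - a < d \<longrightarrow> G b \<le> G a"
        using d(1) by blast
    qed
  qed
qed

text \<open>\<open>F\<close> is compared with all lines of rational slope r. If f x < r, then F - r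
  * x does not increase on short intervals around x, so difference quotients stay below r; slopes
  below f x are treated symmetrically. Countability of the slopes leaves a single null set.\<close>

theorem has_increments_DERIV:
  assumes F: "has_increments F f"
  shows "AE x in lborel. (F has_real_derivative f x) (at x)"
proof -
  have A: "AE x in lborel. \<forall>r\<in>\<rat>. f x - r < 0 \<longrightarrow> (\<exists>d>0. \<forall>a b. a < b \<longrightarrow> a \<le> x \<longrightarrow> x \<le> b \<longrightarrow> b - a < d \<longrightarrow> F b - r * b \<le> F a - r * a)"
    using AE_eventually_le_zero[OF has_increments_add[OF F has_increments_linear[of "- r" for r]]]
    by (subst AE_ball_countable) (auto simp: countable_rat)
  have B: "AE x in lborel. \<forall>r\<in>\<rat>. r - f x < 0 \<longrightarrow> (\<exists>d>0. \<forall>a b. a < b \<longrightarrow> a \<le> x \<longrightarrow> x \<le> b \<longrightarrow> b - a < d \<longrightarrow> r * b - F b \<le> r * a - F a)"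
    using AE_eventually_le_zero[OF has_increments_add[OF has_increments_linear[of "r" for r] has_increments_uminus[OF F]]]
    by (subst AE_ball_countable) (auto simp: countable_rat)
  from A B show ?thesis
  proof eventually_elim
    case (elim x)
    show ?case unfolding has_field_derivative_iff LIM_eq
    proof (intro allI impI)
      fix e :: real assume "e > 0"
      obtain r where r: "r \<in> \<rat>" "f x < r" "r < f x + e" using Rats_dense_in_real[of "f x" "f x + e"] \<open>e > 0\<close> by auto
      obtain s where s: "s \<in> \<rat>" "f x - e < s" "s < f x" using Rats_dense_in_real[of "f x - e" "f x"] \<open>e > 0\<close> by auto
      obtain d1 where d1: "d1 > 0" "\<And>a b. a < b \<Longrightarrow> a \<le> x \<Longrightarrow> x \<le> b \<Longrightarrow> b - a < d1 \<Longrightarrow> F b - r * b \<le> F a - r * a"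
        using elim(1)[rule_format, OF r(1)] r by auto
      obtain d2 where d2: "d2 > 0" "\<And>a b. a < b \<Longrightarrow> a \<le> x \<Longrightarrow> x \<le> b \<Longrightarrow> b - a < d2 \<Longrightarrow> s * b - F b \<le> s * a - F a"
        using elim(2)[rule_format, OF s(1)] s by auto
      have "norm ((F y - F x) / (y - x) - f x) < e" if y: "y \<noteq> x \<and> norm (y - x) < min d1 d2" for y
      proof -
        have "s \<le> (F y - F x) / (y - x) \<and> (F y - F x) / (y - x) \<le> r"
        proof (cases "x < y")
          case True
          then show ?thesis using d1(2)[of x y] d2(2)[of x y] y by (auto simp: field_simps)
        next
          case False
          then have "y < x" using y by auto
          then show ?thesis using d1(2)[of y x] d2(2)[of y x] y by (auto simp: field_simps)
        qed
        then show ?thesis using r s by (auto simp: abs_if)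
      qed
      then show "\<exists>d>0. \<forall>y. y \<noteq> x \<and> norm (y - x) < d \<longrightarrow> norm ((F y - F x) / (y - x) - f x) < e"
        using d1(1) d2(1) by (intro exI[of _ "min d1 d2"]) auto
    qed
  qed
qed

lemma has_increments_unique:
  assumes "has_increments F f" "has_increments F g"
  shows "AE x in lborel. f x = g x"
  using has_increments_DERIV[OF assms(1)] has_increments_DERIV[OF assms(2)]
  by eventually_elim (rule DERIV_unique)

subsection \<open>Absolutely continuous monotone maps\<close>

lemma abs_continuous_onD:
  assumes "abs_continuous_on S f" "e > 0"
  obtains d where "d > 0"
    "\<And>n a b. (\<And>i. i < n \<Longrightarrow> a i \<le> b i \<and> {a i..b i} \<subseteq> S) \<Longrightarrow>
        disjoint_family_on (\<lambda>i. {a i<..<b i}) {..<n::nat} \<Longrightarrow> (\<Sum>i<n. b i - a i) < d \<Longrightarrow> (\<Sum>i<n. \<bar>f (b i) - f (a i)\<bar>) < e"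
proof -
  from assms(1)[unfolded abs_continuous_on_def, rule_format, OF assms(2)]
  obtain d where d: "d > 0" "\<forall>n a b. (\<forall>i<n. a i \<le> b i \<and> {a i..b i} \<subseteq> S) \<and>
        disjoint_family_on (\<lambda>i. {a i<..<b i}) {..<n::nat} \<and> (\<Sum>i<n. b i - a i) < d \<longrightarrow> (\<Sum>i<n. \<bar>f (b i) - f (a i)\<bar>) < e"
    by (elim exE conjE)
  show thesis by (rule that[OF d(1)]) (use d(2) in simp)
qed

lemma abs_continuous_imp_continuous:
  assumes "abs_continuous_on UNIV \<psi>" shows "continuous_on UNIV \<psi>"
proof -
  have "isCont \<psi> x" for x
    unfolding continuous_at_eps_delta
  proof (intro allI impI)
    fix e :: real assume "e > 0"
    from abs_continuous_onD[OF assms this] obtain d where d: "d > 0" "\<And>n a b. (\<And>i. i < n \<Longrightarrow> a i \<le> b i \<and> {a i..b i} \<subseteq> UNIV) \<Longrightarrow>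
        disjoint_family_on (\<lambda>i. {a i<..<b i}) {..<n::nat} \<Longrightarrow> (\<Sum>i<n. b i - a i) < d \<Longrightarrow> (\<Sum>i<n. \<bar>\<psi> (b i) - \<psi> (a i)\<bar>) < e"
      by blast
    have "\<bar>\<psi> y - \<psi> x\<bar> < e" if "\<bar>y - x\<bar> < d" for y
    proof (cases "x \<le> y")
      case True
      then show ?thesis using d(2)[of 1 "\<lambda>_. x" "\<lambda>_. y"] that by (auto simp: disjoint_family_on_def)
    next
      case False
      then show ?thesis using d(2)[of 1 "\<lambda>_. y" "\<lambda>_. x"] that
        by (auto simp: disjoint_family_on_def abs_minus_commute)
    qed
    then show "\<exists>d>0. \<forall>x'. dist x' x < d \<longrightarrow> dist (\<psi> x') (\<psi> x) < e"
      using d(1) by (auto simp: dist_real_def)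
  qed
  then show ?thesis by (simp add: continuous_on_eq_continuous_at)
qed

text \<open>Radon-Nikodym for the Stieltjes measure of \<psi>. Its absolute continuity with respect
  to Lebesgue measure is obtained from the epsilon-delta condition by covering a bounded null set
  with nonoverlapping intervals of total length below d.\<close>

lemma abs_continuous_has_density:
  assumes ac: "abs_continuous_on UNIV \<psi>" and m: "mono \<psi>"
  obtains p where "has_density \<psi> p"
proof -
  have cont: "continuous_on UNIV \<psi>" by (rule abs_continuous_imp_continuous[OF ac])
  have rc: "continuous (at_right a) \<psi>" for a
    using cont by (meson continuous_on_eq_continuous_within continuous_within_subset subset_UNIV UNIV_I)
  define \<mu> where "\<mu> = interval_measure \<psi>"
  have sets_mu [measurable_cong]: "sets \<mu> = sets borel" by (simp add: \<mu>_def)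
  have Icc: "emeasure \<mu> {a..b} = ennreal (\<psi> b - \<psi> a)" if "a \<le> b" for a b
    unfolding \<mu>_def using that m cont by (intro emeasure_interval_measure_Icc) (auto simp: mono_def)
  have Ioc: "emeasure \<mu> {a<..b} = ennreal (\<psi> b - \<psi> a)" if "a \<le> b" for a b
    unfolding \<mu>_def using that m rc by (intro emeasure_interval_measure_Ioc) (auto simp: mono_def)
  have bounded_null: "emeasure \<mu> S \<le> ennreal e" if S: "S \<in> null_sets lborel" "S \<subseteq> cbox u v" and e: "e > 0" for S u v e
  proof -
    from abs_continuous_onD[OF ac e] obtain d where d: "d > 0" "\<And>n a b. (\<And>i. i < n \<Longrightarrow> a i \<le> b i \<and> {a i..b i} \<subseteq> UNIV) \<Longrightarrow>
        disjoint_family_on (\<lambda>i. {a i<..<b i}) {..<n::nat} \<Longrightarrow> (\<Sum>i<n. b i - a i) < d \<Longrightarrow> (\<Sum>i<n. \<bar>\<psi> (b i) - \<psi> (a i)\<bar>) < e"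
      by blast
    have S': "S \<in> null_sets lebesgue" using S(1) by (rule null_sets_completionI)
    then have lm: "S \<in> lmeasurable" by (simp add: negligible_iff_null_sets[symmetric] negligible_imp_measurable)
    obtain D where D: "countable D" "\<And>K. K \<in> D \<Longrightarrow> K \<subseteq> cbox u v \<and> K \<noteq> {} \<and> (\<exists>c d. K = cbox c d)"
        "pairwise (\<lambda>A B. interior A \<inter> interior B = {}) D"
        "S \<subseteq> \<Union>D" "\<Union>D \<in> lmeasurable" "measure lebesgue (\<Union>D) \<le> measure lebesgue S + d/2"
      using measurable_outer_intervals_bounded[OF lm S(2), of "d/2"] d(1) by (metis half_gt_zero)
    have mS: "measure lebesgue S = 0" using S' by (auto simp: measure_def)
    \<comment> \<open>The epsilon-delta condition speaks of finitely many intervals only, so finite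
      subfamilies are bounded here and the countable cover is reached as an increasing
      union.\<close>
    have fin: "emeasure \<mu> (\<Union>E) \<le> ennreal e" if E: "finite E" "E \<subseteq> D" for E
    proof -
      obtain h :: "nat \<Rightarrow> real set" where h: "bij_betw h {..<card E} E"
        using ex_bij_betw_nat_finite[OF E(1)] by (auto simp: lessThan_atLeast0)
      have "\<exists>a b. a \<le> b \<and> K = {a..b}" if "K \<in> E" for K
      proof -
        have "K \<in> D" using E that by blast
        from D(2)[OF this] obtain c d where cd: "K = cbox c d" "K \<noteq> {}" by blast
        then show ?thesis by (intro exI[of _ c] exI[of _ d]) auto
      qed
      then obtain l r where lr: "\<And>K. K \<in> E \<Longrightarrow> l K \<le> r K \<and> K = {l K..r K}" by metis
      have hE: "h i \<in> E" if "i < card E" for i using h that by (auto simp: bij_betw_def)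
      have inj: "inj_on h {..<card E}" using h by (auto simp: bij_betw_def)
      have int: "interior K = {l K<..<r K}" if "K \<in> E" for K
        using lr[OF that] by (metis interior_atLeastAtMost_real)
      have dis: "disjoint_family_on (\<lambda>i. {l (h i)<..<r (h i)}) {..<card E}"
        unfolding disjoint_family_on_def
      proof (intro ballI impI)
        fix i j assume ij: "i \<in> {..<card E}" "j \<in> {..<card E}" "i \<noteq> j"
        then have "h i \<noteq> h j" using inj by (auto simp: inj_on_def)
        then have "interior (h i) \<inter> interior (h j) = {}"
          using D(3) hE[of i] hE[of j] ij E by (auto simp: pairwise_def)
        then show "{l (h i)<..<r (h i)} \<inter> {l (h j)<..<r (h j)} = {}"
          using int[OF hE[of i]] int[OF hE[of j]] ij by auto
      qed
      \<comment> \<open>Two of the intervals meet at most in endpoints, so lengths add up.\<close>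
      have neg: "pairwise (\<lambda>S T. negligible (S \<inter> T)) E"
        unfolding pairwise_def
      proof (intro ballI impI)
        fix A B assume AB: "A \<in> E" "B \<in> E" "A \<noteq> B"
        then have "interior A \<inter> interior B = {}" using D(3) E by (auto simp: pairwise_def)
        then have e: "{l A<..<r A} \<inter> {l B<..<r B} = {}" using int AB by auto
        have "A \<inter> B \<subseteq> {l A, r A, l B, r B}"
        proof
          fix x assume "x \<in> A \<inter> B"
          then have "x \<in> {l A..r A}" "x \<in> {l B..r B}" using lr AB by auto
          moreover have "x \<notin> {l A<..<r A} \<inter> {l B<..<r B}" using e by auto
          ultimately show "x \<in> {l A, r A, l B, r B}" by auto
        qed
        then show "negligible (A \<inter> B)" by (meson finite.emptyI finite.insertI negligible_finite negligible_subset)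
      qed
      have "(\<Sum>i<card E. r (h i) - l (h i)) = (\<Sum>K\<in>E. r K - l K)"
        by (rule sum.reindex_bij_betw[OF h])
      also have "\<dots> = (\<Sum>K\<in>E. measure lebesgue K)"
      proof (rule sum.cong[OF refl])
        fix K assume "K \<in> E"
        then have "l K \<le> r K" "K = {l K..r K}" using lr by auto
        then show "r K - l K = measure lebesgue K" by (metis measure_completion measure_lborel_Icc sets_lborel atLeastAtMost_borel)
      qed
      also have "\<dots> = measure lebesgue (\<Union>E)"
        using D E neg by (intro measure_negligible_finite_Union[symmetric]) auto
      also have "\<dots> \<le> measure lebesgue (\<Union>D)"
      proof (rule measure_mono_fmeasurable)
        have "K \<in> sets lebesgue" if "K \<in> E" for K using lr[OF that] by (metis atLeastAtMost_borel sets_completionI_sets sets_lborel)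
        then show "\<Union>E \<in> sets lebesgue" using E by blast
      qed (use D E in auto)
      also have "\<dots> < d" using D(6) mS d(1) by simp
      finally have sm: "(\<Sum>i<card E. \<bar>\<psi> (r (h i)) - \<psi> (l (h i))\<bar>) < e"
        using dis lr hE by (intro d(2)) auto
      have "emeasure \<mu> (\<Union>E) = emeasure \<mu> (\<Union>i\<in>{..<card E}. h i)" using h by (auto simp: bij_betw_def)
      also have "\<dots> \<le> (\<Sum>i<card E. emeasure \<mu> (h i))"
      proof (rule emeasure_subadditive_finite)
        show "h ` {..<card E} \<subseteq> sets \<mu>" using lr hE by (auto simp: sets_mu) (metis borel_closed closed_atLeastAtMost)
      qed auto
      also have "\<dots> = (\<Sum>i<card E. ennreal \<bar>\<psi> (r (h i)) - \<psi> (l (h i))\<bar>)"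
      proof (rule sum.cong[OF refl])
        fix i assume "i \<in> {..<card E}"
        then have "l (h i) \<le> r (h i)" "h i = {l (h i)..r (h i)}" using lr hE by auto
        then show "emeasure \<mu> (h i) = ennreal \<bar>\<psi> (r (h i)) - \<psi> (l (h i))\<bar>"
          using Icc[of "l (h i)" "r (h i)"] monoD[OF m, of "l (h i)" "r (h i)"] by auto
      qed
      also have "\<dots> \<le> ennreal e" using sm by (subst sum_ennreal) (auto intro: ennreal_leI)
      finally show ?thesis .
    qed
    have "emeasure \<mu> S \<le> emeasure \<mu> (\<Union>D)"
    proof (rule emeasure_mono)
      have "K \<in> sets borel" if "K \<in> D" for K using D(2)[OF that] by auto
      then show "\<Union>D \<in> sets \<mu>" using D(1) by (auto simp: sets_mu intro!: sets.countable_Union)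
    qed (rule D(4))
    also have "\<dots> \<le> ennreal e"
    proof (cases "D = {}")
      case False
      have "\<Union>D = (\<Union>n. \<Union>(from_nat_into D ` {..<n}))"
        using range_from_nat_into[OF False D(1)] by auto (metis UN_iff UNIV_I lessI lessThan_iff rangeE)
      moreover have "(SUP n. emeasure \<mu> (\<Union>(from_nat_into D ` {..<n}))) = emeasure \<mu> (\<Union>n. \<Union>(from_nat_into D ` {..<n}))"
      proof (rule SUP_emeasure_incseq)
        show "incseq (\<lambda>n. \<Union>(from_nat_into D ` {..<n}))" by (fastforce simp: incseq_def intro: less_le_trans)
        have "from_nat_into D i \<in> sets borel" for i
          using D(2)[OF from_nat_into[OF False, of i]] by auto
        then show "range (\<lambda>n. \<Union>(from_nat_into D ` {..<n})) \<subseteq> sets \<mu>"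
          by (auto simp: sets_mu intro!: sets.finite_UN)
      qed
      moreover have "(SUP n. emeasure \<mu> (\<Union>(from_nat_into D ` {..<n}))) \<le> ennreal e"
        by (intro SUP_least fin) (auto intro: from_nat_into[OF False])
      ultimately show ?thesis by simp
    qed simp
    finally show ?thesis .
  qed
  have acm: "absolutely_continuous lborel \<mu>"
    unfolding absolutely_continuous_def
  proof
    fix S :: "real set" assume S: "S \<in> null_sets lborel"
    have "S \<inter> cbox (- real n) n \<in> null_sets \<mu>" for n
    proof -
      have nS: "S \<inter> cbox (- real n) n \<in> null_sets lborel" using S by (intro null_set_Int2) auto
      have "emeasure \<mu> (S \<inter> cbox (- real n) n) \<le> 0"
        by (rule ennreal_le_epsilon) (use bounded_null[OF nS] in auto)
      then show ?thesis using nS by (auto simp: null_sets_def sets_mu)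
    qed
    then have "(\<Union>n. S \<inter> cbox (- real n) n) \<in> null_sets \<mu>" by (rule null_sets_UN)
    moreover have "(\<Union>n. S \<inter> cbox (- real n) n) = S"
    proof (intro equalityI subsetI)
      fix x assume "x \<in> S"
      moreover obtain n :: nat where "\<bar>x\<bar> < n" using reals_Archimedean2 by blast
      ultimately show "x \<in> (\<Union>n. S \<inter> cbox (- real n) n)" by (auto intro!: exI[of _ n])
    qed auto
    ultimately show "S \<in> null_sets \<mu>" by simp
  qed
  have sf: "sigma_finite_measure \<mu>"
    unfolding \<mu>_def using m rc by (intro sigma_finite_interval_measure) (auto simp: mono_def)
  let ?f = "RN_deriv lborel \<mu>"
  have dens: "density lborel ?f = \<mu>"
    by (intro sigma_finite_measure.density_RN_deriv[OF sigma_finite_lborel] acm sets_mu[simplified]) (simp add: sets_mu)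
  have finAE: "AE x in lborel. ?f x \<noteq> \<infinity>"
    by (intro sigma_finite_measure.RN_deriv_finite[OF sigma_finite_lborel] sf acm) (simp add: sets_mu)
  have "has_density \<psi> (\<lambda>x. enn2real (?f x))"
    unfolding has_density_def
  proof (intro conjI allI impI)
    fix a b :: real assume ab: "a \<le> b"
    have "(\<integral>\<^sup>+x. ennreal (enn2real (?f x)) * indicator {a<..b} x \<partial>lborel) = (\<integral>\<^sup>+x. ?f x * indicator {a<..b} x \<partial>lborel)"
      using finAE by (intro nn_integral_cong_AE) (auto simp: less_top)
    also have "\<dots> = emeasure (density lborel ?f) {a<..b}" by (subst emeasure_density) auto
    also have "\<dots> = ennreal (\<psi> b - \<psi> a)" by (simp add: dens Ioc ab)
    finally show "(\<integral>\<^sup>+x. ennreal (enn2real (?f x)) * indicator {a<..b} x \<partial>lborel) = ennreal (\<psi> b - \<psi> a)" .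
  qed (use m in auto)
  then show thesis by (rule that)
qed

lemma Lipschitz_abs_continuous:
  assumes "\<And>x y. x \<le> y \<Longrightarrow> \<bar>f y - f x\<bar> \<le> L * (y - x)"
  shows "abs_continuous_on S f"
  unfolding abs_continuous_on_def
proof (intro allI impI)
  fix e :: real assume e: "e > 0"
  let ?d = "e / (\<bar>L\<bar> + 1)"
  have "(\<Sum>i<n. \<bar>f (b i) - f (a i)\<bar>) < e"
    if h: "(\<forall>i<n. a i \<le> b i \<and> {a i..b i} \<subseteq> S) \<and> disjoint_family_on (\<lambda>i. {a i<..<b i}) {..<n} \<and> (\<Sum>i<n. b i - a i) < ?d"
    for n :: nat and a b
  proof -
    have "(\<Sum>i<n. \<bar>f (b i) - f (a i)\<bar>) \<le> (\<Sum>i<n. (\<bar>L\<bar> + 1) * (b i - a i))"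
    proof (rule sum_mono)
      fix i assume "i \<in> {..<n}"
      then have ab: "a i \<le> b i" using h by auto
      have "\<bar>f (b i) - f (a i)\<bar> \<le> L * (b i - a i)" by (rule assms[OF ab])
      also have "\<dots> \<le> (\<bar>L\<bar> + 1) * (b i - a i)" using ab by (intro mult_right_mono) auto
      finally show "\<bar>f (b i) - f (a i)\<bar> \<le> (\<bar>L\<bar> + 1) * (b i - a i)" .
    qed
    also have "\<dots> = (\<bar>L\<bar> + 1) * (\<Sum>i<n. b i - a i)" by (simp add: sum_distrib_left)
    also have "\<dots> < (\<bar>L\<bar> + 1) * ?d" using h by (intro mult_strict_left_mono) auto
    also have "\<dots> = e" by simp
    finally show ?thesis .
  qed
  then show "\<exists>d>0. \<forall>n a b. (\<forall>i<n. a i \<le> b i \<and> {a i..b i} \<subseteq> S) \<and> disjoint_family_on (\<lambda>i. {a i<..<b i}) {..<n::nat} \<and>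
        (\<Sum>i<n. b i - a i) < d \<longrightarrow> (\<Sum>i<n. \<bar>f (b i) - f (a i)\<bar>) < e"
    using e by (intro exI[of _ ?d]) auto
qed

subsection \<open>A smooth step function\<close>

text \<open>All derivatives of the standard bump exp (- 1 / (1 - x^2)), extended by zero, have this
  form. The family is closed under differentiation, so smoothness follows from one derivative
  rule.\<close>

definition bumpf :: "nat \<Rightarrow> real poly \<Rightarrow> real \<Rightarrow> real" where
  "bumpf m p x = (if \<bar>x\<bar> < 1 then poly p x * (1 / (1 - x\<^sup>2)) ^ m * exp (- (1 / (1 - x\<^sup>2))) else 0)"

text \<open>With q = 1 / (1 - y^2) and n = m + 2, exp q dominates a multiple of q^n; the two spare
  powers of q supply the factor (1 - y^2)^2, and 1 - y^2 \<le> 2 * |y - x|. A quadratic bound forces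
  derivative zero at every x outside the open interval, the endpoints -1 and 1 included.\<close>

lemma bumpf_bound:
  obtains K where "K \<ge> 0" "\<And>x y. \<bar>x\<bar> \<ge> 1 \<Longrightarrow> \<bar>bumpf m p y\<bar> \<le> K * (y - x)\<^sup>2"
proof -
  have "compact (poly p ` {-1..1})" by (intro compact_continuous_image continuous_intros) auto
  then obtain B where B: "\<And>y. y \<in> {-1..1} \<Longrightarrow> \<bar>poly p y\<bar> \<le> B"
    using compact_imp_bounded by (fastforce simp: bounded_iff)
  have B0: "B \<ge> 0" using B[of 0] by auto
  define C where "C = real (m+2) ^ (m+2)"
  have "\<bar>bumpf m p y\<bar> \<le> (4 * B * C) * (y - x)\<^sup>2" if x: "\<bar>x\<bar> \<ge> 1" for x y
  proof (cases "\<bar>y\<bar> < 1")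
    case True
    define q where "q = 1 / (1 - y\<^sup>2)"
    have y1: "0 < 1 - y\<^sup>2" using True by (simp add: abs_square_less_1)
    then have q: "q > 0" by (simp add: q_def)
    \<comment> \<open>The constant C = (m + 2)^(m + 2) stems from exp q \<ge> (1 + q / n)^n with n =
      m + 2.\<close>
    have "(q / real (m+2)) ^ (m+2) \<le> (1 + q / real (m+2)) ^ (m+2)" using q by (intro power_mono) auto
    also have "\<dots> \<le> exp q" using q by (intro exp_ge_one_plus_x_over_n_power_n) auto
    finally have "q ^ (m+2) / C \<le> exp q" by (simp only: power_divide C_def)
    then have "q ^ (m+2) \<le> exp q * C" by (subst (asm) pos_divide_le_eq) (auto simp: C_def)
    then have "q ^ m * exp (- q) * q\<^sup>2 \<le> C" by (simp add: exp_minus field_simps power_add power2_eq_square)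
    then have qe: "q ^ m * exp (- q) \<le> C * (1 - y\<^sup>2)\<^sup>2" using y1 q by (simp add: q_def field_simps)
    have "\<bar>bumpf m p y\<bar> = \<bar>poly p y\<bar> * (q ^ m * exp (- q))"
      using True q by (simp add: bumpf_def q_def[symmetric] abs_mult)
    also have "\<dots> \<le> B * (C * (1 - y\<^sup>2)\<^sup>2)"
    proof (rule mult_mono[OF _ qe B0])
      show "\<bar>poly p y\<bar> \<le> B" using True by (intro B) auto
    qed (use q in auto)
    also have "\<dots> \<le> B * (C * (2 * \<bar>y - x\<bar>)\<^sup>2)"
    proof -
      have "1 - y\<^sup>2 = (1 - \<bar>y\<bar>) * (1 + \<bar>y\<bar>)" by (simp add: algebra_simps power2_eq_square)
      also have "\<dots> \<le> (1 - \<bar>y\<bar>) * 2" using True by (intro mult_left_mono) auto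
      also have "\<dots> \<le> 2 * \<bar>y - x\<bar>" 
      proof -
        have "1 - \<bar>y\<bar> \<le> \<bar>y - x\<bar>" by (rule order_trans[OF _ abs_triangle_ineq2_sym]) (use x in simp)
        then show ?thesis by simp
      qed
      finally show ?thesis using B0 y1 by (intro mult_left_mono power_mono) (auto simp: C_def)
    qed
    also have "\<dots> = (4 * B * C) * (y - x)\<^sup>2" by (simp add: power_mult_distrib)
    finally show ?thesis .
  next
    case False
    then show ?thesis using B0 by (simp add: bumpf_def C_def)
  qed
  then show thesis using B0 by (intro that[of "4 * B * C"]) (auto simp: C_def)
qed

lemma DERIV_zero_of_square_bound:
  fixes f :: "real \<Rightarrow> real"
  assumes "\<And>y. \<bar>f y\<bar> \<le> K * (y - x)\<^sup>2"
  shows "(f has_real_derivative 0) (at x)"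
proof -
  have fx: "f x = 0" using assms[of x] by simp
  have "((\<lambda>y. (f y - f x) / (y - x)) \<longlongrightarrow> 0) (at x)"
  proof (rule Lim_null_comparison)
    show "\<forall>\<^sub>F y in at x. norm ((f y - f x) / (y - x)) \<le> K * \<bar>y - x\<bar>"
      unfolding eventually_at
    proof (intro exI[of _ 1] conjI ballI impI)
      fix y assume "y \<noteq> x \<and> dist y x < 1"
      then have "\<bar>y - x\<bar> > 0" by auto
      then show "norm ((f y - f x) / (y - x)) \<le> K * \<bar>y - x\<bar>"
        using assms[of y] by (simp add: fx divide_le_eq power2_eq_square abs_mult_self mult.assoc)
    qed auto
    have "((\<lambda>y. K * \<bar>y - x\<bar>) \<longlongrightarrow> K * \<bar>x - x\<bar>) (at x)" by (intro tendsto_intros)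
    then show "((\<lambda>y. K * \<bar>y - x\<bar>) \<longlongrightarrow> 0) (at x)" by simp
  qed
  then show ?thesis by (simp add: has_field_derivative_iff)
qed

text \<open>Numerator of the derivative over the common denominator (1 - x^2)^(m + 2); the
  polynomial \<open>[:1, 0, -1:]\<close> is 1 - x^2.\<close>

definition bump_next :: "nat \<Rightarrow> real poly \<Rightarrow> real poly" where
  "bump_next m p = pderiv p * [:1, 0, -1:]\<^sup>2 + [:0, 2 * real m:] * p * [:1, 0, -1:] - [:0, 2:] * p"

lemma DERIV_bumpf: "(bumpf m p has_real_derivative bumpf (m + 2) (bump_next m p) x) (at x)"
proof (cases "\<bar>x\<bar> < 1")
  case False
  obtain K where "\<And>x y. \<bar>x\<bar> \<ge> 1 \<Longrightarrow> \<bar>bumpf m p y\<bar> \<le> K * (y - x)\<^sup>2" using bumpf_bound by blast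
  then have "(bumpf m p has_real_derivative 0) (at x)"
    using False by (intro DERIV_zero_of_square_bound[of _ K]) auto
  then show ?thesis using False by (simp add: bumpf_def)
next
  case True
  define w where "w = 1 - x\<^sup>2"
  have w: "w > 0" using True by (simp add: abs_square_less_1 w_def)
  have "((\<lambda>x. poly p x * (1 / (1 - x\<^sup>2)) ^ m * exp (- (1 / (1 - x\<^sup>2)))) has_real_derivative
     (poly (pderiv p) x * (1/w)^m + poly p x * (real m * (1/w)^(m - 1) * (2 * x / w\<^sup>2))) * exp (- (1/w))
       + poly p x * (1/w)^m * (exp (- (1/w)) * (- (2 * x / w\<^sup>2)))) (at x)"
    using w unfolding w_def
    by (auto intro!: derivative_eq_intros poly_DERIV simp: power2_eq_square) (simp_all add: field_simps)
  moreover have "(poly (pderiv p) x * (1/w)^m + poly p x * (real m * (1/w)^(m - 1) * (2 * x / w\<^sup>2))) * exp (- (1/w))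
       + poly p x * (1/w)^m * (exp (- (1/w)) * (- (2 * x / w\<^sup>2)))
     = (poly (pderiv p) x * w\<^sup>2 + 2 * real m * x * poly p x * w - 2 * x * poly p x) * (1/w)^(m+2) * exp (- (1/w))"
  proof (cases m)
    case 0
    then show ?thesis using w by (simp add: field_simps power2_eq_square)
  next
    case (Suc k)
    then show ?thesis using w by (simp add: field_simps power2_eq_square)
  qed
  moreover have "poly (bump_next m p) x = poly (pderiv p) x * w\<^sup>2 + 2 * real m * x * poly p x * w - 2 * x * poly p x"
    by (simp add: bump_next_def w_def power2_eq_square algebra_simps)
  ultimately have "((\<lambda>x. poly p x * (1 / (1 - x\<^sup>2)) ^ m * exp (- (1 / (1 - x\<^sup>2)))) has_real_derivative bumpf (m+2) (bump_next m p) x) (at x)"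
    using True by (simp add: bumpf_def w_def)
  moreover have "open {x::real. \<bar>x\<bar> < 1}" by (intro open_Collect_less continuous_intros)
  ultimately show ?thesis
    by (rule has_field_derivative_transform_within_open) (use True in \<open>auto simp: bumpf_def\<close>)
qed

primrec bump_poly :: "nat \<Rightarrow> real poly" where
  "bump_poly 0 = 1"
| "bump_poly (Suc n) = bump_next (2 * n) (bump_poly n)"

definition bump :: "real \<Rightarrow> real" where "bump = bumpf 0 1"

lemma continuous_bump: "continuous_on S bump"
proof -
  have "isCont bump x" for x unfolding bump_def by (rule DERIV_isCont[OF DERIV_bumpf])
  then show ?thesis by (simp add: continuous_at_imp_continuous_on)
qed

lemma bump_nonneg: "0 \<le> bump x" by (simp add: bump_def bumpf_def)
lemma bump_zero: "\<bar>x\<bar> \<ge> 1 \<Longrightarrow> bump x = 0" by (simp add: bump_def bumpf_def)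

definition bump_mass :: real where "bump_mass = integral {-2..1} bump"

lemma bump_mass_pos: "bump_mass > 0"
proof -
  have i: "(bump has_integral bump_mass) (cbox (-2) 1)"
    unfolding bump_mass_def using continuous_bump by (auto intro!: integrable_integral integrable_continuous_real)
  have "bump_mass \<ge> 0" by (rule has_integral_nonneg[OF i]) (simp add: bump_nonneg)
  moreover have "bump_mass \<noteq> 0"
  proof
    assume "bump_mass = 0"
    then have "bump 0 = 0" using i
      by (intro has_integral_0_cbox_imp_0[of "-2" 1 bump]) (auto simp: continuous_bump bump_nonneg)
    then show False by (simp add: bump_def bumpf_def)
  qed
  ultimately show ?thesis by simp
qed

definition mollifier :: "real \<Rightarrow> real" where "mollifier x = bump x / bump_mass"

text \<open>The base point -2 lies strictly to the left of the support [-1, 1], so that for s \<ge>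
  -1 the derivative of the integral is two-sided.\<close>

definition smooth_step :: "real \<Rightarrow> real" where "smooth_step s = integral {-2..s} mollifier"

lemma continuous_mollifier: "continuous_on S mollifier"
  unfolding mollifier_def by (intro continuous_intros continuous_bump) (use bump_mass_pos in auto)

lemma mollifier_nonneg: "0 \<le> mollifier x" using bump_nonneg bump_mass_pos by (simp add: mollifier_def)
lemma mollifier_zero: "\<bar>x\<bar> \<ge> 1 \<Longrightarrow> mollifier x = 0" by (simp add: mollifier_def bump_zero)

lemma smooth_step_left: "s \<le> -1 \<Longrightarrow> smooth_step s = 0"
proof -
  assume "s \<le> -1"
  then have "integral {-2..s} mollifier = integral {-2..s} (\<lambda>_. 0)"
    by (intro integral_cong) (auto intro: mollifier_zero)
  then show ?thesis by (simp add: smooth_step_def)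
qed

lemma smooth_step_right: "s \<ge> 1 \<Longrightarrow> smooth_step s = 1"
proof -
  assume s: "s \<ge> 1"
  have "integral {-2..1} mollifier + integral {1..s} mollifier = integral {-2..s} mollifier"
    using s continuous_mollifier by (intro Henstock_Kurzweil_Integration.integral_combine) (auto intro: integrable_continuous_real)
  moreover have "integral {1..s} mollifier = integral {1..s} (\<lambda>_. 0)"
    by (intro integral_cong) (auto intro: mollifier_zero)
  moreover have "integral {-2..1} mollifier = 1"
    unfolding mollifier_def using bump_mass_pos by (simp add: bump_mass_def)
  ultimately show ?thesis by (simp add: smooth_step_def)
qed

lemma DERIV_smooth_step: "(smooth_step has_real_derivative mollifier s) (at s)"
proof (cases "s < -1")
  case True
  have "((\<lambda>_. 0) has_real_derivative mollifier s) (at s)" using True by (simp add: mollifier_zero)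
  then show ?thesis
    by (rule has_field_derivative_transform_within_open[where S="{..<-1}"]) (use True in \<open>auto simp: smooth_step_left\<close>)
next
  case False
  have "((\<lambda>x. integral {-2..x} mollifier) has_real_derivative mollifier s) (at s within {-2..s+1})"
    using False continuous_mollifier by (intro integral_has_real_derivative) auto
  moreover have "at s within {-2..s+1} = at s" using False by (intro at_within_interior) auto
  ultimately show ?thesis by (simp add: smooth_step_def[abs_def])
qed

lemma smooth_step_mono: "mono smooth_step"
proof (rule monoI)
  fix x y :: real assume "x \<le> y"
  then show "smooth_step x \<le> smooth_step y"
    by (rule DERIV_nonneg_imp_nondecreasing) (use DERIV_smooth_step mollifier_nonneg in blast)
qed

lemma smooth_step_bounds: "0 \<le> smooth_step s" "smooth_step s \<le> 1"
  using monoD[OF smooth_step_mono, of "min s (-1)" s] monoD[OF smooth_step_mono, of s "max s 1"]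
  by (auto simp: smooth_step_left smooth_step_right)

definition smooth_step_derivs :: "nat \<Rightarrow> real \<Rightarrow> real" where
  "smooth_step_derivs n = (case n of 0 \<Rightarrow> smooth_step | Suc k \<Rightarrow> (\<lambda>x. bumpf (2 * k) (bump_poly k) x / bump_mass))"

lemma DERIV_smooth_step_derivs: "(smooth_step_derivs n has_real_derivative smooth_step_derivs (Suc n) x) (at x)"
proof (cases n)
  case 0
  then show ?thesis using DERIV_smooth_step[of x]
    by (simp add: smooth_step_derivs_def mollifier_def bump_def one_pCons)
next
  case (Suc k)
  have "((\<lambda>x. bumpf (2 * k) (bump_poly k) x / bump_mass) has_real_derivative bumpf (2 * k + 2) (bump_next (2 * k) (bump_poly k)) x / bump_mass) (at x)"
    by (intro DERIV_cdivide DERIV_bumpf)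
  then show ?thesis using Suc by (simp add: smooth_step_derivs_def)
qed

lemma iterated_deriv_eq:
  fixes D :: "nat \<Rightarrow> real \<Rightarrow> real"
  assumes "D 0 = h" "\<And>n x. (D n has_real_derivative D (Suc n) x) (at x)"
  shows "(deriv ^^ n) h = D n"
proof (induction n)
  case (Suc n)
  have "deriv (D n) = D (Suc n)" using assms(2) by (auto intro!: ext DERIV_imp_deriv)
  then show ?case using Suc by simp
qed (use assms in simp)

text \<open>A smooth approximation of the indicator of the interval from \<open>a\<close> to
  \<open>b\<close>. Its derivative is a difference of two approximate point masses, so testing a
  distributional derivative with it recovers the increment of the function.\<close>

definition trapezoid :: "real \<Rightarrow> real \<Rightarrow> real \<Rightarrow> real \<Rightarrow> real" where
  "trapezoid e a b x = smooth_step ((x - a) / e) - smooth_step ((x - b) / e)"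

lemma trapezoid_deriv:
  assumes "e > 0"
  shows "(trapezoid e a b has_real_derivative (mollifier ((x - a) / e) - mollifier ((x - b) / e)) / e) (at x)"
  unfolding trapezoid_def[abs_def] using assms
  by (auto intro!: derivative_eq_intros DERIV_chain2[OF DERIV_smooth_step] simp: field_simps)

lemma trapezoid_outside:
  assumes "e > 0" "a \<le> b" "x \<le> a - e \<or> b + e \<le> x"
  shows "trapezoid e a b x = 0"
  using assms(3)
proof
  assume x: "x \<le> a - e"
  then have "(x - a) / e \<le> -1" "(x - b) / e \<le> -1" using assms by (auto simp: field_simps)
  then show ?thesis by (simp add: trapezoid_def smooth_step_left)
next
  assume x: "b + e \<le> x"
  then have "(x - a) / e \<ge> 1" "(x - b) / e \<ge> 1" using assms by (auto simp: field_simps)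
  then show ?thesis by (simp add: trapezoid_def smooth_step_right)
qed

lemma test_fun_trapezoid:
  assumes e: "e > 0" and ab: "a \<le> b"
  shows "test_fun (trapezoid e a b)"
proof -
  define D where "D n x = (smooth_step_derivs n ((x - a) / e) - smooth_step_derivs n ((x - b) / e)) / e ^ n" for n x
  have D: "(D n has_real_derivative D (Suc n) x) (at x)" for n x
    unfolding D_def[abs_def] using e
    by (auto intro!: derivative_eq_intros DERIV_chain2[OF DERIV_smooth_step_derivs] simp: field_simps)
  have D0: "D 0 = trapezoid e a b" by (auto simp: D_def trapezoid_def smooth_step_derivs_def)
  have "\<forall>n x. (deriv ^^ n) (trapezoid e a b) differentiable (at x)"
    unfolding iterated_deriv_eq[of D, OF D0 D] using D real_differentiable_def by blast
  moreover have "compact (closure {x. trapezoid e a b x \<noteq> 0})"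
  proof -
    have "{x. trapezoid e a b x \<noteq> 0} \<subseteq> {a - e..b + e}" 
    proof
      fix x assume "x \<in> {x. trapezoid e a b x \<noteq> 0}"
      then have "\<not> (x \<le> a - e \<or> b + e \<le> x)" using trapezoid_outside[OF e ab, of x] by auto
      then show "x \<in> {a - e..b + e}" by auto
    qed
    then show ?thesis by (meson bounded_closed_interval bounded_subset compact_closure)
  qed
  ultimately show ?thesis by (simp add: test_fun_def)
qed

section \<open>From distributional derivatives to increments\<close>

lemma L2_fun_local_integrable:
  assumes "L2_fun g" shows "integrable lborel (\<lambda>x. indicator {a..b} x * g x)" "integrable lborel (\<lambda>x. indicator {a<..b} x * g x)"
proof -
  have [measurable]: "g \<in> borel_measurable borel" and i: "integrable lborel (\<lambda>x. (g x)\<^sup>2)" using assms by (auto simp: L2_fun_def)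
  have i2: "integrable lborel (\<lambda>x. indicator {a..b} x + (g x)\<^sup>2)"
    by (intro Bochner_Integration.integrable_add i integrable_real_indicator) (auto simp: emeasure_lborel_Icc_eq)
  have le: "\<bar>g x\<bar> \<le> \<bar>1 + (g x)\<^sup>2\<bar>" for x
  proof -
    have "0 \<le> (\<bar>g x\<bar> - 1)\<^sup>2" by simp
    then have "2 * \<bar>g x\<bar> \<le> 1 + (g x)\<^sup>2" by (simp add: power2_diff)
    then have "\<bar>g x\<bar> \<le> 1 + (g x)\<^sup>2" using abs_ge_zero[of "g x"] by linarith
    then show ?thesis by simp
  qed
  from i2 show 1: "integrable lborel (\<lambda>x. indicator {a..b} x * g x)"
  proof (rule Bochner_Integration.integrable_bound)
    show "AE x in lborel. norm (indicator {a..b} x * g x) \<le> norm (indicator {a..b} x + (g x)\<^sup>2)"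
    proof (rule AE_I2)
      fix x show "norm (indicator {a..b} x * g x) \<le> norm (indicator {a..b} x + (g x)\<^sup>2)"
        using le[of x] by (cases "x \<in> {a..b}") simp_all
    qed
  qed measurable
  then show "integrable lborel (\<lambda>x. indicator {a<..b} x * g x)"
    by (rule Bochner_Integration.integrable_bound) (auto split: split_indicator)
qed

lemma mollifier_integral: "integrable lborel mollifier" "(LINT x|lborel. mollifier x) = 1"
proof -
  have [measurable]: "mollifier \<in> borel_measurable borel" using continuous_mollifier by (rule borel_measurable_continuous_onI)
  have "has_bochner_integral lborel (\<lambda>x. mollifier x * indicator {-2..2} x) (smooth_step 2 - smooth_step (-2))"
  proof (rule has_bochner_integral_FTC_Icc_real)
    show "isCont mollifier x" for x
      using continuous_mollifier[of UNIV] by (simp add: continuous_on_eq_continuous_at)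
    show "DERIV smooth_step x :> mollifier x" for x by (rule DERIV_smooth_step)
  qed auto
  moreover have "(\<lambda>x. mollifier x * indicator {-2..2} x) = mollifier"
    by (rule ext) (auto simp: mollifier_zero split: split_indicator)
  ultimately show "integrable lborel mollifier" "(LINT x|lborel. mollifier x) = 1"
    by (auto simp: has_bochner_integral_iff smooth_step_left smooth_step_right)
qed

lemma mollifier_limit:
  fixes f :: "real \<Rightarrow> real"
  assumes cont: "continuous_on UNIV f" and bdd: "bounded (range f)"
  shows "integrable lborel (\<lambda>x. f (a + (1 / Suc n) * x) * mollifier x)"
    and "(\<lambda>n. LINT x|lborel. f (a + (1 / Suc n) * x) * mollifier x) \<longlonglongrightarrow> f a"
proof -
  have [measurable]: "mollifier \<in> borel_measurable borel" "f \<in> borel_measurable borel"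
    using continuous_mollifier cont by (auto intro: borel_measurable_continuous_onI)
  obtain B where B: "\<And>x. \<bar>f x\<bar> \<le> B" using bdd by (auto simp: bounded_iff)
  have b: "norm (f z * mollifier x) \<le> B * mollifier x" for z x
    using B[of z] mollifier_nonneg[of x] by (simp add: abs_mult mult_right_mono)
  have iB: "integrable lborel (\<lambda>x. B * mollifier x)" using mollifier_integral by simp
  show "integrable lborel (\<lambda>x. f (a + (1 / Suc n) * x) * mollifier x)"
    by (rule Bochner_Integration.integrable_bound[OF iB]) (auto intro!: AE_I2 order_trans[OF b[unfolded real_norm_def]])
  have "(\<lambda>n. LINT x|lborel. f (a + (1 / Suc n) * x) * mollifier x) \<longlonglongrightarrow> (LINT x|lborel. f a * mollifier x)"
  proof (rule integral_dominated_convergence[OF _ _ iB])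
    show "AE x in lborel. (\<lambda>n. f (a + (1 / Suc n) * x) * mollifier x) \<longlonglongrightarrow> f a * mollifier x"
    proof (rule AE_I2)
      fix x :: real
      have "(\<lambda>n. a + (1 / Suc n) * x) \<longlonglongrightarrow> a + 0 * x"
        by (intro tendsto_intros LIMSEQ_Suc[OF lim_1_over_n, unfolded o_def])
      then have "(\<lambda>n. f (a + (1 / Suc n) * x)) \<longlonglongrightarrow> f a"
        using cont continuous_on_eq_continuous_at[of UNIV f] isCont_tendsto_compose[of a f] by auto
      then show "(\<lambda>n. f (a + (1 / Suc n) * x) * mollifier x) \<longlonglongrightarrow> f a * mollifier x"
        by (intro tendsto_intros)
    qed
  qed (use b in auto)
  then show "(\<lambda>n. LINT x|lborel. f (a + (1 / Suc n) * x) * mollifier x) \<longlonglongrightarrow> f a"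
    by (simp add: mollifier_integral)
qed

text \<open>Testing with trapezoids of width 1 / Suc n: by continuity of \<open>f\<close> one side
  tends to f a - f b, while the other tends to minus the integral of \<open>g\<close> over the
  interval by dominated convergence.\<close>

lemma L2_distr_deriv_increments:
  assumes cont: "continuous_on UNIV f" and bdd: "bounded (range f)" and d: "L2_distr_deriv f g"
  shows "has_increments f g"
  unfolding has_increments_def
proof (intro conjI allI impI)
  have L2: "L2_fun g" using d by (simp add: L2_distr_deriv_def)
  then show [measurable]: "g \<in> borel_measurable borel" by (simp add: L2_fun_def)
  have [measurable]: "mollifier \<in> borel_measurable borel" "f \<in> borel_measurable borel"
    using continuous_mollifier cont by (auto intro: borel_measurable_continuous_onI)
  fix a b :: real assume ab: "a \<le> b"
  show "has_bochner_integral lborel (\<lambda>x. indicator {a<..b} x * g x) (f b - f a)"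
  proof (cases "a = b")
    case True
    then show ?thesis by (simp add: has_bochner_integral_zero)
  next
    case False
    with ab have ab': "a < b" by simp
    define h where "h n = trapezoid (1 / Suc n) a b" for n
    have sub: "(LINT x|lborel. f x * (mollifier ((x - c) / (1 / Suc n)) / (1 / Suc n))) = (LINT x|lborel. f (c + (1 / Suc n) * x) * mollifier x)"
      and subi: "integrable lborel (\<lambda>x. f x * (mollifier ((x - c) / (1 / Suc n)) / (1 / Suc n)))" for c n
    proof -
      define e where "e = 1 / real (Suc n)"
      have e: "e > 0" by (simp add: e_def)
      let ?F = "\<lambda>x. f x * (mollifier ((x - c) / e) / e)"
      have F: "?F (c + e * x) = (f (c + e * x) * mollifier x) * (1 / e)" for x using e by simp
      show "(LINT x|lborel. f x * (mollifier ((x - c) / (1 / Suc n)) / (1 / Suc n))) = (LINT x|lborel. f (c + (1 / Suc n) * x) * mollifier x)"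
        unfolding e_def[symmetric]
        by (subst lborel_integral_real_affine[where c=e and t=c])
           (use e in \<open>simp_all only: F integral_mult_left_zero, auto\<close>)
      have "integrable lborel (\<lambda>x. ?F (c + e * x))"
        using mollifier_limit(1)[OF cont bdd, of c n] unfolding F e_def[symmetric] by simp
      then show "integrable lborel (\<lambda>x. f x * (mollifier ((x - c) / (1 / Suc n)) / (1 / Suc n)))"
        unfolding e_def[symmetric]
        by (subst (asm) lborel_integrable_real_affine_iff[where c=e and t=c]) (use e in auto)
    qed
    have "(LINT x|lborel. f x * deriv (h n) x) = (LINT x|lborel. f (a + (1 / Suc n) * x) * mollifier x) - (LINT x|lborel. f (b + (1 / Suc n) * x) * mollifier x)" for n
    proof -
      have dh: "deriv (h n) x = mollifier ((x - a) / (1 / Suc n)) / (1 / Suc n) - mollifier ((x - b) / (1 / Suc n)) / (1 / Suc n)" for x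
        unfolding h_def diff_divide_distrib[symmetric] by (rule DERIV_imp_deriv[OF trapezoid_deriv]) auto
      show ?thesis unfolding dh right_diff_distrib
        by (subst Bochner_Integration.integral_diff[OF subi subi]) (simp only: sub)
    qed
    moreover have "(LINT x|lborel. f x * deriv (h n) x) = - (LINT x|lborel. g x * h n x)" for n
      using d ab by (simp add: L2_distr_deriv_def h_def test_fun_trapezoid)
    ultimately have eq: "- (LINT x|lborel. g x * h n x) = (LINT x|lborel. f (a + (1 / Suc n) * x) * mollifier x) - (LINT x|lborel. f (b + (1 / Suc n) * x) * mollifier x)" for n
      by simp
    have lim1: "(\<lambda>n. - (LINT x|lborel. g x * h n x)) \<longlonglongrightarrow> f a - f b"
      unfolding eq by (intro tendsto_diff mollifier_limit cont bdd)
    have [measurable]: "smooth_step \<in> borel_measurable borel"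
      using smooth_step_mono by (rule borel_measurable_mono)
    have hm [measurable]: "h n \<in> borel_measurable borel" for n unfolding h_def trapezoid_def[abs_def] by measurable
    \<comment> \<open>Widths are at most 1, so all test functions vanish outside [a - 1, b + 1].
      Pointwise convergence is only claimed off the two endpoints.\<close>
    have lim2: "(\<lambda>n. LINT x|lborel. g x * h n x) \<longlonglongrightarrow> (LINT x|lborel. indicator {a<..b} x * g x)"
    proof (rule integral_dominated_convergence[where w="\<lambda>x. \<bar>indicator {a-1..b+1} x * g x\<bar>"])
      show "integrable lborel (\<lambda>x. \<bar>indicator {a-1..b+1} x * g x\<bar>)"
        by (intro integrable_abs L2_fun_local_integrable L2)
      show "AE x in lborel. norm (g x * h n x) \<le> \<bar>indicator {a-1..b+1} x * g x\<bar>" for n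
      proof (rule AE_I2)
        fix x
        have "\<bar>h n x\<bar> \<le> 1"
          unfolding h_def trapezoid_def using smooth_step_bounds[of "(x - a) / (1 / Suc n)"] smooth_step_bounds[of "(x - b) / (1 / Suc n)"] by (auto simp: abs_if)
        moreover have "h n x = 0" if "x \<notin> {a-1..b+1}"
        proof -
          have "1 / real (Suc n) \<le> 1" by simp
          then have "x \<le> a - 1 / Suc n \<or> b + 1 / Suc n \<le> x" using that by (auto simp only: atLeastAtMost_iff)
          then show ?thesis unfolding h_def using ab by (intro trapezoid_outside) auto
        qed
        ultimately show "norm (g x * h n x) \<le> \<bar>indicator {a-1..b+1} x * g x\<bar>"
          by (auto simp: abs_mult mult_left_le split: split_indicator)
      qed
      show "AE x in lborel. (\<lambda>n. g x * h n x) \<longlonglongrightarrow> indicator {a<..b} x * g x"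
        using AE_lborel_singleton[of a] AE_lborel_singleton[of b]
      proof eventually_elim
        case (elim x)
        have "\<forall>\<^sub>F n in sequentially. g x * h n x = indicator {a<..b} x * g x"
        proof -
          define m where "m = min \<bar>x - a\<bar> \<bar>x - b\<bar>"
          have m: "m > 0" using elim by (auto simp: m_def)
          have "(\<lambda>n. 1 / Suc n) \<longlonglongrightarrow> (0::real)" by (rule LIMSEQ_Suc[OF lim_1_over_n, unfolded o_def])
          then have "\<forall>\<^sub>F n in sequentially. 1 / Suc n < m" using m by (rule order_tendstoD)
          then show ?thesis
          proof eventually_elim
            case (elim n)
            then have n: "1 / Suc n < \<bar>x - a\<bar>" "1 / Suc n < \<bar>x - b\<bar>" by (auto simp: m_def)
            consider "x < a" | "a < x" "x < b" | "b < x" using \<open>m > 0\<close> by (fastforce simp: m_def)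
            then show ?case
            proof cases
              case 1
              then have "h n x = 0" unfolding h_def using n ab by (intro trapezoid_outside) auto
              then show ?thesis using 1 by simp
            next
              case 2
              have "1 \<le> (x - a) / (1 / Suc n)" using n(1) 2 by (subst pos_le_divide_eq) auto
              moreover have "(x - b) / (1 / Suc n) \<le> -1" using n(2) 2 by (subst pos_divide_le_eq) auto
              ultimately have "h n x = 1" unfolding h_def trapezoid_def by (simp only: smooth_step_left smooth_step_right)
              then show ?thesis using 2 by simp
            next
              case 3
              then have "h n x = 0" unfolding h_def using n ab by (intro trapezoid_outside) auto
              then show ?thesis using 3 by simp
            qed
          qed
        qed
        then show ?case by (rule tendsto_eventually)
      qed
    qed auto
    have "- (LINT x|lborel. indicator {a<..b} x * g x) = f a - f b"
      using LIMSEQ_unique[OF tendsto_minus[OF lim2] lim1] .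
    then show ?thesis using L2_fun_local_integrable(2)[OF L2] by (simp add: has_bochner_integral_iff)
  qed
qed

subsection \<open>Integration by parts\<close>

text \<open>Integration by parts through Fubini: f x is f (-A) plus the integral of \<open>g\<close>
  from -A to x, where A bounds the support of the test function. The converse direction is what
  identifies the derivative of an evolved solution.\<close>

lemma increments_L2_distr_deriv:
  assumes inc: "has_increments f g" and L2: "L2_fun g" and cont: "continuous_on UNIV f"
  shows "L2_distr_deriv f g"
  unfolding L2_distr_deriv_def
proof (intro conjI allI impI L2)
  have [measurable]: "g \<in> borel_measurable borel" using L2 by (simp add: L2_fun_def)
  have [measurable]: "f \<in> borel_measurable borel" using cont by (intro borel_measurable_continuous_onI)
  fix h assume h: "test_fun h"
  have dh: "(h has_real_derivative deriv h x) (at x)" for x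
    using h[unfolded test_fun_def, THEN conjunct1, rule_format, of 0 x] by (simp add: DERIV_deriv_iff_real_differentiable)
  have ddh: "deriv h differentiable (at x)" for x
    using h[unfolded test_fun_def, THEN conjunct1, rule_format, of 1 x] by simp
  have cdh: "continuous_on UNIV (deriv h)"
    using ddh by (auto intro!: continuous_at_imp_continuous_on differentiable_imp_continuous_within)
  then have [measurable]: "deriv h \<in> borel_measurable borel" by (rule borel_measurable_continuous_onI)
  have ch: "continuous_on UNIV h" using dh by (auto intro!: continuous_at_imp_continuous_on DERIV_isCont)
  then have [measurable]: "h \<in> borel_measurable borel" by (rule borel_measurable_continuous_onI)
  have "bounded (closure {x. h x \<noteq> 0})" using h by (auto simp: test_fun_def compact_imp_bounded)
  then have "bounded {x. h x \<noteq> 0}" by (rule bounded_subset) (rule closure_subset)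
  then obtain A0 where A0: "\<And>x. h x \<noteq> 0 \<Longrightarrow> \<bar>x\<bar> \<le> A0" by (auto simp: bounded_iff)
  define A where "A = \<bar>A0\<bar> + 1"
  have A: "A > 0" "\<And>x. \<bar>x\<bar> \<ge> A \<Longrightarrow> h x = 0" using A0 by (force simp: A_def)+
  have dA: "deriv h x = 0" if "\<bar>x\<bar> > A" for x
  proof -
    have "((\<lambda>_. 0) has_real_derivative 0) (at x)" by simp
    then have "(h has_real_derivative 0) (at x)"
    proof (rule has_field_derivative_transform_within_open)
      show "open {x::real. \<bar>x\<bar> > A}" by (intro open_Collect_less continuous_intros)
    qed (use that A in auto)
    then show ?thesis by (rule DERIV_imp_deriv)
  qed
  have FTC: "has_bochner_integral lborel (\<lambda>x. deriv h x * indicator {c..d} x) (h d - h c)" if "c \<le> d" for c d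
  proof (rule has_bochner_integral_FTC_Icc_real)
    show "isCont (deriv h) x" for x using cdh by (simp add: continuous_on_eq_continuous_at)
  qed (use that dh in auto)
  let ?I = "{-A<..A}"
  \<comment> \<open>The integrand on the triangle -A < z \<le> x \<le> A, to be integrated in both
    orders.\<close>
  define k where "k = (\<lambda>(x, z). indicator {-A..A} x * deriv h x * (indicator {-A<..x} z * g z))"
  have k [measurable]: "k \<in> borel_measurable (lborel \<Otimes>\<^sub>M lborel)"
  proof -
    have "k = (\<lambda>p. indicator {-A..A} (fst p) * deriv h (fst p) * (indicator {p. -A < snd p \<and> snd p \<le> fst p} p * g (snd p)))"
      by (auto simp: k_def fun_eq_iff split: split_indicator)
    also have "\<dots> \<in> borel_measurable (lborel \<Otimes>\<^sub>M lborel)" by measurable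
    finally show ?thesis .
  qed
  have gi: "integrable lborel (\<lambda>z. indicator {-A<..x} z * g z)" for x by (rule L2_fun_local_integrable[OF L2])
  have hi: "integrable lborel (\<lambda>x. deriv h x * indicator {-A..A} x)" using FTC[of "-A" A] A by (auto simp: has_bochner_integral_iff)
  have ki: "integrable (lborel \<Otimes>\<^sub>M lborel) k"
  proof (rule lborel_pair.Fubini_integrable)
    let ?G = "LINT z|lborel. \<bar>indicator {-A<..A} z * g z\<bar>"
    have "integrable lborel (\<lambda>x. \<bar>deriv h x * indicator {-A..A} x\<bar> * ?G)" using hi by auto
    then show "integrable lborel (\<lambda>x. LINT y|lborel. norm (k (x, y)))"
    proof (rule Bochner_Integration.integrable_bound)
      show "AE x in lborel. norm (LINT y|lborel. norm (k (x, y))) \<le> norm (\<bar>deriv h x * indicator {-A..A} x\<bar> * ?G)"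
      proof (rule AE_I2)
        fix x
        have "(LINT y|lborel. norm (k (x, y))) = (LINT y|lborel. \<bar>deriv h x * indicator {-A..A} x\<bar> * \<bar>indicator {-A<..x} y * g y\<bar>)"
          by (intro Bochner_Integration.integral_cong) (auto simp: k_def abs_mult)
        also have "\<dots> = \<bar>deriv h x * indicator {-A..A} x\<bar> * (LINT y|lborel. \<bar>indicator {-A<..x} y * g y\<bar>)"
          by (rule integral_mult_right_zero)
        also have "\<dots> \<le> \<bar>deriv h x * indicator {-A..A} x\<bar> * ?G"
        proof (cases "x \<le> A")
          case True
          then have "(LINT y|lborel. \<bar>indicator {-A<..x} y * g y\<bar>) \<le> ?G"
            by (intro integral_mono integrable_abs gi) (auto split: split_indicator)
          then show ?thesis by (rule mult_left_mono) simp
        qed simp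
        finally show "norm (LINT y|lborel. norm (k (x, y))) \<le> norm (\<bar>deriv h x * indicator {-A..A} x\<bar> * ?G)" by simp
      qed
    qed measurable
    show "AE x in lborel. integrable lborel (\<lambda>y. k (x, y))" unfolding k_def using gi by auto
  qed measurable
  have "(LINT x|lborel. f x * deriv h x) = (LINT x|lborel. f (-A) * (deriv h x * indicator {-A..A} x) + (LINT z|lborel. k (x, z)))"
  proof (rule integral_cong_AE)
    show "AE x in lborel. f x * deriv h x = f (-A) * (deriv h x * indicator {-A..A} x) + (LINT z|lborel. k (x, z))"
    proof (rule AE_I2)
      fix x
      show "f x * deriv h x = f (-A) * (deriv h x * indicator {-A..A} x) + (LINT z|lborel. k (x, z))"
      proof (cases "x \<in> {-A..A}")
        case True
        then have "(LINT z|lborel. k (x, z)) = deriv h x * (f x - f (-A))"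
          unfolding k_def using has_incrementsD(2)[OF inc, of "-A" x] by (simp add: has_bochner_integral_iff)
        then show ?thesis using True by (simp add: algebra_simps)
      next
        case False
        then have "\<bar>x\<bar> > A" by auto
        then show ?thesis using False by (simp add: dA k_def)
      qed
    qed
  qed measurable
  also have "\<dots> = f (-A) * (h A - h (-A)) + (LINT x|lborel. LINT z|lborel. k (x, z))"
    using FTC[of "-A" A] A hi lborel_pair.integrable_fst'[OF ki]
    by (subst Bochner_Integration.integral_add) (auto simp: has_bochner_integral_iff)
  also have "\<dots> = (LINT x|lborel. LINT z|lborel. k (x, z))" using A by simp
  also have "\<dots> = (LINT z|lborel. LINT x|lborel. k (x, z))"
    using lborel_pair.Fubini_integral[of "\<lambda>x z. k (x, z)"] ki by simp
  also have "\<dots> = (LINT z|lborel. - (g z * h z))"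
  proof (rule Bochner_Integration.integral_cong[OF refl])
    fix z
    show "(LINT x|lborel. k (x, z)) = - (g z * h z)"
    proof (cases "-A < z \<and> z \<le> A")
      case True
      have "(LINT x|lborel. k (x, z)) = (LINT x|lborel. g z * (deriv h x * indicator {z..A} x))"
        using True unfolding k_def by (intro Bochner_Integration.integral_cong) (auto split: split_indicator)
      also have "\<dots> = g z * (h A - h z)" using FTC[of z A] True by (simp add: has_bochner_integral_iff)
      finally show ?thesis using A by simp
    next
      case False
      then have "h z = 0" using A by auto
      moreover have "k (x, z) = 0" for x using False by (auto simp: k_def split: split_indicator)
      ultimately show ?thesis by simp
    qed
  qed
  finally show "(LINT x|lborel. f x * deriv h x) = - (LINT x|lborel. g x * h x)" by simp
qed

lemma dx_increments:
  assumes "f \<in> X_space"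
  shows "has_increments f (dx f)" "L2_fun (dx f)"
  using dx[OF assms] assms L2_distr_deriv_increments[of f "dx f"] by (auto simp: X_space_def L2_distr_deriv_def)

text \<open>\<open>dx f\<close> is a choice among almost everywhere equal functions, so an explicit
  candidate can only be identified with it almost everywhere.\<close>

lemma dx_unique:
  assumes "has_increments f g" "L2_fun g" "continuous_on UNIV f" "bounded (range f)"
  shows "f \<in> X_space" "AE x in lborel. dx f x = g x"
proof -
  have "L2_distr_deriv f g" by (intro increments_L2_distr_deriv assms)
  then show X: "f \<in> X_space" using assms by (auto simp: X_space_def)
  show "AE x in lborel. dx f x = g x" by (rule has_increments_unique[OF dx_increments(1)[OF X] assms(1)])
qed

section \<open>Two tools: surjectivity near the identity and integrability of product
  kernels\<close>

lemma surj_near_identity: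
  fixes F :: "real \<Rightarrow> real"
  assumes "continuous_on UNIV F" "\<And>y. \<bar>F y - y\<bar> \<le> c"
  shows "surj F"
  unfolding surj_def
proof
  fix x
  have "\<exists>y\<ge>x - c. y \<le> x + c \<and> F y = x"
  proof (rule IVT')
    show "F (x - c) \<le> x" using assms(2)[of "x - c"] by auto
    show "x \<le> F (x + c)" using assms(2)[of "x + c"] by auto
    show "x - c \<le> x + c" using assms(2)[of 0] by auto
    show "continuous_on {x - c..x + c} F" using assms(1) continuous_on_subset by blast
  qed
  then show "\<exists>y. x = F y" by auto
qed

lemma integrable_product_bound:
  fixes u v :: "real \<Rightarrow> real" and k :: "real \<times> real \<Rightarrow> real"
  assumes [measurable]: "k \<in> borel_measurable (lborel \<Otimes>\<^sub>M lborel)"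
    and u: "integrable lborel u" and v: "integrable lborel v"
    and le: "\<And>s x. \<bar>k (s, x)\<bar> \<le> \<bar>u s\<bar> * \<bar>v x\<bar>"
  shows "integrable (lborel \<Otimes>\<^sub>M lborel) k"
proof (rule integrableI_bounded)
  have [measurable]: "u \<in> borel_measurable lborel" "v \<in> borel_measurable lborel" using u v by auto
  have "(\<integral>\<^sup>+p. ennreal (norm (k p)) \<partial>(lborel \<Otimes>\<^sub>M lborel)) = (\<integral>\<^sup>+s. \<integral>\<^sup>+x. ennreal (norm (k (s, x))) \<partial>lborel \<partial>lborel)"
    by (subst lborel.nn_integral_fst[symmetric]) auto
  also have "\<dots> \<le> (\<integral>\<^sup>+s. \<integral>\<^sup>+x. ennreal \<bar>u s\<bar> * ennreal \<bar>v x\<bar> \<partial>lborel \<partial>lborel)"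
    using le by (intro nn_integral_mono) (simp add: ennreal_mult[symmetric])
  also have "\<dots> = (\<integral>\<^sup>+s. ennreal \<bar>u s\<bar> \<partial>lborel) * (\<integral>\<^sup>+x. ennreal \<bar>v x\<bar> \<partial>lborel)"
    by (simp add: nn_integral_cmult nn_integral_multc)
  also have "\<dots> < \<infinity>"
    using u v by (auto simp: integrable_iff_bounded ennreal_mult_less_top)
  finally show "(\<integral>\<^sup>+p. ennreal (norm (k p)) \<partial>(lborel \<Otimes>\<^sub>M lborel)) < \<infinity>" .
qed fact

subsection \<open>Evolution of the slope along a characteristic\<close>

text \<open>The slope starting from k < 0 blows up at time - 2 / k. For t > 0 the condition is k > -
  2 / t, the one in the construction of the solution; without division it also covers t = 0.\<close>

definition alive :: "real \<Rightarrow> real \<Rightarrow> bool" where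
  "alive t k \<longleftrightarrow> 0 < 1 + t * k / 2"

text \<open>Solution of w' = - w^2 / 2 with w = k at time 0, meaningful before blow-up.\<close>

definition slope_at :: "real \<Rightarrow> real \<Rightarrow> real" where
  "slope_at t k = k / (1 + t * k / 2)"

text \<open>The derivative of \<open>char_pos\<close> in the label. It stays zero after blow-up
  since characteristics that have met remain together.\<close>

definition stretch :: "real \<Rightarrow> real \<Rightarrow> real" where
  "stretch t k = (if alive t k then (1 + t * k / 2)\<^sup>2 else 0)"

text \<open>The derivative of \<open>char_val\<close> in the label; while the label lives it is
  slope times stretch.\<close>

definition flux :: "real \<Rightarrow> real \<Rightarrow> real" where
  "flux t k = (if alive t k then k * (1 + t * k / 2) else 0)"

text \<open>The part of [0, t] during which the label carries energy: the blow-up time, capped at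
  t.\<close>

definition lifetime :: "real \<Rightarrow> real \<Rightarrow> real" where
  "lifetime t k = (if alive t k then t else - 2 / k)"

lemma measurable_alive [measurable]:
  "Measurable.pred (borel \<Otimes>\<^sub>M borel) (\<lambda>(s, k). alive s k)"
  unfolding alive_def by measurable

lemma measurable_alive' [measurable (raw)]:
  assumes [measurable]: "f \<in> borel_measurable M" "g \<in> borel_measurable M"
  shows "Measurable.pred M (\<lambda>x. alive (f x) (g x))"
  unfolding alive_def by measurable

lemma measurable_slope_at [measurable (raw)]:
  assumes [measurable]: "f \<in> borel_measurable M" "g \<in> borel_measurable M"
  shows "(\<lambda>x. slope_at (f x) (g x)) \<in> borel_measurable M"
    and "(\<lambda>x. stretch (f x) (g x)) \<in> borel_measurable M"
    and "(\<lambda>x. flux (f x) (g x)) \<in> borel_measurable M"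
    and "(\<lambda>x. lifetime (f x) (g x)) \<in> borel_measurable M"
  unfolding slope_at_def stretch_def flux_def lifetime_def by measurable

lemma alive_antimono: "alive t k \<Longrightarrow> 0 \<le> s \<Longrightarrow> s \<le> t \<Longrightarrow> alive s k"
proof (cases "k \<ge> 0")
  case False
  assume "alive t k" "s \<le> t"
  moreover have "t * k \<le> s * k" using False \<open>s \<le> t\<close> by (intro mult_right_mono_neg) auto
  ultimately show ?thesis by (simp add: alive_def)
qed (auto simp: alive_def add_pos_nonneg)

lemma not_alive_lifetime:
  assumes "\<not> alive t k" "0 \<le> t"
  shows "k < 0" "0 < lifetime t k" "lifetime t k \<le> t" "alive s k \<longleftrightarrow> s < lifetime t k"
proof -
  show k: "k < 0"
  proof (rule ccontr)
    assume "\<not> k < 0"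
    then have "0 \<le> t * k" using assms(2) by simp
    then show False using assms(1) by (simp add: alive_def)
  qed
  show "0 < lifetime t k" "lifetime t k \<le> t" "alive s k \<longleftrightarrow> s < lifetime t k"
    using assms(1) k by (auto simp: lifetime_def alive_def field_simps)
qed

lemma lifetime_bounds: "0 \<le> t \<Longrightarrow> 0 \<le> lifetime t k \<and> lifetime t k \<le> t"
  using not_alive_lifetime[of t k] by (cases "alive t k") (auto simp: lifetime_def)

lemma alive_interval:
  assumes "0 \<le> t"
  shows "AE s in lborel. (s \<in> {0..t} \<and> alive s k) \<longleftrightarrow> s \<in> {0..lifetime t k}"
  using AE_lborel_singleton[of "lifetime t k"]
proof eventually_elim
  case (elim s)
  show ?case
  proof (cases "alive t k")
    case True
    then show ?thesis using alive_antimono[OF True, of s] by (auto simp: lifetime_def)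
  next
    case False
    then show ?thesis
      using not_alive_lifetime(2,3)[OF False assms] not_alive_lifetime(4)[OF False assms, of s] elim by auto
  qed
qed

text \<open>Up to the single instant of blow-up, the living times in [0, t] are the interval from 0
  to the lifetime, so this is the fundamental theorem of calculus on that interval.\<close>

lemma alive_integral:
  fixes \<omega> \<Omega> :: "real \<Rightarrow> real"
  assumes t: "0 \<le> t" and D: "\<And>s. (\<Omega> has_real_derivative \<omega> s) (at s)" and c: "continuous_on UNIV \<omega>"
  shows "has_bochner_integral lborel (\<lambda>s. indicator {0..t} s * (\<omega> s * indicator {s. alive s k} s)) (\<Omega> (lifetime t k) - \<Omega> 0)"
proof -
  have [measurable]: "\<omega> \<in> borel_measurable borel" using c by (rule borel_measurable_continuous_onI)
  have "has_bochner_integral lborel (\<lambda>s. \<omega> s * indicator {0..lifetime t k} s) (\<Omega> (lifetime t k) - \<Omega> 0)"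
  proof (rule has_bochner_integral_FTC_Icc_real)
    show "isCont \<omega> s" for s using c by (simp add: continuous_on_eq_continuous_at)
    show "0 \<le> lifetime t k" using lifetime_bounds t by blast
    show "DERIV \<Omega> s :> \<omega> s" for s by (rule D)
  qed
  note hb = this
  have eq: "AE s in lborel. \<omega> s * indicator {0..lifetime t k} s = indicator {0..t} s * (\<omega> s * indicator {s. alive s k} s)"
    using alive_interval[OF t, of k] by eventually_elim (auto split: split_indicator)
  show ?thesis
    using hb by (subst has_bochner_integral_cong_AE[OF _ _ eq, symmetric]) auto
qed

lemma stretch_pos_iff: "0 < stretch t k \<longleftrightarrow> alive t k"
  by (auto simp: stretch_def alive_def)

lemma stretch_nonneg: "0 \<le> stretch t k" by (simp add: stretch_def)

text \<open>The right side is what differentiating \<open>char_pos\<close> in the label produces: 1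
  + t * k plus half of k^2 times the integral of t - s over the lifetime. The lemma says that this
  integrates to the square (1 + t * k / 2)^2, and to zero once the label is dead.\<close>

lemma stretch_eq:
  assumes "0 \<le> t"
  shows "stretch t k = 1 + t * k + 1/2 * k\<^sup>2 * (t * lifetime t k - (lifetime t k)\<^sup>2 / 2)"
proof (cases "alive t k")
  case True
  then show ?thesis by (simp add: stretch_def lifetime_def power2_eq_square algebra_simps)
next
  case False
  then show ?thesis using not_alive_lifetime(1)[OF False assms]
    by (simp add: stretch_def lifetime_def power2_eq_square field_simps)
qed

lemma flux_eq:
  assumes "0 \<le> t"
  shows "flux t k = k + 1/2 * k\<^sup>2 * lifetime t k"
proof (cases "alive t k")
  case True
  then show ?thesis by (simp add: flux_def lifetime_def power2_eq_square algebra_simps)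
next
  case False
  then show ?thesis using not_alive_lifetime(1)[OF False assms]
    by (simp add: flux_def lifetime_def power2_eq_square field_simps)
qed

lemma slope_at_stretch: "alive t k \<Longrightarrow> slope_at t k * stretch t k = flux t k"
  "alive t k \<Longrightarrow> (slope_at t k)\<^sup>2 * stretch t k = k\<^sup>2"
  by (simp_all add: slope_at_def stretch_def flux_def alive_def power2_eq_square)

subsection \<open>Characteristics\<close>

definition energy :: "(real \<Rightarrow> real) \<Rightarrow> real" where
  "energy f = (LINT x|lborel. (dx f x)\<^sup>2)"

lemma active_alive: "0 \<le> t \<Longrightarrow> active f t = {x. alive t (dx f x)}"
  by (auto simp: active_def alive_def field_simps)

context
  fixes f assumes X: "f \<in> X_space"
begin

lemma dx_measurable [measurable]: "dx f \<in> borel_measurable borel"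
  and dx_integrable: "integrable lborel (\<lambda>x. (dx f x)\<^sup>2)"
  using dx_increments(2)[OF X] by (auto simp: L2_fun_def)

lemma char_speed_eq:
  "0 \<le> s \<Longrightarrow> char_speed f s y = 1/4 * (LINT x|lborel. indicator {x. alive s (dx f x)} x * (sgn (y - x) * (dx f x)\<^sup>2))"
  unfolding char_speed_def set_lebesgue_integral_def by (simp add: active_alive)

lemma char_speed_integrable:
  "integrable lborel (\<lambda>x. indicator {x. alive s (dx f x)} x * (sgn (y - x) * (dx f x)\<^sup>2))"
  by (rule Bochner_Integration.integrable_bound[OF dx_integrable])
     (auto simp: abs_mult sgn_real_def split: split_indicator)

lemma char_speed_bound: "0 \<le> s \<Longrightarrow> \<bar>char_speed f s y\<bar> \<le> energy f / 4"
proof -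
  assume s: "0 \<le> s"
  have "norm (LINT x|lborel. indicator {x. alive s (dx f x)} x * (sgn (y - x) * (dx f x)\<^sup>2)) \<le> energy f"
    unfolding energy_def
    by (rule Bochner_Integration.integral_norm_bound_integral[OF char_speed_integrable dx_integrable])
       (auto simp: abs_mult sgn_real_def split: split_indicator)
  then show ?thesis by (simp add: char_speed_eq[OF s])
qed

lemma measurable_char_speed [measurable]: "(\<lambda>s. indicator {0..t} s * char_speed f s y) \<in> borel_measurable borel"
proof -
  have "(\<lambda>s. indicator {0..t} s * char_speed f s y) =
     (\<lambda>s. indicator {0..t} s * (1/4 * (LINT x|lborel. indicator {p. alive (fst p) (dx f (snd p))} (s, x) * (sgn (y - x) * (dx f x)\<^sup>2))))"
    by (rule ext) (auto simp: char_speed_eq indicator_def)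
  also have "\<dots> \<in> borel_measurable borel" by measurable
  finally show ?thesis .
qed

lemma weighted_speed_integrable:
  assumes [measurable]: "\<omega> \<in> borel_measurable borel" and W: "\<And>s. s \<in> {0..t} \<Longrightarrow> \<bar>\<omega> s\<bar> \<le> W"
  shows "integrable lborel (\<lambda>s. indicator {0..t} s * (\<omega> s * char_speed f s y))"
proof (rule Bochner_Integration.integrable_bound)
  show "integrable lborel (\<lambda>s. indicator {0..t} s * (W * (energy f / 4)))"
    by (intro integrable_mult_left integrable_real_indicator) (auto simp: emeasure_lborel_Icc_eq)
  have "(\<lambda>s. indicator {0..t} s * (\<omega> s * char_speed f s y)) = (\<lambda>s. \<omega> s * (indicator {0..t} s * char_speed f s y))"
    by (auto simp: ac_simps)
  also have "\<dots> \<in> borel_measurable lborel" by measurable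
  finally show "(\<lambda>s. indicator {0..t} s * (\<omega> s * char_speed f s y)) \<in> borel_measurable lborel" .
  show "AE s in lborel. norm (indicator {0..t} s * (\<omega> s * char_speed f s y)) \<le> norm (indicator {0..t} s * (W * (energy f / 4)))"
  proof (rule AE_I2)
    fix s
    show "norm (indicator {0..t} s * (\<omega> s * char_speed f s y)) \<le> norm (indicator {0..t} s * (W * (energy f / 4)))"
    proof (cases "s \<in> {0..t}")
      case True
      then have "\<bar>\<omega> s\<bar> * \<bar>char_speed f s y\<bar> \<le> W * (energy f / 4)"
        using W[OF True] char_speed_bound[of s y] by (intro mult_mono) auto
      also have "\<dots> \<le> \<bar>W * (energy f / 4)\<bar>" by (rule abs_ge_self)
      finally show ?thesis using True by (simp add: abs_mult)
    qed simp
  qed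
qed

text \<open>The sign jumps by 2 between the two labels, which turns the factor 1/4 into 1/2.\<close>

lemma char_speed_diff:
  assumes ab: "a \<le> b" and s: "0 \<le> s"
  shows "char_speed f s b - char_speed f s a = (LINT x|lborel. indicator {a<..b} x * (1/2 * (dx f x)\<^sup>2 * indicator {x. alive s (dx f x)} x))"
proof -
  have "char_speed f s b - char_speed f s a =
     1/4 * (LINT x|lborel. indicator {x. alive s (dx f x)} x * (sgn (b - x) * (dx f x)\<^sup>2) - indicator {x. alive s (dx f x)} x * (sgn (a - x) * (dx f x)\<^sup>2))"
    by (subst Bochner_Integration.integral_diff[OF char_speed_integrable char_speed_integrable])
       (simp add: char_speed_eq[OF s] algebra_simps)
  also have "\<dots> = (LINT x|lborel. 1/4 * (indicator {x. alive s (dx f x)} x * (sgn (b - x) * (dx f x)\<^sup>2) - indicator {x. alive s (dx f x)} x * (sgn (a - x) * (dx f x)\<^sup>2)))"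
    by (rule integral_mult_right_zero[symmetric])
  also have "\<dots> = (LINT x|lborel. indicator {a<..b} x * (1/2 * (dx f x)\<^sup>2 * indicator {x. alive s (dx f x)} x))"
  proof (rule integral_cong_AE)
    show "AE x in lborel. 1/4 * (indicator {x. alive s (dx f x)} x * (sgn (b - x) * (dx f x)\<^sup>2) - indicator {x. alive s (dx f x)} x * (sgn (a - x) * (dx f x)\<^sup>2))
       = indicator {a<..b} x * (1/2 * (dx f x)\<^sup>2 * indicator {x. alive s (dx f x)} x)"
      using AE_lborel_singleton[of a] AE_lborel_singleton[of b]
      by eventually_elim (use ab in \<open>auto simp: sgn_real_def split: split_indicator\<close>)
  qed measurable
  finally show ?thesis .
qed

text \<open>Fubini in time and label. The weight 1 serves \<open>char_val\<close>, the weight t - s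
  serves \<open>char_pos\<close>.\<close>

lemma weighted_speed_increments:
  fixes \<omega> \<Omega> :: "real \<Rightarrow> real"
  assumes t: "0 \<le> t" and D: "\<And>s. (\<Omega> has_real_derivative \<omega> s) (at s)" and c: "continuous_on UNIV \<omega>"
  shows "has_increments (\<lambda>y. LINT s:{0..t}|lborel. \<omega> s * char_speed f s y)
    (\<lambda>x. 1/2 * (dx f x)\<^sup>2 * (\<Omega> (lifetime t (dx f x)) - \<Omega> 0))"
  unfolding has_increments_def
proof (intro conjI allI impI)
  have [measurable]: "\<omega> \<in> borel_measurable borel" using c by (rule borel_measurable_continuous_onI)
  have "continuous_on UNIV \<Omega>" using D by (auto intro!: continuous_at_imp_continuous_on DERIV_isCont)
  then have [measurable]: "\<Omega> \<in> borel_measurable borel" by (rule borel_measurable_continuous_onI)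
  show "(\<lambda>x. 1/2 * (dx f x)\<^sup>2 * (\<Omega> (lifetime t (dx f x)) - \<Omega> 0)) \<in> borel_measurable borel" by measurable
  have "compact (\<omega> ` {0..t})" using c by (intro compact_continuous_image) (auto intro: continuous_on_subset)
  then obtain W where W: "\<And>s. s \<in> {0..t} \<Longrightarrow> \<bar>\<omega> s\<bar> \<le> W"
    using compact_imp_bounded by (fastforce simp: bounded_iff)
  fix a b :: real assume ab: "a \<le> b"
  define k where "k = (\<lambda>(s, x). indicator {0..t} s * (\<omega> s * (indicator {a<..b} x * (1/2 * (dx f x)\<^sup>2 * indicator {x. alive s (dx f x)} x))))"
  have [measurable]: "k \<in> borel_measurable (lborel \<Otimes>\<^sub>M lborel)"
  proof -
    have "k = (\<lambda>p. indicator {0..t} (fst p) * (\<omega> (fst p) * (indicator {a<..b} (snd p) * (1/2 * (dx f (snd p))\<^sup>2 * indicator {p. alive (fst p) (dx f (snd p))} p))))"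
      by (auto simp: k_def fun_eq_iff indicator_def)
    also have "\<dots> \<in> borel_measurable (lborel \<Otimes>\<^sub>M lborel)" by measurable
    finally show ?thesis .
  qed
  have ki: "integrable (lborel \<Otimes>\<^sub>M lborel) k"
  proof (rule integrable_product_bound)
    show "integrable lborel (\<lambda>s. indicator {0..t} s * W)"
      by (intro integrable_mult_left integrable_real_indicator) (auto simp: emeasure_lborel_Icc_eq)
    show "integrable lborel (\<lambda>x. (dx f x)\<^sup>2)" by (rule dx_integrable)
    fix s x
    show "\<bar>k (s, x)\<bar> \<le> \<bar>indicator {0..t} s * W\<bar> * \<bar>(dx f x)\<^sup>2\<bar>"
    proof (cases "s \<in> {0..t}")
      case True
      have "\<bar>\<omega> s\<bar> * \<bar>indicator {a<..b} x * (1/2 * (dx f x)\<^sup>2 * indicator {x. alive s (dx f x)} x)\<bar> \<le> \<bar>W\<bar> * \<bar>(dx f x)\<^sup>2\<bar>"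
        using W[OF True] by (intro mult_mono) (auto split: split_indicator)
      then show ?thesis using True by (simp add: k_def abs_mult)
    qed (simp add: k_def)
  qed measurable
  have inner_s: "has_bochner_integral lborel (\<lambda>s. k (s, x)) (indicator {a<..b} x * (1/2 * (dx f x)\<^sup>2 * (\<Omega> (lifetime t (dx f x)) - \<Omega> 0)))" for x
    using has_bochner_integral_mult_right[OF alive_integral[OF t D c, of "dx f x"], of "indicator {a<..b} x * (1/2 * (dx f x)\<^sup>2)"]
    by (simp add: k_def ac_simps indicator_def)
  have inner_x: "(LINT x|lborel. k (s, x)) = indicator {0..t} s * (\<omega> s * (char_speed f s b - char_speed f s a))" for s
  proof (cases "s \<in> {0..t}")
    case True
    then show ?thesis by (subst char_speed_diff[OF ab]) (auto simp: k_def)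
  qed (simp add: k_def)
  let ?Phi = "\<lambda>y. LINT s:{0..t}|lborel. \<omega> s * char_speed f s y"
  have "(LINT x|lborel. indicator {a<..b} x * (1/2 * (dx f x)\<^sup>2 * (\<Omega> (lifetime t (dx f x)) - \<Omega> 0))) = (LINT x|lborel. LINT s|lborel. k (s, x))"
    by (simp only: has_bochner_integral_integral_eq[OF inner_s])
  also have "\<dots> = (LINT s|lborel. LINT x|lborel. k (s, x))"
    using lborel_pair.Fubini_integral[of "\<lambda>s x. k (s, x)"] ki by simp
  also have "\<dots> = (LINT s|lborel. indicator {0..t} s * (\<omega> s * char_speed f s b) - indicator {0..t} s * (\<omega> s * char_speed f s a))"
    unfolding inner_x by (simp add: algebra_simps)
  also have "\<dots> = ?Phi b - ?Phi a"
    unfolding set_lebesgue_integral_def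
    by (subst Bochner_Integration.integral_diff) (auto intro!: weighted_speed_integrable W)
  finally have val: "(LINT x|lborel. indicator {a<..b} x * (1/2 * (dx f x)\<^sup>2 * (\<Omega> (lifetime t (dx f x)) - \<Omega> 0))) = ?Phi b - ?Phi a" .
  have "integrable lborel (\<lambda>x. LINT s|lborel. k (s, x))"
    using lborel_pair.integrable_snd[of "\<lambda>s x. k (s, x)"] ki by simp
  then have "integrable lborel (\<lambda>x. indicator {a<..b} x * (1/2 * (dx f x)\<^sup>2 * (\<Omega> (lifetime t (dx f x)) - \<Omega> 0)))"
    by (simp only: has_bochner_integral_integral_eq[OF inner_s])
  with val show "has_bochner_integral lborel (\<lambda>x. indicator {a<..b} x * (1/2 * (dx f x)\<^sup>2 * (\<Omega> (lifetime t (dx f x)) - \<Omega> 0))) (?Phi b - ?Phi a)"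
    by (simp add: has_bochner_integral_iff)
qed

context
  fixes t :: real assumes t: "0 \<le> t"
begin

lemma char_val_increments: "has_increments (char_val f t) (\<lambda>x. flux t (dx f x))"
proof -
  have "has_increments (\<lambda>y. LINT s:{0..t}|lborel. 1 * char_speed f s y) (\<lambda>x. 1/2 * (dx f x)\<^sup>2 * (lifetime t (dx f x) - 0))"
    by (rule weighted_speed_increments[OF t]) (auto intro!: derivative_eq_intros)
  from has_increments_add[OF dx_increments(1)[OF X] this]
  show ?thesis by (simp add: char_val_def[abs_def] flux_eq[OF t])
qed

lemma char_pos_increments: "has_increments (char_pos f t) (\<lambda>x. stretch t (dx f x))"
proof -
  have "has_increments (\<lambda>y. LINT s:{0..t}|lborel. (t - s) * char_speed f s y)
     (\<lambda>x. 1/2 * (dx f x)\<^sup>2 * ((t * lifetime t (dx f x) - (lifetime t (dx f x))\<^sup>2 / 2) - (t * 0 - 0\<^sup>2 / 2)))"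
    by (rule weighted_speed_increments[OF t]) (auto intro!: derivative_eq_intros continuous_intros)
  from has_increments_add[OF has_increments_add[OF has_increments_linear[of 1] has_increments_cmult[OF dx_increments(1)[OF X], of t]] this]
  show ?thesis by (simp add: char_pos_def[abs_def] stretch_eq[OF t])
qed

lemma char_pos_density: "has_density (char_pos f t) (\<lambda>x. stretch t (dx f x))"
  using char_pos_increments by (simp add: has_density_iff stretch_nonneg)

lemma weighted_speed_bound:
  assumes [measurable]: "\<omega> \<in> borel_measurable borel" and W: "\<And>s. s \<in> {0..t} \<Longrightarrow> \<bar>\<omega> s\<bar> \<le> W"
  shows "\<bar>LINT s:{0..t}|lborel. \<omega> s * char_speed f s y\<bar> \<le> t * (W * (energy f / 4))"
proof -
  have "norm (LINT s|lborel. indicator {0..t} s * (\<omega> s * char_speed f s y)) \<le> (LINT s|lborel. indicator {0..t} s * (W * (energy f / 4)))"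
  proof (rule Bochner_Integration.integral_norm_bound_integral)
    show "integrable lborel (\<lambda>s. indicator {0..t} s * (W * (energy f / 4)))"
      by (intro integrable_mult_left integrable_real_indicator) (auto simp: emeasure_lborel_Icc_eq)
    fix s
    show "norm (indicator {0..t} s * (\<omega> s * char_speed f s y)) \<le> indicator {0..t} s * (W * (energy f / 4))"
    proof (cases "s \<in> {0..t}")
      case True
      then have "\<bar>\<omega> s\<bar> * \<bar>char_speed f s y\<bar> \<le> W * (energy f / 4)"
        using W[OF True] char_speed_bound[of s y] by (intro mult_mono) auto
      then show ?thesis using True by (simp add: abs_mult)
    qed simp
  qed (rule weighted_speed_integrable[OF assms(1) W])
  then show ?thesis using t by (simp add: set_lebesgue_integral_def)
qed

lemma X_bounded: obtains B where "\<And>y. \<bar>f y\<bar> \<le> B"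
  using X by (auto simp: X_space_def bounded_iff)

lemma surj_char_pos: "surj (char_pos f t)"
proof -
  obtain B where B: "\<And>y. \<bar>f y\<bar> \<le> B" using X_bounded by blast
  show ?thesis
  proof (rule surj_near_identity)
    show "continuous_on UNIV (char_pos f t)" by (rule has_increments_continuous[OF char_pos_increments])
    fix y
    have "\<bar>t * f y\<bar> \<le> t * B" using B[of y] t by (simp add: abs_mult mult_left_mono)
    moreover have "\<bar>LINT s:{0..t}|lborel. (t - s) * char_speed f s y\<bar> \<le> t * (t * (energy f / 4))"
      by (rule weighted_speed_bound) auto
    ultimately show "\<bar>char_pos f t y - y\<bar> \<le> t * B + t * (t * (energy f / 4))"
      unfolding char_pos_def by linarith
  qed
qed

lemma char_val_bounded: obtains B where "\<And>y. \<bar>char_val f t y\<bar> \<le> B"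
proof -
  obtain B where B: "\<And>y. \<bar>f y\<bar> \<le> B" using X_bounded by blast
  have "\<bar>char_val f t y\<bar> \<le> B + t * (1 * (energy f / 4))" for y
    using B[of y] weighted_speed_bound[of "\<lambda>_. 1" 1 y] unfolding char_val_def by simp
  then show thesis by (rule that)
qed

text \<open>If two labels sit at the same position, the stretch vanishes almost everywhere between
  them. Then those labels are dead, the flux vanishes too, and the values agree. This makes the
  description by \<open>THE\<close> in \<open>dissipative_solution\<close> unambiguous.\<close>

lemma char_val_cong_le:
  assumes "a \<le> b" "char_pos f t a = char_pos f t b"
  shows "char_val f t a = char_val f t b"
proof -
  have "(\<integral>\<^sup>+x. ennreal (stretch t (dx f x)) * indicator {a<..b} x \<partial>lborel) = 0"
    using has_density_nn_integral[OF char_pos_density assms(1)] assms(2) by simp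
  then have "AE x in lborel. ennreal (stretch t (dx f x)) * indicator {a<..b} x = 0"
    by (subst (asm) nn_integral_0_iff_AE) auto
  then have "AE x in lborel. indicator {a<..b} x * flux t (dx f x) = 0"
    by eventually_elim (auto simp: ennreal_eq_0_iff flux_def stretch_pos_iff not_less[symmetric] split: split_indicator_asm)
  then have "(LINT x|lborel. indicator {a<..b} x * flux t (dx f x)) = 0"
    by (rule integral_eq_zero_AE)
  then show ?thesis using has_incrementsD(2)[OF char_val_increments assms(1)] by (simp add: has_bochner_integral_iff)
qed

lemma dissipative_solution_char_pos: "dissipative_solution f t (char_pos f t y) = char_val f t y"
  unfolding dissipative_solution_def
proof (rule the_equality)
  fix w assume "\<exists>y'. char_pos f t y' = char_pos f t y \<and> w = char_val f t y'"
  then show "w = char_val f t y" using char_val_cong_le[of y] char_val_cong_le[of _ y] by (metis linear)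
qed auto

text \<open>An explicit Borel candidate for the derivative at time t. The default 0 concerns
  positions reached by dead labels, which form a null set.\<close>

definition transported_slope :: "real \<Rightarrow> real" where
  "transported_slope x = (let y = ginv (char_pos f t) x in if alive t (dx f y) then slope_at t (dx f y) else 0)"

lemma measurable_transported_slope [measurable]: "transported_slope \<in> borel_measurable borel"
proof -
  note [measurable] = measurable_ginv[OF char_pos_density surj_char_pos]
  show ?thesis unfolding transported_slope_def[abs_def] Let_def by measurable
qed

lemma transported_slope_char_pos:
  "AE y in lborel. alive t (dx f y) \<longrightarrow> transported_slope (char_pos f t y) = slope_at t (dx f y)"
  using AE_ginv_left[OF char_pos_density surj_char_pos]
  by eventually_elim (simp add: transported_slope_def stretch_pos_iff)

text \<open>Change of variables from position to label: slope times stretch is the flux, the density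
  of \<open>char_val\<close>.\<close>

lemma dissipative_solution_increments: "has_increments (dissipative_solution f t) transported_slope"
  unfolding has_increments_def
proof (intro conjI allI impI)
  let ?F = "char_pos f t"
  have F: "mono ?F" "continuous_on UNIV ?F" "surj ?F"
    using char_pos_density has_density_mono has_density_continuous surj_char_pos by auto
  note [measurable] = has_density_measurable_fun[OF char_pos_density]
  fix p q :: real assume pq: "p \<le> q"
  define a where "a = ginv ?F p"
  define b where "b = ginv ?F q"
  have ab: "a \<le> b" using monoD[OF mono_ginv[OF F] pq] by (simp add: a_def b_def)
  have Fab: "?F a = p" "?F b = q" using ginv_right[OF F] by (simp_all add: a_def b_def)
  let ?G = "\<lambda>x. indicator {p<..q} x * transported_slope x"
  have eq: "AE y in lborel. ?G (?F y) * stretch t (dx f y) = indicator {a<..b} y * flux t (dx f y)"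
    using transported_slope_char_pos AE_has_density_inj[OF char_pos_density surj_char_pos]
  proof eventually_elim
    case (elim y)
    show ?case
    proof (cases "alive t (dx f y)")
      case True
      then have inj: "?F y' = ?F y \<Longrightarrow> y' = y" for y' using elim(2) by (simp add: stretch_pos_iff)
      have "y \<in> {a<..b} \<longleftrightarrow> ?F y \<in> {p<..q}"
        unfolding Fab[symmetric]
        using inj[of a] inj[of b] monoD[OF F(1), of a y] monoD[OF F(1), of y b] monoD[OF F(1), of y a] monoD[OF F(1), of b y]
        by (force simp: not_less not_le)
      then show ?thesis using elim(1) True slope_at_stretch(1)[OF True] by (auto split: split_indicator)
    next
      case False
      then show ?thesis by (simp add: stretch_def flux_def)
    qed
  qed
  have hb: "has_bochner_integral lborel (\<lambda>y. indicator {a<..b} y * flux t (dx f y)) (char_val f t b - char_val f t a)"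
    by (rule has_incrementsD(2)[OF char_val_increments ab])
  then have "has_bochner_integral lborel (\<lambda>y. ?G (?F y) * stretch t (dx f y)) (char_val f t b - char_val f t a)"
    by (subst has_bochner_integral_cong_AE[OF _ _ eq]) auto
  then have "has_bochner_integral lborel ?G (char_val f t b - char_val f t a)"
    using integral_has_density[OF char_pos_density surj_char_pos, of ?G] by (simp add: has_bochner_integral_iff)
  then show "has_bochner_integral lborel ?G (dissipative_solution f t q - dissipative_solution f t p)"
    using Fab dissipative_solution_char_pos[of a] dissipative_solution_char_pos[of b] by simp
qed measurable

text \<open>Squared slope times stretch is the initial k^2 on living labels, so the energy at time t
  is the part of the initial energy that is still alive.\<close>

lemma L2_transported_slope: "L2_fun transported_slope"
proof -
  let ?F = "char_pos f t"
  note [measurable] = has_density_measurable_fun[OF char_pos_density]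
  have eq: "AE y in lborel. (transported_slope (?F y))\<^sup>2 * stretch t (dx f y) = indicator {y. alive t (dx f y)} y * (dx f y)\<^sup>2"
    using transported_slope_char_pos
  proof eventually_elim
    case (elim y)
    then show ?case using slope_at_stretch(2)[of t "dx f y"] by (cases "alive t (dx f y)") (auto simp: stretch_def)
  qed
  have "integrable lborel (\<lambda>y. indicator {y. alive t (dx f y)} y * (dx f y)\<^sup>2)"
    by (rule Bochner_Integration.integrable_bound[OF dx_integrable]) (auto split: split_indicator)
  then have "integrable lborel (\<lambda>y. (transported_slope (?F y))\<^sup>2 * stretch t (dx f y))"
    by (subst integrable_cong_AE[OF _ _ eq]) auto
  then show ?thesis
    using integral_has_density(1)[OF char_pos_density surj_char_pos, of "\<lambda>x. (transported_slope x)\<^sup>2"] by (simp add: L2_fun_def)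
qed

lemma
  shows dissipative_solution_X_space: "dissipative_solution f t \<in> X_space"
    and dx_dissipative_solution: "AE x in lborel. dx (dissipative_solution f t) x = transported_slope x"
proof -
  have "bounded (range (dissipative_solution f t))"
  proof -
    obtain B where B: "\<And>y. \<bar>char_val f t y\<bar> \<le> B" using char_val_bounded by blast
    have "\<bar>dissipative_solution f t x\<bar> \<le> B" for x
    proof -
      obtain y where "char_pos f t y = x" using surj_char_pos by (metis surjD)
      then show ?thesis using B[of y] dissipative_solution_char_pos[of y] by simp
    qed
    then show ?thesis by (auto simp: bounded_iff)
  qed
  then show "dissipative_solution f t \<in> X_space" "AE x in lborel. dx (dissipative_solution f t) x = transported_slope x"
    using dx_unique[OF dissipative_solution_increments L2_transported_slope
        has_increments_continuous[OF dissipative_solution_increments]] by auto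
qed

lemma dx_dissipative_solution_char_pos:
  "AE y in lborel. alive t (dx f y) \<longrightarrow> dx (dissipative_solution f t) (char_pos f t y) = slope_at t (dx f y)"
  using transported_slope_char_pos AE_has_density[OF char_pos_density surj_char_pos dx_dissipative_solution]
  by eventually_elim (simp add: stretch_pos_iff)

end

end

section \<open>Monotone maps that agree on a set\<close>

lemma has_density_DERIV: "has_density F f \<Longrightarrow> AE x in lborel. (F has_real_derivative f x) (at x)"
  by (intro has_increments_DERIV has_density_increments)

text \<open>Each isolated point is the only point of \<open>A\<close> in some interval with rational
  ends.\<close>

lemma countable_isolated_points:
  fixes A :: "real set"
  shows "countable {x\<in>A. \<not> x islimpt A}"
proof -
  have "{x\<in>A. \<not> x islimpt A} \<subseteq> (\<Union>(p,q)\<in>\<rat>\<times>\<rat>. {x. A \<inter> {p<..<q} = {x}})"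
  proof
    fix x assume "x \<in> {x\<in>A. \<not> x islimpt A}"
    then obtain T where T: "x \<in> A" "x \<in> T" "open T" "\<And>y. y \<in> A \<Longrightarrow> y \<in> T \<Longrightarrow> y = x"
      by (auto simp: islimpt_def)
    then obtain e where e: "e > 0" "ball x e \<subseteq> T" using openE by blast
    obtain p where p: "p \<in> \<rat>" "x - e < p" "p < x" using Rats_dense_in_real[of "x - e" x] e by auto
    obtain q where q: "q \<in> \<rat>" "x < q" "q < x + e" using Rats_dense_in_real[of x "x + e"] e by auto
    have "{p<..<q} \<subseteq> ball x e" using p q by (auto simp: dist_real_def)
    then have "y = x" if "y \<in> A \<inter> {p<..<q}" for y using T(4) e(2) that by blast
    moreover have "x \<in> A \<inter> {p<..<q}" using T(1) p q by simp
    ultimately have "A \<inter> {p<..<q} = {x}" by blast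
    then show "x \<in> (\<Union>(p,q)\<in>\<rat>\<times>\<rat>. {x. A \<inter> {p<..<q} = {x}})" using p q by blast
  qed
  moreover have "countable {x. A \<inter> {p<..<q} = {x}}" for p q
  proof (cases "\<exists>x. A \<inter> {p<..<q} = {x}")
    case True
    then obtain x where "A \<inter> {p<..<q} = {x}" by blast
    then have "{x. A \<inter> {p<..<q} = {x}} = {x}" by auto
    then show ?thesis by simp
  qed auto
  then have "countable (\<Union>(p,q)\<in>\<rat>\<times>\<rat>. {x. A \<inter> {p<..<q} = {x}})"
    by (auto intro!: countable_UN countable_SIGMA countable_rat)
  ultimately show ?thesis by (rule countable_subset)
qed

text \<open>At a limit point of \<open>A\<close> the derivative of F - G can be computed along
  \<open>A\<close>, where the difference is identically zero. Only countably many points of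
  \<open>A\<close> are not limit points.\<close>

lemma density_eq_on_coincidence_set:
  assumes F: "has_density F f" and G: "has_density G g" and eq: "\<And>y. y \<in> A \<Longrightarrow> F y = G y"
  shows "AE y in lborel. y \<in> A \<longrightarrow> f y = g y"
proof -
  have "AE y in lborel. y \<notin> {x\<in>A. \<not> x islimpt A}"
    by (intro AE_not_in countable_imp_null_set_lborel countable_isolated_points)
  with has_density_DERIV[OF F] has_density_DERIV[OF G] show ?thesis
  proof eventually_elim
    case (elim y)
    show ?case
    proof
      assume y: "y \<in> A"
      then have lim: "at y within A \<noteq> bot" using elim(3) by (simp add: trivial_limit_within)
      have "((\<lambda>z. F z - G z) has_real_derivative f y - g y) (at y within A)"
        using elim(1,2) by (intro DERIV_diff) (auto intro: has_field_derivative_at_within)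
      then have "((\<lambda>z. ((F z - G z) - (F y - G y)) / (z - y)) \<longlongrightarrow> f y - g y) (at y within A)"
        by (simp add: has_field_derivative_iff)
      moreover have "((\<lambda>z. ((F z - G z) - (F y - G y)) / (z - y)) \<longlongrightarrow> 0) (at y within A)"
        by (rule tendsto_eventually) (auto simp: eventually_at_filter eq y)
      ultimately show "f y = g y" using tendsto_unique[OF lim] by fastforce
    qed
  qed
qed

subsection \<open>Replacing a monotone relation by a Lipschitz map\<close>

locale slope_truncation =
  fixes F H :: "real \<Rightarrow> real" and f h :: "real \<Rightarrow> real" and N :: real
  assumes F: "has_density F f" and surjF: "surj F" and H: "has_density H h" and N: "0 < N"
begin

text \<open>Outside the window \<open>H\<close> continues parallel to \<open>F\<close>. This keeps
  it at bounded distance from \<open>F\<close>, so that the infimum defining \<open>trunc\<close> is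
  finite and \<open>trunc\<close> stays near the identity, hence onto.\<close>

definition HN :: "real \<Rightarrow> real" where
  "HN y = (if y < -N then H (-N) + F y - F (-N) else if N < y then H N + F y - F N else H y)"

definition gap :: real where
  "gap = \<bar>H N\<bar> + \<bar>H (-N)\<bar> + \<bar>F N\<bar> + \<bar>F (-N)\<bar>"

lemma F_mono: "a \<le> b \<Longrightarrow> F a \<le> F b" and H_mono: "a \<le> b \<Longrightarrow> H a \<le> H b"
  using has_density_mono[OF F] has_density_mono[OF H] by (auto dest: monoD)

lemma HN_near_F: "\<bar>HN y - F y\<bar> \<le> gap"
  using F_mono[of "-N" y] F_mono[of y N] H_mono[of "-N" y] H_mono[of y N]
  unfolding HN_def gap_def by (auto simp: abs_le_iff)

lemma HN_mono: "a \<le> b \<Longrightarrow> HN a \<le> HN b"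
  using F_mono[of a b] H_mono[of a b] H_mono[of "-N" b] H_mono[of a N] H_mono[of "-N" N] F_mono[of N b] F_mono[of a "-N"] N
  unfolding HN_def by auto

text \<open>The largest \<open>L\<close>-Lipschitz minorant of the monotone relation \<open>{(F y, HN y)}\<close>.\<close>
definition trunc :: "real \<Rightarrow> real \<Rightarrow> real" where
  "trunc L x = (INF y. HN y + L * max 0 (x - F y))"

text \<open>A slope of at least 1 compensates the decrease of \<open>HN\<close> to the left, which
  is that of \<open>F\<close> up to \<open>gap\<close>.\<close>

lemma trunc_bdd:
  assumes "1 \<le> L" shows "x - gap \<le> HN y + L * max 0 (x - F y)"
proof -
  have "1 * max 0 (x - F y) \<le> L * max 0 (x - F y)" using assms by (intro mult_right_mono) auto
  moreover have "x - F y \<le> max 0 (x - F y)" by simp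
  ultimately show ?thesis using HN_near_F[of y] unfolding abs_le_iff mult_1 by linarith
qed

lemma trunc_bdd_below: "1 \<le> L \<Longrightarrow> bdd_below (range (\<lambda>y. HN y + L * max 0 (x - F y)))"
  using trunc_bdd by (intro bdd_belowI2)

lemma trunc_le: "1 \<le> L \<Longrightarrow> trunc L x \<le> HN y + L * max 0 (x - F y)"
  unfolding trunc_def by (intro cINF_lower trunc_bdd_below) auto

lemma trunc_ge: "(\<And>y. c \<le> HN y + L * max 0 (x - F y)) \<Longrightarrow> c \<le> trunc L x"
  unfolding trunc_def by (intro cINF_greatest) auto

lemma trunc_near_identity: "1 \<le> L \<Longrightarrow> \<bar>trunc L x - x\<bar> \<le> gap"
proof -
  assume L: "1 \<le> L"
  obtain y where y: "F y = x" using surjF by (metis surjD)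
  have "trunc L x \<le> HN y" using trunc_le[OF L, of x y] y by simp
  moreover have "x - gap \<le> trunc L x" by (rule trunc_ge) (rule trunc_bdd[OF L])
  ultimately show ?thesis using HN_near_F[of y] y by linarith
qed

lemma trunc_mono: "1 \<le> L \<Longrightarrow> mono (trunc L)"
proof (rule monoI)
  fix x x' :: real assume L: "1 \<le> L" and "x \<le> x'"
  then have "L * max 0 (x - F y) \<le> L * max 0 (x' - F y)" for y by (intro mult_left_mono) auto
  then show "trunc L x \<le> trunc L x'"
    using trunc_le[OF L, of x] by (intro trunc_ge) (meson add_left_mono order_trans)
qed

lemma trunc_Lipschitz: "1 \<le> L \<Longrightarrow> x \<le> x' \<Longrightarrow> \<bar>trunc L x' - trunc L x\<bar> \<le> L * (x' - x)"
proof -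
  assume L: "1 \<le> L" and x: "x \<le> x'"
  have "trunc L x' - L * (x' - x) \<le> trunc L x"
  proof (rule trunc_ge)
    fix y
    have "L * max 0 (x' - F y) \<le> L * (max 0 (x - F y) + (x' - x))" using L x by (intro mult_left_mono) auto
    then show "trunc L x' - L * (x' - x) \<le> HN y + L * max 0 (x - F y)"
      using trunc_le[OF L, of x' y] by (simp add: algebra_simps)
  qed
  then show ?thesis using monoD[OF trunc_mono[OF L] x] by simp
qed

lemma trunc_antimono: "1 \<le> L \<Longrightarrow> L \<le> L' \<Longrightarrow> trunc L x \<le> trunc L' x"
proof (rule trunc_ge)
  fix y assume L: "1 \<le> L" "L \<le> L'"
  have "L * max 0 (x - F y) \<le> L' * max 0 (x - F y)" using L by (intro mult_right_mono) auto
  then show "trunc L x \<le> HN y + L' * max 0 (x - F y)" using trunc_le[OF L(1), of x y] by linarith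
qed

definition contact :: "real \<Rightarrow> real set" where
  "contact L = {y\<in>{-N<..<N}. trunc L (F y) = H y}"

lemma trunc_abs_continuous: "1 \<le> L \<Longrightarrow> abs_continuous_on UNIV (trunc L)"
  by (rule Lipschitz_abs_continuous) (rule trunc_Lipschitz)

lemma trunc_continuous: "1 \<le> L \<Longrightarrow> continuous_on UNIV (trunc L)"
  by (intro abs_continuous_imp_continuous trunc_abs_continuous)

lemma trunc_surj: "1 \<le> L \<Longrightarrow> surj (trunc L)"
  by (intro surj_near_identity[OF trunc_continuous trunc_near_identity])

lemma contact_measurable: "1 \<le> L \<Longrightarrow> contact L \<in> sets borel"
proof -
  assume "1 \<le> L"
  then have [measurable]: "trunc L \<in> borel_measurable borel" by (intro borel_measurable_mono trunc_mono)
  note [measurable] = has_density_measurable_fun[OF F] has_density_measurable_fun[OF H]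
  show ?thesis unfolding contact_def by measurable
qed

lemma contact_mono: "1 \<le> L \<Longrightarrow> L \<le> L' \<Longrightarrow> contact L \<subseteq> contact L'"
proof
  fix y assume L: "1 \<le> L" "L \<le> L'" and y: "y \<in> contact L"
  then have "trunc L (F y) \<le> trunc L' (F y)" by (intro trunc_antimono)
  moreover have "trunc L' (F y) \<le> H y" using trunc_le[of L' "F y" y] L y by (auto simp: contact_def HN_def)
  ultimately show "y \<in> contact L'" using y by (auto simp: contact_def)
qed

text \<open>Contact at y means that the relation does not rise to y faster than slope L from any
  point z on its left. Near y this follows from the derivatives, as F' is positive and H' is finite.
  Far from y, F y - F z is bounded away from zero, and \<open>HN\<close> differs from
  \<open>F\<close> by at most \<open>gap\<close>.\<close>

lemma eventually_contact:
  "AE y in lborel. 0 < f y \<longrightarrow> y \<in> {-N<..<N} \<longrightarrow> (\<exists>n::nat. y \<in> contact (real (Suc n)))"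
  using has_density_DERIV[OF F] has_density_DERIV[OF H]
proof eventually_elim
  case (elim y)
  show ?case
  proof (intro impI)
    assume f: "0 < f y" and y: "y \<in> {-N<..<N}"
    have h0: "0 \<le> h y" by (rule has_density_nonneg[OF H])
    have lims: "((\<lambda>z. (F z - F y) / (z - y)) \<longlongrightarrow> f y) (at y)" "((\<lambda>z. (H z - H y) / (z - y)) \<longlongrightarrow> h y) (at y)"
      using elim by (simp_all add: has_field_derivative_iff)
    have "\<forall>\<^sub>F z in at y. f y / 2 < (F z - F y) / (z - y)"
      by (rule order_tendstoD(1)[OF lims(1)]) (use f in simp)
    moreover have "\<forall>\<^sub>F z in at y. (H z - H y) / (z - y) < h y + 1"
      by (rule order_tendstoD(2)[OF lims(2)]) simp
    ultimately have "\<forall>\<^sub>F z in at y. f y / 2 < (F z - F y) / (z - y) \<and> (H z - H y) / (z - y) < h y + 1"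
      by eventually_elim auto
    then obtain d0 where d0: "d0 > 0" "\<And>z. z \<noteq> y \<Longrightarrow> dist z y < d0 \<Longrightarrow> f y / 2 < (F z - F y) / (z - y) \<and> (H z - H y) / (z - y) < h y + 1"
      by (auto simp: eventually_at)
    \<comment> \<open>The bound y + N keeps all z > y - d inside the window, where \<open>HN\<close>
      is \<open>H\<close>.\<close>
    define d where "d = min d0 (y + N)"
    have d: "d > 0" "d \<le> d0" "d \<le> y + N" using d0 y by (auto simp: d_def)
    have near: "f y / 2 * (y - z) < F y - F z \<and> H y - H z < (h y + 1) * (y - z)" if "y - d < z" "z < y" for z
    proof -
      have q: "f y / 2 < (F z - F y) / (z - y)" "(H z - H y) / (z - y) < h y + 1"
        using d0(2)[of z] that d by (auto simp: dist_real_def)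
      have "f y / 2 * (y - z) < F y - F z" 
      proof -
        have "F z - F y < f y / 2 * (z - y)" using q(1) that by (subst (asm) neg_less_divide_eq) auto
        then show ?thesis by (simp only: right_diff_distrib)
      qed
      moreover have "H y - H z < (h y + 1) * (y - z)" using q(2) that by (simp add: neg_divide_less_eq algebra_simps)
      ultimately show ?thesis by simp
    qed
    \<comment> \<open>Half the distance d, so that the strict estimate \<open>near\<close> still
      applies at this point.\<close>
    define g where "g = F y - F (y - d/2)"
    have g: "g > 0"
    proof -
      have "0 < f y / 2 * (y - (y - d/2))" using f d by simp
      then show ?thesis using near[of "y - d/2"] d unfolding g_def by linarith
    qed
    have gap0: "0 \<le> gap" using HN_near_F[of 0] by linarith
    \<comment> \<open>The first entry is the quotient of the bounds h y + 1 and f y / 2 for z near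
      y. The second serves the far points, where F y - F z \<ge> g absorbs the error 2 *
      gap.\<close>
    define L where "L = max (2 * (h y + 1) / f y) (1 + 2 * gap / g)"
    obtain n :: nat where n: "L < real n" using reals_Archimedean2 by blast
    define K where "K = real (Suc n)"
    have K: "1 \<le> K" "L \<le> K" using n by (auto simp: K_def)
    have HNy: "HN y = H y" using y by (auto simp: HN_def)
    have key: "HN y \<le> HN z + K * max 0 (F y - F z)" for z
    proof -
      have K0: "0 \<le> K * max 0 (F y - F z)" using K by simp
      consider "y \<le> z" | "z < y" "y - d < z" | "z \<le> y - d" by linarith
      then show ?thesis
      proof cases
        case 1
        then show ?thesis using HN_mono[of y z] K0 by linarith
      next
        case 2
        note nz = near[OF 2(2,1)]
        have "HN z = H z" using 2 d y by (auto simp: HN_def)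
        moreover have "H y - H z \<le> K * (F y - F z)"
        proof -
          have "H y - H z \<le> (h y + 1) * (y - z)" using nz by simp
          also have "\<dots> = (2 * (h y + 1) / f y) * (f y / 2 * (y - z))" using f by simp
          also have "\<dots> \<le> K * (f y / 2 * (y - z))"
            using K(2) f 2 by (intro mult_right_mono) (auto simp: L_def)
          also have "\<dots> \<le> K * (F y - F z)" using nz K(1) by (intro mult_left_mono) auto
          finally show ?thesis .
        qed
        moreover have "K * (F y - F z) \<le> K * max 0 (F y - F z)" using K by (intro mult_left_mono) auto
        ultimately show ?thesis using HNy by linarith
      next
        case 3
        then have "F z \<le> F (y - d/2)" using d by (intro F_mono) auto
        then have gz: "g \<le> F y - F z" by (simp add: g_def)
        have "HN y - HN z \<le> F y - F z + 2 * gap" using HN_near_F[of y] HN_near_F[of z] by linarith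
        also have "2 * gap = 2 * gap / g * g" using g by simp
        also have "F y - F z + \<dots> \<le> F y - F z + 2 * gap / g * (F y - F z)"
          using gz gap0 g by (intro add_left_mono mult_left_mono) auto
        also have "\<dots> = (1 + 2 * gap / g) * (F y - F z)" by (simp add: algebra_simps)
        also have "\<dots> \<le> K * (F y - F z)" using K gz g by (intro mult_right_mono) (auto simp: L_def)
        also have "\<dots> \<le> K * max 0 (F y - F z)" using K by (intro mult_left_mono) auto
        finally show ?thesis by linarith
      qed
    qed
    have "HN y \<le> trunc K (F y)" by (rule trunc_ge) (rule key)
    moreover have "trunc K (F y) \<le> HN y" using trunc_le[OF K(1), of "F y" y] by simp
    ultimately show "\<exists>n::nat. y \<in> contact (real (Suc n))"
      using y HNy by (intro exI[of _ n]) (auto simp: contact_def K_def)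
  qed
qed

end

text \<open>The weight \<open>w\<close> is a finite measure, so mass can be exhausted by continuity
  from above: half of e is spent on labels outside a large window, the other half on labels of the
  window not yet in contact. By \<open>supp\<close> and \<open>eventually_contact\<close> the latter
  shrink to a set of weight zero. Densities agree on the contact set because the maps do.\<close>

lemma monotone_relation_approx:
  fixes w :: "real \<Rightarrow> ennreal"
  assumes F: "has_density F f" and surjF: "surj F" and H: "has_density H h"
    and w [measurable]: "w \<in> borel_measurable borel" and fin: "(\<integral>\<^sup>+y. w y \<partial>lborel) < \<infinity>"
    and supp: "AE y in lborel. 0 < w y \<longrightarrow> 0 < f y" and e: "0 < (e::real)"
  obtains \<psi> p A where "has_density \<psi> p" "abs_continuous_on UNIV \<psi>" "surj \<psi>" "A \<in> sets borel"
    "\<And>y. y \<in> A \<Longrightarrow> \<psi> (F y) = H y" "AE y in lborel. y \<in> A \<longrightarrow> p (F y) * f y = h y"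
    "(\<integral>\<^sup>+y. w y * indicator (- A) y \<partial>lborel) \<le> ennreal e"
proof -
  let ?M = "density lborel w"
  have finM: "emeasure ?M S \<noteq> \<infinity>" if "S \<in> sets borel" for S
  proof -
    have "emeasure ?M S \<le> (\<integral>\<^sup>+y. w y \<partial>lborel)"
      using that by (subst emeasure_density) (auto intro!: nn_integral_mono split: split_indicator)
    then show ?thesis using fin by auto
  qed
  have "(\<lambda>n. emeasure ?M (- {-real (Suc n)<..<real (Suc n)})) \<longlonglongrightarrow> emeasure ?M (\<Inter>n. - {-real (Suc n)<..<real (Suc n)})"
    by (rule Lim_emeasure_decseq) (use finM in \<open>auto simp: decseq_def\<close>)
  moreover have "(\<Inter>n. - {-real (Suc n)<..<real (Suc n)}) = {}"
  proof -
    have "\<exists>n. x \<in> {-real (Suc n)<..<real (Suc n)}" for x :: real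
    proof -
      obtain n :: nat where "\<bar>x\<bar> < n" using reals_Archimedean2 by blast
      then show ?thesis by (intro exI[of _ n]) auto
    qed
    then show ?thesis by blast
  qed
  ultimately have "(\<lambda>n. emeasure ?M (- {-real (Suc n)<..<real (Suc n)})) \<longlonglongrightarrow> 0" by simp
  moreover have "0 < ennreal (e/2)" using e by simp
  ultimately have "\<forall>\<^sub>F n in sequentially. emeasure ?M (- {-real (Suc n)<..<real (Suc n)}) < ennreal (e/2)"
    by (rule order_tendstoD(2))
  then obtain m where m: "emeasure ?M (- {-real (Suc m)<..<real (Suc m)}) < ennreal (e/2)"
    by (auto simp: eventually_sequentially)
  define N where "N = real (Suc m)"
  interpret slope_truncation F H f h N
    using F surjF H by unfold_locales (auto simp: N_def)
  let ?E = "\<lambda>n. {-N<..<N} - contact (real (Suc n))"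
  have cm: "contact (real (Suc n)) \<in> sets borel" for n by (rule contact_measurable) auto
  have "(\<lambda>n. emeasure ?M (?E n)) \<longlonglongrightarrow> emeasure ?M (\<Inter>n. ?E n)"
  proof (rule Lim_emeasure_decseq)
    show "decseq ?E" unfolding decseq_def by (intro allI impI Diff_mono contact_mono) auto
  qed (use finM cm in auto)
  moreover have "emeasure ?M (\<Inter>n. ?E n) = 0"
  proof -
    have "AE y in lborel. w y * indicator (\<Inter>n. ?E n) y = 0"
      using supp eventually_contact
    proof eventually_elim
      case (elim y)
      show ?case
      proof (cases "0 < w y \<and> y \<in> (\<Inter>n. ?E n)")
        case True
        then show ?thesis using elim by blast
      next
        case False
        then show ?thesis by (auto split: split_indicator simp: zero_less_iff_neq_zero)
      qed
    qed
    then have "(\<integral>\<^sup>+y. w y * indicator (\<Inter>n. ?E n) y \<partial>lborel) = 0"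
      using cm by (subst nn_integral_0_iff_AE) auto
    moreover have "(\<Inter>n. ?E n) \<in> sets lborel" using cm by auto
    ultimately show ?thesis by (subst emeasure_density) auto
  qed
  ultimately have "(\<lambda>n. emeasure ?M (?E n)) \<longlonglongrightarrow> 0" by simp
  moreover have "0 < ennreal (e/2)" using e by simp
  ultimately have "\<forall>\<^sub>F n in sequentially. emeasure ?M (?E n) < ennreal (e/2)" by (rule order_tendstoD(2))
  then obtain n where n: "emeasure ?M (?E n) < ennreal (e/2)" by (auto simp: eventually_sequentially)
  define L where "L = real (Suc n)"
  have L: "1 \<le> L" by (simp add: L_def)
  obtain p where p: "has_density (trunc L) p"
    using abs_continuous_has_density[OF trunc_abs_continuous[OF L] trunc_mono[OF L]] .
  have A: "contact L \<in> sets borel" by (rule contact_measurable[OF L])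
  show thesis
  proof (rule that[OF p trunc_abs_continuous[OF L] trunc_surj[OF L] A])
    show eq: "trunc L (F y) = H y" if "y \<in> contact L" for y using that by (simp add: contact_def)
    show "AE y in lborel. y \<in> contact L \<longrightarrow> p (F y) * f y = h y"
      by (rule density_eq_on_coincidence_set[OF has_density_compose[OF p F surjF] H eq])
    have "(\<integral>\<^sup>+y. w y * indicator (- contact L) y \<partial>lborel) = emeasure ?M (- contact L)"
      using A by (subst emeasure_density) auto
    also have "\<dots> \<le> emeasure ?M (?E n \<union> (- {-N<..<N}))"
      using A by (intro emeasure_mono) (auto simp: L_def)
    also have "\<dots> \<le> emeasure ?M (?E n) + emeasure ?M (- {-N<..<N})"
      using cm by (intro emeasure_subadditive) auto
    also have "\<dots> \<le> ennreal (e/2) + ennreal (e/2)"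
      using n m by (intro add_mono) (auto simp: N_def)
    also have "\<dots> = ennreal e" using e by (simp add: ennreal_plus[symmetric] del: ennreal_plus)
    finally show "(\<integral>\<^sup>+y. w y * indicator (- contact L) y \<partial>lborel) \<le> ennreal e" .
  qed
qed

section \<open>Couplings parametrised by a common label\<close>

lemma aux_dist_nonneg: "0 < k \<Longrightarrow> 0 \<le> aux_dist k P Q"
  by (cases P; cases Q) auto

lemma aux_dist_graph_Infty_le: "0 < k \<Longrightarrow> aux_dist k (graph_point u x) Infty \<le> k * pi"
proof -
  assume k: "0 < k"
  have "pi / 2 + arctan (dx u x) \<le> pi" "0 \<le> pi / 2 + arctan (dx u x)"
    using arctan_lbound[of "dx u x"] arctan_ubound[of "dx u x"] by simp_all
  then show ?thesis using k by (simp add: graph_point_def)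
qed

lemma measurable_aux_dist_graph:
  assumes "u \<in> X_space" "v \<in> X_space"
    and [measurable]: "a \<in> borel_measurable M" "b \<in> borel_measurable M"
  shows "(\<lambda>x. aux_dist k (graph_point u (a x)) (graph_point v (b x))) \<in> borel_measurable M"
    and "(\<lambda>x. aux_dist k (graph_point u (a x)) Infty) \<in> borel_measurable M"
proof -
  have [measurable]: "u \<in> borel_measurable borel" "v \<in> borel_measurable borel"
    using assms by (auto simp: X_space_def intro: borel_measurable_continuous_onI)
  note [measurable] = dx_measurable[OF assms(1)] dx_measurable[OF assms(2)]
  have [measurable]: "arctan \<in> borel_measurable borel"
    by (intro borel_measurable_continuous_onI continuous_intros)
  show "(\<lambda>x. aux_dist k (graph_point u (a x)) (graph_point v (b x))) \<in> borel_measurable M"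
    "(\<lambda>x. aux_dist k (graph_point u (a x)) Infty) \<in> borel_measurable M"
    unfolding graph_point_def aux_dist.simps by measurable
qed

text \<open>
  A coupling in which neither graph is parametrised by its own variable: \<open>F\<close> and \<open>H\<close> are
  monotone absolutely continuous maps onto the two real lines with densities \<open>f\<close> and \<open>h\<close>.
  Unlike the family of triples in the definition of \<^const>\<open>J\<close>, this one is preserved by the flow.
\<close>
definition coupling_cost ::
  "real \<Rightarrow> (real \<Rightarrow> real) \<Rightarrow> (real \<Rightarrow> real) \<Rightarrow> (real \<Rightarrow> real) \<Rightarrow> (real \<Rightarrow> real) \<Rightarrow> (real \<Rightarrow> real) \<Rightarrow> (real \<Rightarrow> real) \<Rightarrow>
   (real \<Rightarrow> real) \<Rightarrow> (real \<Rightarrow> real) \<Rightarrow> ennreal" where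
  "coupling_cost k u v F f H h \<theta>1 \<theta>2 =
     (\<integral>\<^sup>+y. ennreal (aux_dist k (graph_point u (F y)) (graph_point v (H y)) * \<theta>1 y * (dx u (F y))\<^sup>2 * f y) \<partial>lborel) +
     (\<integral>\<^sup>+y. ennreal (aux_dist k (graph_point u (F y)) Infty * (1 - \<theta>1 y) * (dx u (F y))\<^sup>2 * f y) \<partial>lborel) +
     (\<integral>\<^sup>+y. ennreal (aux_dist k (graph_point v (H y)) Infty * (1 - \<theta>2 y) * (dx v (H y))\<^sup>2 * h y) \<partial>lborel)"

locale coupling =
  fixes u v F f H h \<theta>1 \<theta>2 :: "real \<Rightarrow> real" and k :: real
  assumes u: "u \<in> X_space" and v: "v \<in> X_space"
    and F: "has_density F f" and surjF: "surj F" and H: "has_density H h" and surjH: "surj H"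
    and th1: "simple_function borel \<theta>1" "range \<theta>1 \<subseteq> {0..1}"
    and th2: "simple_function borel \<theta>2" "range \<theta>2 \<subseteq> {0..1}"
    and match: "AE y in lborel. \<theta>1 y * (dx u (F y))\<^sup>2 * f y = \<theta>2 y * (dx v (H y))\<^sup>2 * h y"
    and k: "0 < k"
begin

lemmas [measurable] = has_density_measurable[OF F] has_density_measurable_fun[OF F]
  has_density_measurable[OF H] has_density_measurable_fun[OF H] dx_measurable[OF u] dx_measurable[OF v]
  borel_measurable_simple_function[OF th1(1)] borel_measurable_simple_function[OF th2(1)]
  measurable_ginv[OF F surjF] measurable_ginv[OF H surjH]

lemma th_bounds: "0 \<le> \<theta>1 y" "\<theta>1 y \<le> 1" "0 \<le> \<theta>2 y" "\<theta>2 y \<le> 1"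
  using th1(2) th2(2) by (auto simp: subset_iff)

lemmas f_nonneg = has_density_nonneg[OF F] and h_nonneg = has_density_nonneg[OF H]

definition w :: "real \<Rightarrow> ennreal" where "w y = ennreal (\<theta>1 y * (dx u (F y))\<^sup>2 * f y)"

lemma w_measurable [measurable]: "w \<in> borel_measurable borel" unfolding w_def[abs_def] by measurable

lemma w_finite: "(\<integral>\<^sup>+y. w y \<partial>lborel) < \<infinity>"
proof -
  have "(\<integral>\<^sup>+y. w y \<partial>lborel) \<le> (\<integral>\<^sup>+y. ennreal ((dx u (F y))\<^sup>2) * ennreal (f y) \<partial>lborel)"
  proof (rule nn_integral_mono)
    fix y
    have "\<theta>1 y * ((dx u (F y))\<^sup>2 * f y) \<le> 1 * ((dx u (F y))\<^sup>2 * f y)"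
      using th_bounds[of y] f_nonneg[of y] by (intro mult_right_mono) auto
    then show "w y \<le> ennreal ((dx u (F y))\<^sup>2) * ennreal (f y)"
      unfolding w_def by (simp add: ennreal_mult''[symmetric] f_nonneg ennreal_leI mult.assoc)
  qed
  also have "\<dots> = (\<integral>\<^sup>+x. ennreal ((dx u x)\<^sup>2) \<partial>lborel)"
    by (rule nn_integral_has_density[OF F surjF]) measurable
  also have "\<dots> < \<infinity>" using dx_integrable[OF u] by (simp add: integrable_iff_bounded)
  finally show ?thesis .
qed

lemma w_support: "0 < w y \<Longrightarrow> 0 < f y"
  using f_nonneg[of y] by (cases "f y = 0") (auto simp: w_def)

context
  fixes \<psi> p :: "real \<Rightarrow> real" and A :: "real set"
  assumes p: "has_density \<psi> p" and ac: "abs_continuous_on UNIV \<psi>" and surj: "surj \<psi>"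
    and A [measurable]: "A \<in> sets borel"
    and eqA: "\<And>y. y \<in> A \<Longrightarrow> \<psi> (F y) = H y" and densA: "AE y in lborel. y \<in> A \<longrightarrow> p (F y) * f y = h y"
begin

lemmas [measurable] = has_density_measurable[OF p] has_density_measurable_fun[OF p]

text \<open>The weights of a triple are functions on the two axes, hence the passage back to labels
  by \<open>ginv\<close>. The indicator switches the plan off wherever \<psi> does not follow the
  coupling.\<close>

definition \<phi>1 :: "real \<Rightarrow> real" where "\<phi>1 x = \<theta>1 (ginv F x) * indicator A (ginv F x)"
definition \<phi>2 :: "real \<Rightarrow> real" where "\<phi>2 z = \<theta>2 (ginv H z) * indicator A (ginv H z)"

lemma phi_measurable [measurable]: "\<phi>1 \<in> borel_measurable borel" "\<phi>2 \<in> borel_measurable borel"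
  unfolding \<phi>1_def[abs_def] \<phi>2_def[abs_def] by measurable

lemma phi_bounds: "\<phi>1 x \<in> {0..1}" "\<phi>2 x \<in> {0..1}"
  unfolding \<phi>1_def \<phi>2_def using th_bounds by (auto split: split_indicator)

lemma phi_simple: "simple_function borel \<phi>1" "simple_function borel \<phi>2"
proof -
  have "range \<phi>1 \<subseteq> insert 0 (range \<theta>1)" "range \<phi>2 \<subseteq> insert 0 (range \<theta>2)"
    unfolding \<phi>1_def \<phi>2_def by (auto split: split_indicator)
  moreover have "finite (range \<theta>1)" "finite (range \<theta>2)"
    using simple_functionD(1)[OF th1(1)] simple_functionD(1)[OF th2(1)] by auto
  ultimately have "finite (range \<phi>1)" "finite (range \<phi>2)"
    by (meson finite_insert finite_subset)+
  then show "simple_function borel \<phi>1" "simple_function borel \<phi>2"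
    by (simp_all add: simple_function_borel_measurable phi_measurable)
qed

lemma phi1_F: "AE y in lborel. 0 < f y \<longrightarrow> \<phi>1 (F y) = \<theta>1 y * indicator A y"
  using AE_ginv_left[OF F surjF] by eventually_elim (simp add: \<phi>1_def)

lemma phi2_H: "AE y in lborel. 0 < h y \<longrightarrow> \<phi>2 (H y) = \<theta>2 y * indicator A y"
  using AE_ginv_left[OF H surjH] by eventually_elim (simp add: \<phi>2_def)

lemma deriv_psi: "AE x in lborel. deriv \<psi> x = p x"
  using has_density_DERIV[OF p] by eventually_elim (rule DERIV_imp_deriv)

text \<open>The identity is checked at x = F y. On \<open>A\<close> it is the given matching with p
  (F y) * f y = h y. Off \<open>A\<close> the left side is zero, and the point is that the right
  side vanishes as well.\<close>

lemma truncated_match: "AE x in lborel. \<phi>1 x * (dx u x)\<^sup>2 = p x * \<phi>2 (\<psi> x) * (dx v (\<psi> x))\<^sup>2"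
proof -
  have comp: "has_density (\<lambda>y. \<psi> (F y)) (\<lambda>y. p (F y) * f y)" by (rule has_density_compose[OF p F surjF])
  have surjc: "surj (\<lambda>y. \<psi> (F y))" using comp_surj[OF surjF surj] by (simp only: comp_def)
  have "AE y in lborel. 0 < f y \<longrightarrow> \<phi>1 (F y) * (dx u (F y))\<^sup>2 = p (F y) * \<phi>2 (\<psi> (F y)) * (dx v (\<psi> (F y)))\<^sup>2"
    using phi1_F phi2_H match densA AE_has_density_inj[OF comp surjc]
  proof eventually_elim
    case (elim y)
    show ?case
    proof
      assume f: "0 < f y"
      show "\<phi>1 (F y) * (dx u (F y))\<^sup>2 = p (F y) * \<phi>2 (\<psi> (F y)) * (dx v (\<psi> (F y)))\<^sup>2"
      proof (cases "y \<in> A")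
        case True
        have ph: "p (F y) * f y = h y" using elim True by blast
        have hphi: "h y * \<phi>2 (H y) = h y * \<theta>2 y"
          using elim(2) True h_nonneg[of y] by (cases "h y = 0") auto
        have "f y * (\<phi>1 (F y) * (dx u (F y))\<^sup>2) = \<theta>2 y * (dx v (H y))\<^sup>2 * h y"
          using elim(1,3) f True by (simp add: mult.commute mult.left_commute)
        also have "\<dots> = (h y * \<phi>2 (H y)) * (dx v (H y))\<^sup>2" unfolding hphi by (simp only: ac_simps)
        also have "\<dots> = f y * (p (F y) * \<phi>2 (\<psi> (F y)) * (dx v (\<psi> (F y)))\<^sup>2)"
          using eqA[OF True] ph by (simp add: ph[symmetric] ac_simps)
        finally show ?thesis using f by simp
      next
        case False
        \<comment> \<open>Otherwise \<psi> (F y) = H z for some z in \<open>A\<close>, where H z =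
          \<psi> (F z). The composite has positive density at y, so it is injective there and z = y,
          contradicting that y is off \<open>A\<close>.\<close>
        have "p (F y) * \<phi>2 (\<psi> (F y)) = 0"
        proof (rule ccontr)
          assume nz: "p (F y) * \<phi>2 (\<psi> (F y)) \<noteq> 0"
          then have "0 < p (F y)" using has_density_nonneg[OF p, of "F y"] by (simp add: less_le)
          then have inj: "\<psi> (F y') = \<psi> (F y) \<Longrightarrow> y' = y" for y' using elim(5) f by simp
          define z where "z = ginv H (\<psi> (F y))"
          have "z \<in> A" using nz by (auto simp: \<phi>2_def z_def split: split_indicator_asm)
          moreover have "H z = \<psi> (F y)"
            unfolding z_def using H surjH has_density_mono has_density_continuous by (intro ginv_right) auto
          ultimately have "z = y" using eqA[of z] by (intro inj) simp
          then show False using False \<open>z \<in> A\<close> by simp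
        qed
        then show ?thesis using elim(1) f False by simp
      qed
    qed
  qed
  then show ?thesis by (subst AE_has_density_iff[OF F surjF]) auto
qed

lemma truncated_admissible: "(\<psi>, \<phi>1, \<phi>2) \<in> admissible u v"
proof -
  have "AE x in lborel. \<phi>1 x * (dx u x)\<^sup>2 = deriv \<psi> x * \<phi>2 (\<psi> x) * (dx v (\<psi> x))\<^sup>2"
    using truncated_match deriv_psi by eventually_elim simp
  then have "AE x in lebesgue. \<phi>1 x * (dx u x)\<^sup>2 = deriv \<psi> x * \<phi>2 (\<psi> x) * (dx v (\<psi> x))\<^sup>2"
    by (rule AE_completion)
  then show ?thesis
    unfolding admissible_def transport_triples_def
    using phi_simple phi_bounds has_density_mono[OF p] ac surj by auto
qed

text \<open>Dropping a matched label sends its energy to \<open>Infty\<close>, at distance at most k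
  * pi, on both graphs. The matched energy \<open>w\<close> is the same on either side, which
  accounts for the factor 2.\<close>

lemma truncated_cost:
  "transport_cost k u v (\<psi>, \<phi>1, \<phi>2) \<le> coupling_cost k u v F f H h \<theta>1 \<theta>2
     + ennreal (2 * k * pi) * (\<integral>\<^sup>+y. w y * indicator (- A) y \<partial>lborel)"
proof -
  let ?R = "\<integral>\<^sup>+y. w y * indicator (- A) y \<partial>lborel"
  let ?du = "\<lambda>x. aux_dist k (graph_point u x) Infty"
  let ?dv = "\<lambda>x. aux_dist k (graph_point v x) Infty"
  note [measurable] = measurable_aux_dist_graph[OF u v] measurable_aux_dist_graph(2)[OF v u]
  have nn: "0 \<le> aux_dist k P Q" for P Q by (rule aux_dist_nonneg[OF k])
  have 1: "(\<integral>\<^sup>+x. ennreal (aux_dist k (graph_point u x) (graph_point v (\<psi> x)) * \<phi>1 x * (dx u x)\<^sup>2) \<partial>lebesgue)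
     \<le> (\<integral>\<^sup>+y. ennreal (aux_dist k (graph_point u (F y)) (graph_point v (H y)) * \<theta>1 y * (dx u (F y))\<^sup>2 * f y) \<partial>lborel)"
  proof -
    have "(\<integral>\<^sup>+x. ennreal (aux_dist k (graph_point u x) (graph_point v (\<psi> x)) * \<phi>1 x * (dx u x)\<^sup>2) \<partial>lebesgue)
       = (\<integral>\<^sup>+y. ennreal (aux_dist k (graph_point u (F y)) (graph_point v (\<psi> (F y))) * \<phi>1 (F y) * (dx u (F y))\<^sup>2) * ennreal (f y) \<partial>lborel)"
      unfolding nn_integral_completion by (rule nn_integral_has_density[OF F surjF, symmetric]) measurable
    also have "\<dots> \<le> (\<integral>\<^sup>+y. ennreal (aux_dist k (graph_point u (F y)) (graph_point v (H y)) * \<theta>1 y * (dx u (F y))\<^sup>2 * f y) \<partial>lborel)"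
    proof (rule nn_integral_mono_AE)
      show "AE y in lborel. ennreal (aux_dist k (graph_point u (F y)) (graph_point v (\<psi> (F y))) * \<phi>1 (F y) * (dx u (F y))\<^sup>2) * ennreal (f y)
          \<le> ennreal (aux_dist k (graph_point u (F y)) (graph_point v (H y)) * \<theta>1 y * (dx u (F y))\<^sup>2 * f y)"
        using phi1_F
      proof eventually_elim
        case (elim y)
        show ?case
        proof (cases "0 < f y \<and> y \<in> A")
          case True
          then show ?thesis using elim eqA[of y] by (simp add: ennreal_mult''[symmetric])
        next
          case False
          then have "\<phi>1 (F y) * f y = 0" using elim f_nonneg[of y] by (cases "f y = 0") auto
          then have "\<phi>1 (F y) = 0 \<or> f y = 0" by simp
          then show ?thesis by auto
        qed
      qed
    qed
    finally show ?thesis .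
  qed
  have 2: "(\<integral>\<^sup>+x. ennreal (?du x * (1 - \<phi>1 x) * (dx u x)\<^sup>2) \<partial>lebesgue)
     \<le> (\<integral>\<^sup>+y. ennreal (?du (F y) * (1 - \<theta>1 y) * (dx u (F y))\<^sup>2 * f y) \<partial>lborel) + ennreal (k * pi) * ?R"
  proof -
    have "(\<integral>\<^sup>+x. ennreal (?du x * (1 - \<phi>1 x) * (dx u x)\<^sup>2) \<partial>lebesgue)
       = (\<integral>\<^sup>+y. ennreal (?du (F y) * (1 - \<phi>1 (F y)) * (dx u (F y))\<^sup>2) * ennreal (f y) \<partial>lborel)"
      unfolding nn_integral_completion by (rule nn_integral_has_density[OF F surjF, symmetric]) measurable
    also have "\<dots> \<le> (\<integral>\<^sup>+y. ennreal (?du (F y) * (1 - \<theta>1 y) * (dx u (F y))\<^sup>2 * f y) + ennreal (k * pi) * (w y * indicator (- A) y) \<partial>lborel)"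
    proof (rule nn_integral_mono_AE)
      show "AE y in lborel. ennreal (?du (F y) * (1 - \<phi>1 (F y)) * (dx u (F y))\<^sup>2) * ennreal (f y)
          \<le> ennreal (?du (F y) * (1 - \<theta>1 y) * (dx u (F y))\<^sup>2 * f y) + ennreal (k * pi) * (w y * indicator (- A) y)"
        using phi1_F
      proof eventually_elim
        case (elim y)
        show ?case
        proof (cases "0 < f y")
          case True
          show ?thesis
          proof (cases "y \<in> A")
            case yA: False
            have m: "0 \<le> \<theta>1 y * (dx u (F y))\<^sup>2 * f y" using th_bounds[of y] True by simp
            have "?du (F y) * (dx u (F y))\<^sup>2 * f y = ?du (F y) * (1 - \<theta>1 y) * (dx u (F y))\<^sup>2 * f y + ?du (F y) * (\<theta>1 y * (dx u (F y))\<^sup>2 * f y)"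
              by (simp add: algebra_simps)
            also have "\<dots> \<le> ?du (F y) * (1 - \<theta>1 y) * (dx u (F y))\<^sup>2 * f y + (k * pi) * (\<theta>1 y * (dx u (F y))\<^sup>2 * f y)"
              by (intro add_left_mono mult_right_mono aux_dist_graph_Infty_le k m)
            finally have le: "?du (F y) * (dx u (F y))\<^sup>2 * f y \<le> \<dots>" .
            have "ennreal (?du (F y) * (1 - \<phi>1 (F y)) * (dx u (F y))\<^sup>2) * ennreal (f y) = ennreal (?du (F y) * (dx u (F y))\<^sup>2 * f y)"
              using elim True yA by (simp add: ennreal_mult''[symmetric])
            also have "\<dots> \<le> ennreal (?du (F y) * (1 - \<theta>1 y) * (dx u (F y))\<^sup>2 * f y + (k * pi) * (\<theta>1 y * (dx u (F y))\<^sup>2 * f y))"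
              by (rule ennreal_leI[OF le])
            also have "\<dots> = ennreal (?du (F y) * (1 - \<theta>1 y) * (dx u (F y))\<^sup>2 * f y) + ennreal (k * pi) * w y"
              using th_bounds[of y] True k nn m by (simp only: w_def) (subst ennreal_plus, auto simp: ennreal_mult''[symmetric] simp del: aux_dist.simps)
            finally show ?thesis using yA by simp
          next
            case yA: True
            then show ?thesis using elim True by (simp add: ennreal_mult''[symmetric])
          qed
        next
          case False
          then show ?thesis using f_nonneg[of y] by (simp add: not_less)
        qed
      qed
    qed
    also have "\<dots> = (\<integral>\<^sup>+y. ennreal (?du (F y) * (1 - \<theta>1 y) * (dx u (F y))\<^sup>2 * f y) \<partial>lborel) + ennreal (k * pi) * ?R"
      by (subst nn_integral_add) (auto simp: nn_integral_cmult)
    finally show ?thesis .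
  qed
  have 3: "(\<integral>\<^sup>+x. ennreal (?dv (\<psi> x) * (1 - \<phi>2 (\<psi> x)) * (dx v (\<psi> x))\<^sup>2 * deriv \<psi> x) \<partial>lebesgue)
     \<le> (\<integral>\<^sup>+y. ennreal (?dv (H y) * (1 - \<theta>2 y) * (dx v (H y))\<^sup>2 * h y) \<partial>lborel) + ennreal (k * pi) * ?R"
  proof -
    have "(\<integral>\<^sup>+x. ennreal (?dv (\<psi> x) * (1 - \<phi>2 (\<psi> x)) * (dx v (\<psi> x))\<^sup>2 * deriv \<psi> x) \<partial>lebesgue)
       = (\<integral>\<^sup>+x. ennreal (?dv (\<psi> x) * (1 - \<phi>2 (\<psi> x)) * (dx v (\<psi> x))\<^sup>2) * ennreal (p x) \<partial>lborel)"
      unfolding nn_integral_completion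
    proof (rule nn_integral_cong_AE)
      show "AE x in lborel. ennreal (?dv (\<psi> x) * (1 - \<phi>2 (\<psi> x)) * (dx v (\<psi> x))\<^sup>2 * deriv \<psi> x)
          = ennreal (?dv (\<psi> x) * (1 - \<phi>2 (\<psi> x)) * (dx v (\<psi> x))\<^sup>2) * ennreal (p x)"
        using deriv_psi by eventually_elim (simp add: ennreal_mult''[symmetric] has_density_nonneg[OF p])
    qed
    also have "\<dots> = (\<integral>\<^sup>+z. ennreal (?dv z * (1 - \<phi>2 z) * (dx v z)\<^sup>2) \<partial>lborel)"
      by (rule nn_integral_has_density[OF p surj]) measurable
    also have "\<dots> = (\<integral>\<^sup>+y. ennreal (?dv (H y) * (1 - \<phi>2 (H y)) * (dx v (H y))\<^sup>2) * ennreal (h y) \<partial>lborel)"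
      by (rule nn_integral_has_density[OF H surjH, symmetric]) measurable
    also have "\<dots> \<le> (\<integral>\<^sup>+y. ennreal (?dv (H y) * (1 - \<theta>2 y) * (dx v (H y))\<^sup>2 * h y) + ennreal (k * pi) * (w y * indicator (- A) y) \<partial>lborel)"
    proof (rule nn_integral_mono_AE)
      show "AE y in lborel. ennreal (?dv (H y) * (1 - \<phi>2 (H y)) * (dx v (H y))\<^sup>2) * ennreal (h y)
          \<le> ennreal (?dv (H y) * (1 - \<theta>2 y) * (dx v (H y))\<^sup>2 * h y) + ennreal (k * pi) * (w y * indicator (- A) y)"
        using phi2_H match
      proof eventually_elim
        case (elim y)
        show ?case
        proof (cases "0 < h y")
          case True
          show ?thesis
          proof (cases "y \<in> A")
            case yA: False
            have m: "0 \<le> \<theta>2 y * (dx v (H y))\<^sup>2 * h y" using th_bounds[of y] True by simp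
            have "?dv (H y) * (dx v (H y))\<^sup>2 * h y = ?dv (H y) * (1 - \<theta>2 y) * (dx v (H y))\<^sup>2 * h y + ?dv (H y) * (\<theta>2 y * (dx v (H y))\<^sup>2 * h y)"
              by (simp add: algebra_simps)
            also have "\<dots> \<le> ?dv (H y) * (1 - \<theta>2 y) * (dx v (H y))\<^sup>2 * h y + (k * pi) * (\<theta>2 y * (dx v (H y))\<^sup>2 * h y)"
              by (intro add_left_mono mult_right_mono aux_dist_graph_Infty_le k m)
            finally have le: "?dv (H y) * (dx v (H y))\<^sup>2 * h y \<le> \<dots>" .
            have "ennreal (?dv (H y) * (1 - \<phi>2 (H y)) * (dx v (H y))\<^sup>2) * ennreal (h y) = ennreal (?dv (H y) * (dx v (H y))\<^sup>2 * h y)"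
              using elim True yA by (simp add: ennreal_mult''[symmetric])
            also have "\<dots> \<le> ennreal (?dv (H y) * (1 - \<theta>2 y) * (dx v (H y))\<^sup>2 * h y + (k * pi) * (\<theta>2 y * (dx v (H y))\<^sup>2 * h y))"
              by (rule ennreal_leI[OF le])
            also have "\<dots> = ennreal (?dv (H y) * (1 - \<theta>2 y) * (dx v (H y))\<^sup>2 * h y) + ennreal (k * pi) * w y"
              using th_bounds[of y] True k nn m by (simp only: w_def elim(2)) (subst ennreal_plus, auto simp: ennreal_mult''[symmetric] simp del: aux_dist.simps)
            finally show ?thesis using yA by simp
          next
            case yA: True
            then show ?thesis using elim True by (simp add: ennreal_mult''[symmetric])
          qed
        next
          case False
          then show ?thesis using h_nonneg[of y] by (simp add: not_less)
        qed
      qed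
    qed
    also have "\<dots> = (\<integral>\<^sup>+y. ennreal (?dv (H y) * (1 - \<theta>2 y) * (dx v (H y))\<^sup>2 * h y) \<partial>lborel) + ennreal (k * pi) * ?R"
      by (subst nn_integral_add) (auto simp: nn_integral_cmult)
    finally show ?thesis .
  qed
  have "ennreal (2 * k * pi) * ?R = ennreal (k * pi) * ?R + ennreal (k * pi) * ?R"
    using k by (simp add: distrib_right[symmetric] ennreal_plus[symmetric] del: ennreal_plus)
  then show ?thesis
    using add_mono[OF add_mono[OF 1 2] 3] unfolding transport_cost_def coupling_cost_def by (simp add: ac_simps)
qed

end

lemma J_le_coupling_cost: "J k u v \<le> coupling_cost k u v F f H h \<theta>1 \<theta>2"
proof (rule ennreal_le_epsilon)
  fix e :: real assume e: "0 < e"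
  \<comment> \<open>Chosen so that the truncation error 2 * k * pi * e' is exactly e.\<close>
  define e' where "e' = e / (2 * k * pi)"
  have e': "0 < e'" using e k by (simp add: e'_def)
  have supp: "AE y in lborel. 0 < w y \<longrightarrow> 0 < f y" using w_support by auto
  from monotone_relation_approx[OF F surjF H w_measurable w_finite supp e']
  obtain \<psi> p A where A: "has_density \<psi> p" "abs_continuous_on UNIV \<psi>" "surj \<psi>" "A \<in> sets borel"
    "\<And>y. y \<in> A \<Longrightarrow> \<psi> (F y) = H y" "AE y in lborel. y \<in> A \<longrightarrow> p (F y) * f y = h y"
    "(\<integral>\<^sup>+y. w y * indicator (- A) y \<partial>lborel) \<le> ennreal e'"
    by blast
  have "J k u v \<le> transport_cost k u v (\<psi>, \<phi>1 A, \<phi>2 A)"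
    unfolding J_def by (rule INF_lower) (rule truncated_admissible[OF A(1-6)])
  also have "\<dots> \<le> coupling_cost k u v F f H h \<theta>1 \<theta>2 + ennreal (2 * k * pi) * (\<integral>\<^sup>+y. w y * indicator (- A) y \<partial>lborel)"
    by (rule truncated_cost[OF A(1-6)])
  also have "\<dots> \<le> coupling_cost k u v F f H h \<theta>1 \<theta>2 + ennreal (2 * k * pi) * ennreal e'"
    by (intro add_left_mono mult_left_mono A) auto
  also have "ennreal (2 * k * pi) * ennreal e' = ennreal e"
    using k e by (simp add: e'_def ennreal_mult''[symmetric])
  finally show "J k u v \<le> coupling_cost k u v F f H h \<theta>1 \<theta>2 + ennreal e" .
qed

end

subsection \<open>Angles along characteristics\<close>

text \<open>The angle above - pi / 2, which times the constant of the metric is the distance to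
  \<open>Infty\<close>. It descends to 0 at blow-up, so the value 0 for dead labels continues
  it.\<close>

definition height :: "real \<Rightarrow> real \<Rightarrow> real" where
  "height t k = (if alive t k then pi / 2 + arctan (slope_at t k) else 0)"

lemma measurable_height [measurable (raw)]:
  assumes [measurable]: "f \<in> borel_measurable M" "g \<in> borel_measurable M"
  shows "(\<lambda>x. height (f x) (g x)) \<in> borel_measurable M"
proof -
  have [measurable]: "arctan \<in> borel_measurable borel"
    by (intro borel_measurable_continuous_onI continuous_intros)
  show ?thesis unfolding height_def by measurable
qed

lemma height_nonneg: "0 \<le> height t k"
  using arctan_lbound[of "slope_at t k"] by (simp add: height_def)

lemma height_0: "height 0 k = pi / 2 + arctan k"
  by (simp add: height_def alive_def slope_at_def)

text \<open>The reciprocal of the slope is linear in time, 1 / k + t / 2. In this form the height is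
  smooth through the blow-up time, where the slope itself is infinite.\<close>

lemma height_negative:
  assumes "k < 0" "alive t k" shows "height t k = - arctan (1 / k + t / 2)"
proof -
  have "slope_at t k < 0" using assms by (simp add: slope_at_def alive_def divide_neg_pos)
  then have "arctan (1 / slope_at t k) = - pi / 2 - arctan (slope_at t k)"
  proof -
    have ne: "slope_at t k \<noteq> 0" and sg: "sgn (slope_at t k) = - 1" using \<open>slope_at t k < 0\<close> by auto
    show ?thesis using Transcendental.arctan_inverse[OF ne] unfolding sg by linarith
  qed
  moreover have "1 / slope_at t k = 1 / k + t / 2" using assms by (simp add: slope_at_def alive_def field_simps)
  ultimately show ?thesis using assms by (simp add: height_def)
qed

lemma lifetime_le_death: "k < 0 \<Longrightarrow> 0 \<le> t \<Longrightarrow> lifetime t k \<le> - 2 / k"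
  by (auto simp: lifetime_def alive_def field_simps)

lemma not_alive_lifetime_eq: "\<not> alive t k \<Longrightarrow> lifetime t k = - 2 / k"
  by (simp add: lifetime_def)

text \<open>For k < 0 put q = 1 / k + s / 2. The derivative of exp (- s) * \<kappa> * height is -
  exp (- s) * \<kappa> * ((1/2) / (1 + q^2) - arctan q), and the bracket is at least 1/4; this is
  the origin of \<open>4 * \<mu> \<le> \<kappa>\<close>. For k \<ge> 0 the height does not increase
  and is at least pi / 2 \<ge> 1, so the factor exp (- s) alone supplies the gain.\<close>

lemma height_dissipation:
  assumes t: "0 \<le> t" and r: "0 \<le> r" "r \<le> lifetime t k" and lam: "0 \<le> \<mu>" "4 * \<mu> \<le> \<kappa>"
  shows "exp (- t) * (\<kappa> * height t k) + \<mu> * (exp (- r) - exp (- lifetime t k)) \<le> exp (- r) * (\<kappa> * height r k)"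
proof (cases "k < 0")
  case False
  then have al: "alive s k" if "0 \<le> s" for s using that by (simp add: alive_def add_pos_nonneg)
  have tau: "lifetime t k = t" using al[OF t] by (simp add: lifetime_def)
  have "slope_at t k \<le> slope_at r k"
  proof -
    have "r * k \<le> t * k" using r tau False by (intro mult_right_mono) auto
    then show ?thesis using False al[OF r(1)] unfolding slope_at_def alive_def by (intro divide_left_mono mult_pos_pos) auto
  qed
  then have h: "height t k \<le> height r k" using al t r by (simp add: height_def arctan_monotone')
  have "0 \<le> slope_at r k" using False al[OF r(1)] by (simp add: slope_at_def alive_def)
  then have "1 \<le> height r k" using al[OF r(1)] pi_ge_two by (simp add: height_def add_increasing2)
  then have "\<kappa> * 1 \<le> \<kappa> * height r k" using lam by (intro mult_left_mono) auto
  then have lk: "\<mu> \<le> \<kappa> * height r k" using lam by linarith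
  have e: "exp (- t) \<le> exp (- r)" using r tau by simp
  have "exp (- t) * (\<kappa> * height t k) \<le> exp (- t) * (\<kappa> * height r k)"
    using h lam by (intro mult_left_mono) auto
  moreover have "\<mu> * (exp (- r) - exp (- t)) \<le> (\<kappa> * height r k) * (exp (- r) - exp (- t))"
    using lk e by (intro mult_right_mono) auto
  ultimately show ?thesis unfolding tau by (simp add: algebra_simps)
next
  case True
  let ?T = "lifetime t k"
  let ?g = "\<lambda>s. exp (- s) * (\<kappa> * (- arctan (1 / k + s / 2)) - \<mu>)"
  have T2: "?T \<le> - 2 / k" by (rule lifetime_le_death[OF True t])
  have g: "?g ?T \<le> ?g r"
  proof (rule DERIV_nonpos_imp_nonincreasing[OF r(2)])
    fix s assume s: "r \<le> s" "s \<le> ?T"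
    define q where "q = 1 / k + s / 2"
    have q: "q \<le> 0"
    proof -
      have "s / 2 \<le> (- 2 / k) / 2" using s T2 by (intro divide_right_mono) auto
      then show ?thesis by (simp add: q_def)
    qed
    have D: "(?g has_real_derivative exp (- s) * (\<kappa> * (- (1/2) / (1 + q\<^sup>2)) - (\<kappa> * (- arctan q) - \<mu>))) (at s)"
      unfolding q_def by (auto intro!: derivative_eq_intros simp: field_simps)
    \<comment> \<open>For -1 \<le> q \<le> 0 the first term suffices, the motion of the angle. For q
      < -1 the second does, the angle itself, which exceeds pi / 4.\<close>
    have "1/4 \<le> (1/2) / (1 + q\<^sup>2) - arctan q"
    proof (cases "-1 \<le> q")
      case True
      then have "q\<^sup>2 \<le> 1" using q by (simp add: abs_square_le_1)
      then have "1/4 \<le> (1/2) / (1 + q\<^sup>2)" by (simp add: field_simps add_pos_nonneg)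
      moreover have "arctan q \<le> 0" using q by simp
      ultimately show ?thesis by linarith
    next
      case False
      then have "arctan q \<le> arctan (-1)" by (intro arctan_monotone') auto
      moreover have "0 \<le> (1/2) / (1 + q\<^sup>2)" by (simp add: add_nonneg_nonneg)
      moreover have "arctan (-1) = - (pi / 4)" by (simp add: arctan_minus arctan_one)
      ultimately show ?thesis using pi_ge_two by linarith
    qed
    then have "\<kappa> * (1/4) \<le> \<kappa> * ((1/2) / (1 + q\<^sup>2) - arctan q)" using lam by (intro mult_left_mono) auto
    then have "\<mu> \<le> \<kappa> * ((1/2) / (1 + q\<^sup>2) - arctan q)" using lam by linarith
    then have "\<kappa> * (- (1/2) / (1 + q\<^sup>2)) - (\<kappa> * (- arctan q) - \<mu>) \<le> 0" by (simp add: algebra_simps)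
    then have "exp (- s) * (\<kappa> * (- (1/2) / (1 + q\<^sup>2)) - (\<kappa> * (- arctan q) - \<mu>)) \<le> 0" by (simp add: mult_nonneg_nonpos)
    with D show "\<exists>y. (?g has_real_derivative y) (at s) \<and> y \<le> 0" by blast
  qed
  \<comment> \<open>If the label is dead at r \<le> lifetime, then r is the blow-up time and both
    sides are 0.\<close>
  have hr: "height r k = - arctan (1 / k + r / 2)"
  proof (cases "alive r k")
    case False
    then have "- 2 / k \<le> r" using True by (simp add: alive_def field_simps)
    then have "r = - 2 / k" using T2 r by linarith
    then show ?thesis using False True by (simp add: height_def)
  qed (rule height_negative[OF True])
  have ht: "exp (- t) * (\<kappa> * height t k) = exp (- ?T) * (\<kappa> * (- arctan (1 / k + ?T / 2)))"
  proof (cases "alive t k")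
    case True
    then show ?thesis using height_negative[OF \<open>k < 0\<close> True] by (simp add: lifetime_def)
  next
    case False
    then show ?thesis using True by (simp add: height_def lifetime_def)
  qed
  show ?thesis using g unfolding ht hr by (simp add: algebra_simps)
qed

text \<open>With a = 1 + t * k / 2, the derivative of arctan (slope_at t k) in k is 1 / (a^2 + k^2),
  so this bounds the expansion of angles by exp t. The time derivative of the right side is exp s *
  ((a + k / 2)^2 + 3/4 * k^2), which is nonnegative.\<close>

lemma angle_expansion: "0 \<le> (t::real) \<Longrightarrow> 1 + k\<^sup>2 \<le> exp t * ((1 + t * k / 2)\<^sup>2 + k\<^sup>2)"
proof -
  assume t: "0 \<le> t"
  let ?E = "\<lambda>s. exp s * ((1 + s * k / 2)\<^sup>2 + k\<^sup>2)"
  have "?E 0 \<le> ?E t"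
  proof (rule DERIV_nonneg_imp_nondecreasing[OF t])
    fix s assume "0 \<le> s" "s \<le> t"
    let ?a = "1 + s * k / 2"
    have "(?E has_real_derivative exp s * (?a\<^sup>2 + k\<^sup>2 + ?a * k)) (at s)"
      by (auto intro!: derivative_eq_intros simp: field_simps power2_eq_square)
    moreover have "0 \<le> ?a\<^sup>2 + k\<^sup>2 + ?a * k"
    proof -
      have "?a\<^sup>2 + k\<^sup>2 + ?a * k = (?a + k / 2)\<^sup>2 + 3/4 * k\<^sup>2" by (simp add: power2_eq_square field_simps)
      then show ?thesis by simp
    qed
    ultimately show "\<exists>y. (?E has_real_derivative y) (at s) \<and> 0 \<le> y" by (meson exp_ge_zero mult_nonneg_nonneg)
  qed
  then show ?thesis by simp
qed

lemma angle_rate: "0 \<le> (t::real) \<Longrightarrow> 0 < (1 + t * k / 2)\<^sup>2 + k\<^sup>2 \<Longrightarrow> 1 / ((1 + t * k / 2)\<^sup>2 + k\<^sup>2) \<le> exp t / (1 + k\<^sup>2)"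
proof -
  assume t: "0 \<le> t" and pos: "0 < (1 + t * k / 2)\<^sup>2 + k\<^sup>2"
  have "0 < 1 + k\<^sup>2" by (simp add: add_pos_nonneg)
  then show ?thesis using angle_expansion[OF t, of k] pos by (simp add: divide_simps mult.commute)
qed

lemma alive_mono: "alive t k \<Longrightarrow> 0 \<le> t \<Longrightarrow> k \<le> l \<Longrightarrow> alive t l"
proof -
  assume "alive t k" "0 \<le> t" "k \<le> l"
  moreover then have "t * k \<le> t * l" by (intro mult_left_mono)
  ultimately show ?thesis by (simp add: alive_def)
qed

text \<open>The difference exp t * arctan x - arctan (slope_at t x) has nonnegative derivative in x.
  All x \<ge> k are alive along with k, so no blow-up occurs on the way.\<close>

lemma angle_increase:
  assumes t: "0 \<le> t" and k: "alive t k" and kl: "k \<le> l"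
  shows "arctan (slope_at t l) - arctan (slope_at t k) \<le> exp t * (arctan l - arctan k)"
    and "arctan (slope_at t k) \<le> arctan (slope_at t l)"
proof -
  let ?G = "\<lambda>x. exp t * arctan x - arctan (slope_at t x)"
  have "?G k \<le> ?G l"
  proof (rule DERIV_nonneg_imp_nondecreasing[OF kl])
    fix x assume x: "k \<le> x" "x \<le> l"
    define a where "a = 1 + t * x / 2"
    have a: "0 < a" using alive_mono[OF k t x(1)] by (simp add: alive_def a_def)
    have s: "(slope_at t has_real_derivative 1 / a\<^sup>2) (at x)"
      unfolding slope_at_def[abs_def] a_def using a
      by (auto intro!: derivative_eq_intros simp: a_def power2_eq_square)
    have D: "(?G has_real_derivative exp t * inverse (1 + x\<^sup>2) - inverse (1 + (slope_at t x)\<^sup>2) * (1 / a\<^sup>2)) (at x)"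
      by (rule DERIV_diff[OF DERIV_cmult[OF DERIV_arctan] DERIV_chain2[OF DERIV_arctan s]])
    have "inverse (1 + (slope_at t x)\<^sup>2) * (1 / a\<^sup>2) = 1 / (a\<^sup>2 + x\<^sup>2)"
    proof -
      have e: "(1 + (slope_at t x)\<^sup>2) * a\<^sup>2 = a\<^sup>2 + x\<^sup>2"
        using a by (simp add: slope_at_def a_def[symmetric] power_divide distrib_right)
      show ?thesis unfolding e[symmetric] by (simp only: divide_inverse inverse_mult_distrib mult_1_left)
    qed
    moreover have "1 / (a\<^sup>2 + x\<^sup>2) \<le> exp t * inverse (1 + x\<^sup>2)"
    proof -
      have "0 < a\<^sup>2 + x\<^sup>2" using a by (simp add: add_pos_nonneg)
      then show ?thesis using angle_rate[OF t, of x] unfolding a_def by (simp only: divide_inverse)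
    qed
    ultimately have "0 \<le> exp t * inverse (1 + x\<^sup>2) - inverse (1 + (slope_at t x)\<^sup>2) * (1 / a\<^sup>2)" by linarith
    with D show "\<exists>y. (?G has_real_derivative y) (at x) \<and> 0 \<le> y" by blast
  qed
  then show "arctan (slope_at t l) - arctan (slope_at t k) \<le> exp t * (arctan l - arctan k)"
    by (simp add: algebra_simps)
  have pos: "0 < 1 + t * k / 2" "0 < 1 + t * l / 2" using k alive_mono[OF k t kl] by (simp_all add: alive_def)
  have "k * (1 + t * l / 2) \<le> l * (1 + t * k / 2)" using kl by (simp add: algebra_simps)
  then have "k / (1 + t * k / 2) \<le> l / (1 + t * l / 2)"
    using pos by (simp only: pos_divide_le_eq pos_le_divide_eq times_divide_eq_left)
  then have "slope_at t k \<le> slope_at t l" by (simp only: slope_at_def)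
  then show "arctan (slope_at t k) \<le> arctan (slope_at t l)" by (rule arctan_monotone')
qed

lemma angle_contraction:
  assumes t: "0 \<le> t" and k: "alive t k" and l: "alive t l"
  shows "\<bar>arctan (slope_at t k) - arctan (slope_at t l)\<bar> \<le> exp t * \<bar>arctan k - arctan l\<bar>"
proof (cases "k \<le> l")
  case True
  then have "arctan k \<le> arctan l" by (rule arctan_monotone')
  then show ?thesis using angle_increase[OF t k True] by simp
next
  case False
  then have lk: "l \<le> k" by simp
  then have "arctan l \<le> arctan k" by (rule arctan_monotone')
  then show ?thesis using angle_increase[OF t l lk] by simp
qed

text \<open>The limit case of the angle estimate, in which one of the two angles has just reached -
  pi / 2. The slope formula is singular at k, so for negative x the height is written as - arctan (1
  / x + T / 2), which is regular there.\<close>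

lemma height_at_death:
  assumes k: "k < 0" and T: "T = - 2 / k"
  shows "height T l \<le> exp T * \<bar>arctan k - arctan l\<bar>"
proof -
  have T0: "0 < T" using k T by (simp add: divide_neg_neg)
  have neg: "height T x \<le> exp T * (arctan x - arctan k)" if x: "k < x" "x < 0" for x
  proof -
    have al: "alive T x" using x k by (simp add: alive_def T field_simps)
    let ?G = "\<lambda>x. exp T * arctan x + arctan (1 / x + T / 2)"
    have "?G k \<le> ?G x"
    proof (rule DERIV_nonneg_imp_nondecreasing[OF less_imp_le[OF x(1)]])
      fix z assume z: "k \<le> z" "z \<le> x"
      then have z0: "z < 0" using x by simp
      have "((\<lambda>x. 1 / x + T / 2) has_real_derivative - (1 / z\<^sup>2)) (at z)"
        using z0 by (auto intro!: derivative_eq_intros simp: power2_eq_square)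
      from DERIV_add[OF DERIV_cmult[OF DERIV_arctan] DERIV_chain2[OF DERIV_arctan this]]
      have D: "(?G has_real_derivative exp T * inverse (1 + z\<^sup>2) + inverse (1 + (1 / z + T / 2)\<^sup>2) * (- (1 / z\<^sup>2))) (at z)" .
      have "inverse (1 + (1 / z + T / 2)\<^sup>2) * (1 / z\<^sup>2) = 1 / ((1 + T * z / 2)\<^sup>2 + z\<^sup>2)"
      proof -
        have e: "(1 + (1 / z + T / 2)\<^sup>2) * z\<^sup>2 = (1 + T * z / 2)\<^sup>2 + z\<^sup>2"
          using z0 by (simp add: power2_eq_square field_simps)
        show ?thesis unfolding e[symmetric] by (simp only: divide_inverse inverse_mult_distrib mult_1_left)
      qed
      moreover have "1 / ((1 + T * z / 2)\<^sup>2 + z\<^sup>2) \<le> exp T * inverse (1 + z\<^sup>2)"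
      proof -
        have "0 < (1 + T * z / 2)\<^sup>2 + z\<^sup>2" using z0 by (simp add: add_nonneg_pos)
        then show ?thesis using angle_rate[OF less_imp_le[OF T0], of z] by (simp only: divide_inverse)
      qed
      ultimately have "0 \<le> exp T * inverse (1 + z\<^sup>2) + inverse (1 + (1 / z + T / 2)\<^sup>2) * (- (1 / z\<^sup>2))" by linarith
      with D show "\<exists>y. (?G has_real_derivative y) (at z) \<and> 0 \<le> y" by blast
    qed
    moreover have "1 / k + T / 2 = 0" using k by (simp add: T)
    ultimately have "exp T * arctan k \<le> exp T * arctan x + arctan (1 / x + T / 2)" by simp
    then show ?thesis using height_negative[OF x(2) al] by (simp add: algebra_simps)
  qed
  show ?thesis
  proof (cases "k < l")
    case False
    then have "\<not> alive T l" using k by (simp add: alive_def T field_simps)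
    then show ?thesis by (simp add: height_def)
  next
    case True
    then have kl: "\<bar>arctan k - arctan l\<bar> = arctan l - arctan k" using arctan_monotone'[of k l] by simp
    show ?thesis
    proof (cases "l < 0")
      case True
      then show ?thesis using neg[of l] \<open>k < l\<close> kl by simp
    next
      case False
      \<comment> \<open>The regular formula needs x < 0 and the slope formula needs x alive at T; k
        / 2 satisfies both and links the two estimates.\<close>
      have al: "alive T (k / 2)" using k by (simp add: alive_def T)
      have le: "k / 2 \<le> l" using False k by simp
      have "height T l - height T (k / 2) \<le> exp T * (arctan l - arctan (k / 2))"
        using angle_increase(1)[OF less_imp_le[OF T0] al le] al alive_mono[OF al less_imp_le[OF T0] le] by (simp add: height_def)
      moreover have "height T (k / 2) \<le> exp T * (arctan (k / 2) - arctan k)" using k by (intro neg) auto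
      ultimately show ?thesis unfolding kl by (simp add: algebra_simps)
    qed
  qed
qed

text \<open>Angles expand by at most exp T up to the first death T, where the survivor's height is
  controlled by the initial angle gap. From then on the survivor dissipates, and this pays for the
  \<mu> term.\<close>

lemma height_death_bound:
  assumes t: "0 \<le> t" and dead: "\<not> alive t k" and le: "lifetime t k \<le> lifetime t l" and lam: "0 \<le> \<mu>" "4 * \<mu> \<le> \<kappa>"
  shows "exp (- t) * (\<kappa> * height t l) + \<mu> * (exp (- lifetime t k) - exp (- lifetime t l)) \<le> \<kappa> * \<bar>arctan k - arctan l\<bar>"
proof -
  let ?T = "lifetime t k"
  have "exp (- t) * (\<kappa> * height t l) + \<mu> * (exp (- ?T) - exp (- lifetime t l)) \<le> exp (- ?T) * (\<kappa> * height ?T l)"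
    using lifetime_bounds[OF t, of k] by (intro height_dissipation t le lam) auto
  also have "\<dots> \<le> exp (- ?T) * (\<kappa> * (exp ?T * \<bar>arctan k - arctan l\<bar>))"
    using height_at_death[OF not_alive_lifetime(1)[OF dead t] not_alive_lifetime_eq[OF dead], of l] lam
    by (intro mult_left_mono) auto
  also have "\<dots> = \<kappa> * \<bar>arctan k - arctan l\<bar>" by (simp add: exp_minus)
  finally show ?thesis .
qed

text \<open>
  The contribution of a matched pair of particles: \<open>a\<close> bounds the sum of the distances of
  positions and values. The term with \<open>\<mu>\<close> accounts for the time during which exactly one of
  the two particles carries energy.
\<close>
definition pair_dist :: "real \<Rightarrow> real \<Rightarrow> real \<Rightarrow> real \<Rightarrow> real \<Rightarrow> real" where
  "pair_dist \<kappa> t a k l =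
     (if alive t k \<and> alive t l
      then min (a + \<kappa> * \<bar>arctan (slope_at t k) - arctan (slope_at t l)\<bar>) (\<kappa> * height t k + \<kappa> * height t l)
      else \<kappa> * height t k + \<kappa> * height t l)"

text \<open>The initial distance is a minimum, so both of its branches must bound the left side. The
  branch through infinity treats the two particles separately, using |exp (- a) - exp (- b)| \<le>
  (1 - exp (- a)) + (1 - exp (- b)). The direct branch uses the angle estimate while both live,
  where the \<mu> term is zero, and the death bound after the first death.\<close>

lemma pair_dist_estimate:
  assumes t: "0 \<le> t" and lam: "0 \<le> \<mu>" "4 * \<mu> \<le> \<kappa>" and E: "0 \<le> E" "0 \<le> a0" and a: "a \<le> exp t * (a0 + E)"
  shows "exp (- t) * pair_dist \<kappa> t a k l + \<mu> * \<bar>exp (- lifetime t k) - exp (- lifetime t l)\<bar> \<le> pair_dist \<kappa> 0 a0 k l + E"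
proof -
  have alive0: "alive 0 x" for x by (simp add: alive_def)
  have D0: "pair_dist \<kappa> 0 a0 k l = min (a0 + \<kappa> * \<bar>arctan k - arctan l\<bar>) (\<kappa> * height 0 k + \<kappa> * height 0 l)"
    by (simp add: pair_dist_def alive0 slope_at_def)
  have Dt: "pair_dist \<kappa> t a k l \<le> \<kappa> * height t k + \<kappa> * height t l" by (simp add: pair_dist_def)
  have B: "exp (- t) * pair_dist \<kappa> t a k l + \<mu> * \<bar>exp (- lifetime t k) - exp (- lifetime t l)\<bar> \<le> \<kappa> * height 0 k + \<kappa> * height 0 l"
  proof -
    have tau: "0 \<le> lifetime t x" for x using lifetime_bounds[OF t] by blast
    have "exp (- t) * pair_dist \<kappa> t a k l \<le> exp (- t) * (\<kappa> * height t k + \<kappa> * height t l)"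
      using Dt by (intro mult_left_mono) auto
    moreover have "exp (- t) * (\<kappa> * height t x) + \<mu> * (1 - exp (- lifetime t x)) \<le> \<kappa> * height 0 x" for x
      using height_dissipation[OF t order_refl tau[of x] lam] by simp
    note this[of k] this[of l]
    moreover have "\<mu> * \<bar>exp (- lifetime t k) - exp (- lifetime t l)\<bar> \<le> \<mu> * ((1 - exp (- lifetime t k)) + (1 - exp (- lifetime t l)))"
    proof (rule mult_left_mono[OF _ lam(1)])
      have "exp (- lifetime t k) \<le> 1" "exp (- lifetime t l) \<le> 1" using tau by auto
      then show "\<bar>exp (- lifetime t k) - exp (- lifetime t l)\<bar> \<le> (1 - exp (- lifetime t k)) + (1 - exp (- lifetime t l))"
        by linarith
    qed
    ultimately show ?thesis by (simp add: algebra_simps)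
  qed
  have A: "exp (- t) * pair_dist \<kappa> t a k l + \<mu> * \<bar>exp (- lifetime t k) - exp (- lifetime t l)\<bar> \<le> a0 + \<kappa> * \<bar>arctan k - arctan l\<bar> + E"
  proof (cases "alive t k \<and> alive t l")
    case True
    then have "exp (- t) * pair_dist \<kappa> t a k l \<le> exp (- t) * (a + \<kappa> * \<bar>arctan (slope_at t k) - arctan (slope_at t l)\<bar>)"
      by (intro mult_left_mono) (auto simp: pair_dist_def)
    also have "\<dots> \<le> exp (- t) * (exp t * (a0 + E) + \<kappa> * (exp t * \<bar>arctan k - arctan l\<bar>))"
      using a lam angle_contraction[OF t] True by (intro mult_left_mono add_mono) auto
    also have "\<dots> = a0 + \<kappa> * \<bar>arctan k - arctan l\<bar> + E" by (simp add: exp_minus field_simps)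
    finally show ?thesis using True by (simp add: lifetime_def)
  next
    case False
    then consider "\<not> alive t k" "lifetime t k \<le> lifetime t l" | "\<not> alive t l" "lifetime t l \<le> lifetime t k"
      using not_alive_lifetime(3)[OF _ t, of k] not_alive_lifetime(3)[OF _ t, of l]
      by (cases "alive t k"; cases "alive t l") (auto simp: lifetime_def, linarith)
    then have "exp (- t) * pair_dist \<kappa> t a k l + \<mu> * \<bar>exp (- lifetime t k) - exp (- lifetime t l)\<bar> \<le> \<kappa> * \<bar>arctan k - arctan l\<bar>"
    proof cases
      case 1
      then show ?thesis using height_death_bound[OF t 1 lam] by (simp add: pair_dist_def height_def)
    next
      case 2
      then show ?thesis using height_death_bound[OF t 2 lam]
        by (simp add: pair_dist_def height_def abs_minus_commute)
    qed
    then show ?thesis using E by linarith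
  qed
  show ?thesis using A B E unfolding D0 by (auto simp: min_def)
qed

section \<open>Evolution of one admissible plan\<close>

locale plan_evolution =
  fixes u v \<psi> \<phi>1 \<phi>2 p :: "real \<Rightarrow> real" and \<kappa> t :: real
  assumes u: "u \<in> X_space" and v: "v \<in> X_space"
    and p: "has_density \<psi> p" and surj: "surj \<psi>"
    and phi1: "simple_function borel \<phi>1" "range \<phi>1 \<subseteq> {0..1}"
    and phi2: "simple_function borel \<phi>2" "range \<phi>2 \<subseteq> {0..1}"
    and match: "AE y in lborel. \<phi>1 y * (dx u y)\<^sup>2 = p y * \<phi>2 (\<psi> y) * (dx v (\<psi> y))\<^sup>2"
    and kappa: "0 < \<kappa>" "energy u \<le> \<kappa>" and t: "0 \<le> t"
begin

lemmas [measurable] = has_density_measurable[OF p] has_density_measurable_fun[OF p]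
  dx_measurable[OF u] dx_measurable[OF v]
  borel_measurable_simple_function[OF phi1(1)] borel_measurable_simple_function[OF phi2(1)]

lemmas p_nonneg = has_density_nonneg[OF p]

lemma phi_bounds: "0 \<le> \<phi>1 y" "\<phi>1 y \<le> 1" "0 \<le> \<phi>2 y" "\<phi>2 y \<le> 1"
  using phi1(2) phi2(2) by (auto simp: subset_iff)

definition l :: "real \<Rightarrow> real" where "l y = dx v (\<psi> y)"
definition matched :: "real \<Rightarrow> real" where "matched y = \<phi>1 y * (dx u y)\<^sup>2"
definition free_u :: "real \<Rightarrow> real" where "free_u y = (1 - \<phi>1 y) * (dx u y)\<^sup>2"
definition free_v :: "real \<Rightarrow> real" where "free_v y = (1 - \<phi>2 (\<psi> y)) * (l y)\<^sup>2 * p y"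
definition total :: "real \<Rightarrow> real" where "total y = (dx u y)\<^sup>2 + (l y)\<^sup>2 * p y"

text \<open>The part of the two energy densities at time s that does not cancel in the difference of
  the source terms. Matched energy counts only while exactly one partner is alive.\<close>

definition unbalanced :: "real \<Rightarrow> real \<Rightarrow> real" where
  "unbalanced s y = free_u y * (if alive s (dx u y) then 1 else 0) + free_v y * (if alive s (l y) then 1 else 0)
     + matched y * \<bar>(if alive s (dx u y) then 1 else 0) - (if alive s (l y) then 1 else 0)\<bar>"

text \<open>The integral of \<open>unbalanced\<close> over [0, t] with weight exp (- s), in closed
  form; this weight is the one that \<open>height_dissipation\<close> returns.\<close>

definition loss :: "real \<Rightarrow> real" where
  "loss y = free_u y * (1 - exp (- lifetime t (dx u y))) + free_v y * (1 - exp (- lifetime t (l y)))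
     + matched y * \<bar>exp (- lifetime t (dx u y)) - exp (- lifetime t (l y))\<bar>"

lemma mass_measurable [measurable]:
  "l \<in> borel_measurable borel" "matched \<in> borel_measurable borel" "free_u \<in> borel_measurable borel"
  "free_v \<in> borel_measurable borel" "total \<in> borel_measurable borel" "loss \<in> borel_measurable borel"
proof -
  show [measurable]: "l \<in> borel_measurable borel" unfolding l_def[abs_def] by measurable
  show [measurable]: "matched \<in> borel_measurable borel" "free_u \<in> borel_measurable borel"
    "free_v \<in> borel_measurable borel" "total \<in> borel_measurable borel"
    unfolding matched_def[abs_def] free_u_def[abs_def] free_v_def[abs_def] total_def[abs_def] by measurable
  show "loss \<in> borel_measurable borel" unfolding loss_def[abs_def] by measurable
qed

lemma unbalanced_measurable [measurable]:
  "(\<lambda>q. unbalanced (fst q) (snd q)) \<in> borel_measurable (lborel \<Otimes>\<^sub>M lborel)"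
  "unbalanced s \<in> borel_measurable borel"
  unfolding unbalanced_def[abs_def] by measurable

lemma mass_nonneg: "0 \<le> matched y" "0 \<le> free_u y" "0 \<le> free_v y" "0 \<le> total y"
  using phi_bounds p_nonneg[of y] by (auto simp: matched_def free_u_def free_v_def total_def)

lemma mass_split: "matched y + free_u y = (dx u y)\<^sup>2" "free_v y \<le> (l y)\<^sup>2 * p y"
proof -
  show "matched y + free_u y = (dx u y)\<^sup>2" by (simp add: matched_def free_u_def algebra_simps)
  have "(1 - \<phi>2 (\<psi> y)) * ((l y)\<^sup>2 * p y) \<le> 1 * ((l y)\<^sup>2 * p y)"
    using phi_bounds[of "\<psi> y"] p_nonneg[of y] by (intro mult_right_mono) auto
  then show "free_v y \<le> (l y)\<^sup>2 * p y" by (simp add: free_v_def)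
qed

lemma match_v: "AE y in lborel. (l y)\<^sup>2 * p y = matched y + free_v y"
  using match by eventually_elim (simp add: matched_def free_v_def l_def algebra_simps)

lemma integrable_v: "integrable lborel (\<lambda>y. (l y)\<^sup>2 * p y)"
  using integral_has_density(1)[OF p surj, of "\<lambda>x. (dx v x)\<^sup>2"] dx_integrable[OF v] by (simp add: l_def)

lemma integrable_total: "integrable lborel total"
  unfolding total_def[abs_def] by (intro Bochner_Integration.integrable_add dx_integrable[OF u] integrable_v)

lemma unbalanced_bounds: "0 \<le> unbalanced s y" "unbalanced s y \<le> total y"
proof -
  note n = mass_nonneg[of y]
  show "0 \<le> unbalanced s y" using n by (auto simp: unbalanced_def)
  have "unbalanced s y \<le> free_u y + free_v y + matched y" using n by (auto simp: unbalanced_def)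
  also have "\<dots> \<le> total y" using mass_split[of y] by (simp add: total_def)
  finally show "unbalanced s y \<le> total y" .
qed

lemma loss_bounds: "0 \<le> loss y" "loss y \<le> total y"
proof -
  note n = mass_nonneg[of y]
  have b: "0 \<le> lifetime t x" for x using lifetime_bounds[OF t] by blast
  have e: "0 < exp (- lifetime t x)" "exp (- lifetime t x) \<le> 1" for x using b[of x] by auto
  show "0 \<le> loss y" using n e by (auto simp: loss_def intro!: add_nonneg_nonneg mult_nonneg_nonneg)
  have "\<bar>exp (- lifetime t (dx u y)) - exp (- lifetime t (l y))\<bar> \<le> 1"
    using e[of "dx u y"] e[of "l y"] by linarith
  then have "free_u y * (1 - exp (- lifetime t (dx u y))) \<le> free_u y"
    "free_v y * (1 - exp (- lifetime t (l y))) \<le> free_v y"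
    "matched y * \<bar>exp (- lifetime t (dx u y)) - exp (- lifetime t (l y))\<bar> \<le> matched y"
    using n by (intro mult_left_le; simp)+
  then have "loss y \<le> free_u y + free_v y + matched y" by (simp add: loss_def)
  also have "\<dots> \<le> total y" using mass_split[of y] by (simp add: total_def)
  finally show "loss y \<le> total y" .
qed

lemma unbalanced_integrable: "integrable lborel (unbalanced s)"
  by (rule Bochner_Integration.integrable_bound[OF integrable_total])
     (use unbalanced_bounds mass_nonneg in auto)

lemma loss_integrable: "integrable lborel loss"
  by (rule Bochner_Integration.integrable_bound[OF integrable_total])
     (use loss_bounds mass_nonneg in auto)

definition U :: "real \<Rightarrow> real" where "U s = (LINT x|lborel. unbalanced s x)"
definition \<rho> :: real where "\<rho> = (LINT x|lborel. loss x)"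

lemma rho_nonneg: "0 \<le> \<rho>" unfolding \<rho>_def using loss_bounds by (intro integral_nonneg_AE) auto

lemma U_measurable [measurable]: "U \<in> borel_measurable borel"
proof -
  have "U = (\<lambda>s. LINT x|lborel. (\<lambda>q. unbalanced (fst q) (snd q)) (s, x))" by (simp add: U_def[abs_def])
  also have "\<dots> \<in> borel_measurable borel" by measurable
  finally show ?thesis .
qed

lemma U_bounds: "0 \<le> U s" "U s \<le> (LINT x|lborel. total x)"
proof -
  show "0 \<le> U s" unfolding U_def using unbalanced_bounds by (intro integral_nonneg_AE) auto
  show "U s \<le> (LINT x|lborel. total x)"
    unfolding U_def by (intro integral_mono unbalanced_integrable integrable_total unbalanced_bounds)
qed

text \<open>After pulling the integral for \<open>v\<close> back along \<psi>, both integrands carry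
  the same sign factor because \<psi> is monotone. Matched energies of living pairs then cancel and
  only \<open>unbalanced\<close> remains.\<close>

lemma char_speed_difference:
  assumes s: "0 \<le> s"
  shows "\<bar>char_speed u s y - char_speed v s (\<psi> y)\<bar> \<le> U s / 4"
proof -
  let ?a = "\<lambda>x. indicator {x. alive s (dx u x)} x * (sgn (y - x) * (dx u x)\<^sup>2)"
  let ?b = "\<lambda>x. indicator {x. alive s (l x)} x * (sgn (\<psi> y - \<psi> x) * (l x)\<^sup>2) * p x"
  have bi: "integrable lborel ?b" and cv: "char_speed v s (\<psi> y) = 1/4 * (LINT x|lborel. ?b x)"
  proof -
    let ?G = "\<lambda>z. indicator {z. alive s (dx v z)} z * (sgn (\<psi> y - z) * (dx v z)\<^sup>2)"
    have [measurable]: "?G \<in> borel_measurable borel" by measurable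
    have eq: "?G (\<psi> x) * p x = ?b x" for x by (simp add: l_def indicator_def)
    show "integrable lborel ?b"
      using integral_has_density(1)[OF p surj, of ?G] char_speed_integrable[OF v, of s "\<psi> y"] by (simp add: eq)
    show "char_speed v s (\<psi> y) = 1/4 * (LINT x|lborel. ?b x)"
      using integral_has_density(2)[OF p surj, of ?G] by (simp add: eq char_speed_eq[OF v s])
  qed
  have eqD: "char_speed u s y - char_speed v s (\<psi> y) = 1/4 * (LINT x|lborel. ?a x - ?b x)"
    using Bochner_Integration.integral_diff[OF char_speed_integrable[OF u, of s y] bi]
    by (simp add: char_speed_eq[OF u s] cv)
  have leD: "norm (LINT x|lborel. ?a x - ?b x) \<le> U s"
    unfolding U_def
  proof (rule Bochner_Integration.integral_norm_bound_integral[where f="\<lambda>x. ?a x - ?b x", THEN order_trans])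
    show "integrable lborel (\<lambda>x. ?a x - ?b x)"
      by (intro Bochner_Integration.integrable_diff char_speed_integrable[OF u] bi)
    show "integrable lborel (\<lambda>x. norm (?a x - ?b x))"
      by (intro integrable_norm Bochner_Integration.integrable_diff char_speed_integrable[OF u] bi)
    show "(LINT x|lborel. norm (?a x - ?b x)) \<le> (LINT x|lborel. unbalanced s x)"
    proof (rule integral_mono_AE)
      show "integrable lborel (\<lambda>x. norm (?a x - ?b x))"
        by (intro integrable_norm Bochner_Integration.integrable_diff char_speed_integrable[OF u] bi)
      show "integrable lborel (unbalanced s)" by (rule unbalanced_integrable)
      show "AE x in lborel. norm (?a x - ?b x) \<le> unbalanced s x"
        using match_v AE_has_density_inj[OF p surj]
      proof eventually_elim
        case (elim x)
        let ?K = "if alive s (dx u x) then 1 else 0 :: real" and ?L = "if alive s (l x) then 1 else 0 :: real"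
        \<comment> \<open>Where p x > 0 the map \<psi> is injective at x, so the signs of \<psi> y -
          \<psi> x and y - x agree; elsewhere the factor p x removes the term.\<close>
        have b: "?b x = ?L * (sgn (y - x) * ((l x)\<^sup>2 * p x))"
        proof (cases "0 < p x")
          case True
          then have inj: "\<psi> y' = \<psi> x \<Longrightarrow> y' = x" for y' using elim(2) by blast
          have "sgn (\<psi> y - \<psi> x) = sgn (y - x)"
            using inj[of y] monoD[OF has_density_mono[OF p], of x y] monoD[OF has_density_mono[OF p], of y x]
            by (cases x y rule: linorder_cases) (force simp: sgn_real_def)+
          then show ?thesis by (simp add: indicator_def)
        next
          case False
          then have "p x = 0" using p_nonneg[of x] by simp
          then show ?thesis by simp
        qed
        have "?a x - ?b x = sgn (y - x) * (free_u x * ?K - free_v x * ?L + matched x * (?K - ?L))"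
          unfolding b elim(1) mass_split(1)[symmetric] by (simp add: indicator_def algebra_simps)
        then have "norm (?a x - ?b x) \<le> \<bar>free_u x * ?K - free_v x * ?L + matched x * (?K - ?L)\<bar>"
          by (auto simp: abs_mult sgn_real_def)
        also have "\<dots> \<le> \<bar>free_u x * ?K\<bar> + \<bar>free_v x * ?L\<bar> + \<bar>matched x * (?K - ?L)\<bar>" by linarith
        also have "\<dots> = unbalanced s x" using mass_nonneg[of x] by (simp add: unbalanced_def abs_mult)
        finally show ?case .
      qed
    qed
  qed auto
  show ?thesis unfolding eqD abs_mult using leD by simp
qed

lemma weighted_U_integrable:
  assumes [measurable]: "\<omega> \<in> borel_measurable borel" and W: "\<And>s. s \<in> {0..t} \<Longrightarrow> \<bar>\<omega> s\<bar> \<le> W"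
  shows "integrable lborel (\<lambda>s. indicator {0..t} s * (\<omega> s * (U s / 4)))"
proof (rule Bochner_Integration.integrable_bound)
  let ?C = "LINT x|lborel. total x"
  show "integrable lborel (\<lambda>s. indicator {0..t} s * (W * ?C))"
    by (intro integrable_mult_left integrable_real_indicator) (auto simp: emeasure_lborel_Icc_eq)
  show "AE s in lborel. norm (indicator {0..t} s * (\<omega> s * (U s / 4))) \<le> norm (indicator {0..t} s * (W * ?C))"
  proof (rule AE_I2)
    fix s
    show "norm (indicator {0..t} s * (\<omega> s * (U s / 4))) \<le> norm (indicator {0..t} s * (W * ?C))"
    proof (cases "s \<in> {0..t}")
      case True
      have "\<bar>\<omega> s\<bar> * \<bar>U s / 4\<bar> \<le> W * ?C"
        using W[OF True] U_bounds[of s] by (intro mult_mono) auto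
      also have "\<dots> \<le> \<bar>W * ?C\<bar>" by (rule abs_ge_self)
      finally show ?thesis using True by (simp add: abs_mult)
    qed simp
  qed
qed measurable

lemma weighted_speed_difference:
  assumes [measurable]: "\<omega> \<in> borel_measurable borel" and W: "\<And>s. s \<in> {0..t} \<Longrightarrow> 0 \<le> \<omega> s \<and> \<omega> s \<le> W"
  shows "\<bar>(LINT s:{0..t}|lborel. \<omega> s * char_speed u s y) - (LINT s:{0..t}|lborel. \<omega> s * char_speed v s (\<psi> y))\<bar>
     \<le> (LINT s|lborel. indicator {0..t} s * (\<omega> s * (U s / 4)))"
proof -
  have W': "s \<in> {0..t} \<Longrightarrow> \<bar>\<omega> s\<bar> \<le> W" for s using W[of s] by auto
  note iu = weighted_speed_integrable[OF u assms(1) W', where y=y]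
    and iv = weighted_speed_integrable[OF v assms(1) W', where y="\<psi> y"]
  have "(LINT s:{0..t}|lborel. \<omega> s * char_speed u s y) - (LINT s:{0..t}|lborel. \<omega> s * char_speed v s (\<psi> y))
     = (LINT s|lborel. indicator {0..t} s * (\<omega> s * char_speed u s y) - indicator {0..t} s * (\<omega> s * char_speed v s (\<psi> y)))"
    unfolding set_lebesgue_integral_def using Bochner_Integration.integral_diff[OF iu iv] by simp
  moreover have "norm (LINT s|lborel. indicator {0..t} s * (\<omega> s * char_speed u s y) - indicator {0..t} s * (\<omega> s * char_speed v s (\<psi> y)))
     \<le> (LINT s|lborel. indicator {0..t} s * (\<omega> s * (U s / 4)))"
  proof (rule Bochner_Integration.integral_norm_bound_integral)
    show "integrable lborel (\<lambda>s. indicator {0..t} s * (\<omega> s * (U s / 4)))"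
      by (rule weighted_U_integrable[OF assms(1) W'])
    fix s
    show "norm (indicator {0..t} s * (\<omega> s * char_speed u s y) - indicator {0..t} s * (\<omega> s * char_speed v s (\<psi> y)))
       \<le> indicator {0..t} s * (\<omega> s * (U s / 4))"
    proof (cases "s \<in> {0..t}")
      case True
      have "\<omega> s * \<bar>char_speed u s y - char_speed v s (\<psi> y)\<bar> \<le> \<omega> s * (U s / 4)"
        using W[OF True] True by (intro mult_left_mono char_speed_difference) auto
      then show ?thesis using True W[OF True] by (simp add: right_diff_distrib[symmetric] abs_mult)
    qed simp
  qed (intro Bochner_Integration.integrable_diff iu iv; assumption)
  ultimately show ?thesis by simp
qed

lemma loss_time_integral:
  "has_bochner_integral lborel (\<lambda>s. indicator {0..t} s * (exp (- s) * unbalanced s y)) (loss y)"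
proof -
  let ?a = "\<lambda>k s. indicator {0..t} s * (exp (- s) * indicator {s. alive s k} s) :: real"
  have a: "has_bochner_integral lborel (?a k) (1 - exp (- lifetime t k))" for k
  proof -
    have "has_bochner_integral lborel (?a k) (- exp (- lifetime t k) - (- exp (- 0)))"
      by (rule alive_integral[OF t]) (auto intro!: derivative_eq_intros continuous_intros)
    then show ?thesis by simp
  qed
  \<comment> \<open>Living times are nested in the slope, so for k \<le> k' the absolute value opens
    with one sign for all times.\<close>
  have one: "has_bochner_integral lborel (\<lambda>s. \<bar>?a k s - ?a k' s\<bar>) \<bar>exp (- lifetime t k) - exp (- lifetime t k')\<bar>"
    if "k \<le> k'" for k k'
  proof -
    have eq: "\<bar>?a k s - ?a k' s\<bar> = ?a k' s - ?a k s" for s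
      using alive_mono[OF _ _ that, of s] by (auto split: split_indicator)
    have hb: "has_bochner_integral lborel (\<lambda>s. ?a k' s - ?a k s) ((1 - exp (- lifetime t k')) - (1 - exp (- lifetime t k)))"
      by (intro has_bochner_integral_diff a)
    moreover have "0 \<le> (1 - exp (- lifetime t k')) - (1 - exp (- lifetime t k))"
    proof -
      have "0 \<le> (LINT s|lborel. ?a k' s - ?a k s)"
        unfolding eq[symmetric] by (intro integral_nonneg_AE) auto
      then show ?thesis using hb by (simp add: has_bochner_integral_iff)
    qed
    ultimately show ?thesis unfolding eq by (simp add: abs_if split: if_splits)
  qed
  have two: "has_bochner_integral lborel (\<lambda>s. \<bar>?a k s - ?a k' s\<bar>) \<bar>exp (- lifetime t k) - exp (- lifetime t k')\<bar>" for k k'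
  proof (cases "k \<le> k'")
    case False
    then show ?thesis using one[of k' k] by (simp add: abs_minus_commute)
  qed (rule one)
  have "has_bochner_integral lborel (\<lambda>s. free_u y * ?a (dx u y) s + free_v y * ?a (l y) s + matched y * \<bar>?a (dx u y) s - ?a (l y) s\<bar>) (loss y)"
    unfolding loss_def by (intro has_bochner_integral_add has_bochner_integral_mult_right a two)
  moreover have "(\<lambda>s. free_u y * ?a (dx u y) s + free_v y * ?a (l y) s + matched y * \<bar>?a (dx u y) s - ?a (l y) s\<bar>)
     = (\<lambda>s. indicator {0..t} s * (exp (- s) * unbalanced s y))"
    by (rule ext) (auto simp: unbalanced_def indicator_def algebra_simps)
  ultimately show ?thesis by simp
qed

lemma rho_eq: "(LINT s|lborel. indicator {0..t} s * (exp (- s) * (U s / 4))) = \<rho> / 4"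
proof -
  define k where "k = (\<lambda>(s, y). indicator {0..t} s * (exp (- s) * unbalanced s y))"
  have [measurable]: "k \<in> borel_measurable (lborel \<Otimes>\<^sub>M lborel)"
  proof -
    have "k = (\<lambda>q. indicator {0..t} (fst q) * (exp (- fst q) * unbalanced (fst q) (snd q)))" by (auto simp: k_def)
    also have "\<dots> \<in> borel_measurable (lborel \<Otimes>\<^sub>M lborel)" by measurable
    finally show ?thesis .
  qed
  have ki: "integrable (lborel \<Otimes>\<^sub>M lborel) k"
  proof (rule integrable_product_bound)
    show "integrable lborel (\<lambda>s. indicator {0..t} s :: real)"
      by (intro integrable_real_indicator) (auto simp: emeasure_lborel_Icc_eq)
    show "integrable lborel total" by (rule integrable_total)
    fix s x
    show "\<bar>k (s, x)\<bar> \<le> \<bar>indicator {0..t} s\<bar> * \<bar>total x\<bar>"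
    proof (cases "s \<in> {0..t}")
      case True
      have "exp (- s) * unbalanced s x \<le> 1 * total x"
        using True unbalanced_bounds[of s x] by (intro mult_mono) auto
      then show ?thesis using True unbalanced_bounds[of s x] mass_nonneg[of x] by (simp add: k_def abs_mult)
    qed (simp add: k_def)
  qed measurable
  have "(LINT s|lborel. indicator {0..t} s * (exp (- s) * (U s / 4))) = (LINT s|lborel. (LINT y|lborel. k (s, y)) / 4)"
    by (simp add: k_def U_def)
  also have "\<dots> = (LINT s|lborel. LINT y|lborel. k (s, y)) / 4" by simp
  also have "(LINT s|lborel. LINT y|lborel. k (s, y)) = (LINT y|lborel. LINT s|lborel. k (s, y))"
    using lborel_pair.Fubini_integral[of "\<lambda>s y. k (s, y)"] ki by simp
  also have "\<dots> = \<rho>"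
    unfolding \<rho>_def k_def using loss_time_integral by (simp add: has_bochner_integral_iff)
  finally show ?thesis .
qed

definition displacement :: "real \<Rightarrow> real" where
  "displacement y = \<bar>char_pos u t y - char_pos v t (\<psi> y)\<bar> + \<bar>char_val u t y - char_val v t (\<psi> y)\<bar>"

text \<open>A change of speed at time s enters the value with weight 1 and the position with weight
  t - s, and 1 + (t - s) \<le> exp t * exp (- s). This produces the weight in \<rho>. The initial
  difference of values enters with weight 1 + t in the same way.\<close>

lemma displacement_bound: "displacement y \<le> exp t * ((\<bar>y - \<psi> y\<bar> + \<bar>u y - v (\<psi> y)\<bar>) + \<rho> / 4)"
proof -
  let ?D = "\<lambda>\<omega>. (LINT s:{0..t}|lborel. \<omega> s * char_speed u s y) - (LINT s:{0..t}|lborel. \<omega> s * char_speed v s (\<psi> y))"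
  let ?I = "\<lambda>\<omega>. LINT s|lborel. indicator {0..t} s * (\<omega> s * (U s / 4))"
  have 1: "\<bar>?D (\<lambda>_. 1)\<bar> \<le> ?I (\<lambda>_. 1)" by (rule weighted_speed_difference[where W=1]) auto
  have 2: "\<bar>?D (\<lambda>s. t - s)\<bar> \<le> ?I (\<lambda>s. t - s)" by (rule weighted_speed_difference[where W=t]) auto
  have "?I (\<lambda>_. 1) + ?I (\<lambda>s. t - s) = (LINT s|lborel. indicator {0..t} s * (1 * (U s / 4)) + indicator {0..t} s * ((t - s) * (U s / 4)))"
    by (rule Bochner_Integration.integral_add[symmetric]; rule weighted_U_integrable[where W="1 + t"]) (use t in auto)
  also have "\<dots> \<le> (LINT s|lborel. exp t * (indicator {0..t} s * (exp (- s) * (U s / 4))))"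
  proof (rule integral_mono)
    show "integrable lborel (\<lambda>s. indicator {0..t} s * (1 * (U s / 4)) + indicator {0..t} s * ((t - s) * (U s / 4)))"
      by (rule Bochner_Integration.integrable_add; rule weighted_U_integrable[where W="1 + t"]) (use t in auto)
    show "integrable lborel (\<lambda>s. exp t * (indicator {0..t} s * (exp (- s) * (U s / 4))))"
      by (intro integrable_mult_right weighted_U_integrable[where W=1]) auto
    fix s
    show "indicator {0..t} s * (1 * (U s / 4)) + indicator {0..t} s * ((t - s) * (U s / 4)) \<le> exp t * (indicator {0..t} s * (exp (- s) * (U s / 4)))"
    proof (cases "s \<in> {0..t}")
      case True
      have "(1 + (t - s)) * (U s / 4) \<le> exp (t - s) * (U s / 4)"
        using U_bounds[of s] by (intro mult_right_mono exp_ge_add_one_self) auto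
      then show ?thesis using True by (simp add: exp_diff exp_minus field_simps)
    qed simp
  qed
  also have "\<dots> = exp t * (\<rho> / 4)" by (simp only: integral_mult_right_zero rho_eq)
  finally have 3: "?I (\<lambda>_. 1) + ?I (\<lambda>s. t - s) \<le> exp t * (\<rho> / 4)" .
  have "char_pos u t y - char_pos v t (\<psi> y) = (y - \<psi> y) + t * (u y - v (\<psi> y)) + ?D (\<lambda>s. t - s)"
    by (simp add: char_pos_def algebra_simps)
  then have "\<bar>char_pos u t y - char_pos v t (\<psi> y)\<bar> \<le> \<bar>y - \<psi> y\<bar> + t * \<bar>u y - v (\<psi> y)\<bar> + \<bar>?D (\<lambda>s. t - s)\<bar>"
    using abs_triangle_ineq[of "(y - \<psi> y) + t * (u y - v (\<psi> y))" "?D (\<lambda>s. t - s)"]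
      abs_triangle_ineq[of "y - \<psi> y" "t * (u y - v (\<psi> y))"] t by (simp add: abs_mult)
  moreover have "char_val u t y - char_val v t (\<psi> y) = (u y - v (\<psi> y)) + ?D (\<lambda>_. 1)"
    by (simp add: char_val_def)
  then have "\<bar>char_val u t y - char_val v t (\<psi> y)\<bar> \<le> \<bar>u y - v (\<psi> y)\<bar> + \<bar>?D (\<lambda>_. 1)\<bar>"
    using abs_triangle_ineq by metis
  ultimately have "displacement y \<le> \<bar>y - \<psi> y\<bar> + (1 + t) * \<bar>u y - v (\<psi> y)\<bar> + exp t * (\<rho> / 4)"
    unfolding displacement_def using 1 2 3 by (simp add: distrib_right)
  also have "\<dots> \<le> exp t * \<bar>y - \<psi> y\<bar> + exp t * \<bar>u y - v (\<psi> y)\<bar> + exp t * (\<rho> / 4)"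
  proof (intro add_mono order_refl)
    have "1 * \<bar>y - \<psi> y\<bar> \<le> exp t * \<bar>y - \<psi> y\<bar>" using t by (intro mult_right_mono) auto
    then show "\<bar>y - \<psi> y\<bar> \<le> exp t * \<bar>y - \<psi> y\<bar>" by simp
    show "(1 + t) * \<bar>u y - v (\<psi> y)\<bar> \<le> exp t * \<bar>u y - v (\<psi> y)\<bar>"
      by (intro mult_right_mono exp_ge_add_one_self) auto
  qed
  finally show ?thesis by (simp add: algebra_simps)
qed

definition cost_density :: "real \<Rightarrow> real \<Rightarrow> real \<Rightarrow> real" where
  "cost_density s a y = matched y * pair_dist \<kappa> s a (dx u y) (l y)
     + free_u y * (\<kappa> * height s (dx u y)) + free_v y * (\<kappa> * height s (l y))"

text \<open>The dissipation estimates with \<mu> = energy u / 4. This choice makes the gain \<mu> *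
  \<rho> equal to the largest possible integral of matched y * \<rho> / 4, and 4 * \<mu> \<le>
  \<kappa> is the assumption on the energy.\<close>

lemma cost_density_estimate:
  "exp (- t) * cost_density t (displacement y) y + energy u / 4 * loss y
     \<le> cost_density 0 (\<bar>y - \<psi> y\<bar> + \<bar>u y - v (\<psi> y)\<bar>) y + matched y * (\<rho> / 4)"
proof -
  let ?m = "energy u / 4" and ?a0 = "\<bar>y - \<psi> y\<bar> + \<bar>u y - v (\<psi> y)\<bar>"
  have m: "0 \<le> ?m" "4 * ?m \<le> \<kappa>" using kappa by (auto simp: energy_def)
  have tau: "0 \<le> lifetime t x" for x using lifetime_bounds[OF t] by blast
  have h: "exp (- t) * (\<kappa> * height t x) + ?m * (1 - exp (- lifetime t x)) \<le> \<kappa> * height 0 x" for x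
    using height_dissipation[OF t order_refl tau[of x] m] by simp
  have "exp (- t) * pair_dist \<kappa> t (displacement y) (dx u y) (l y) + ?m * \<bar>exp (- lifetime t (dx u y)) - exp (- lifetime t (l y))\<bar>
     \<le> pair_dist \<kappa> 0 ?a0 (dx u y) (l y) + \<rho> / 4"
    using rho_nonneg displacement_bound[of y] by (intro pair_dist_estimate[OF t m]) auto
  from mult_left_mono[OF this mass_nonneg(1)[of y]] mult_left_mono[OF h[of "dx u y"] mass_nonneg(2)[of y]]
    mult_left_mono[OF h[of "l y"] mass_nonneg(3)[of y]]
  show ?thesis unfolding cost_density_def loss_def by (simp add: algebra_simps)
qed

lemma pair_dist_nonneg: "0 \<le> a \<Longrightarrow> 0 \<le> pair_dist \<kappa> s a k k'"
  using kappa height_nonneg by (auto simp: pair_dist_def)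

lemma cost_density_nonneg: "0 \<le> a \<Longrightarrow> 0 \<le> cost_density s a y"
  unfolding cost_density_def using mass_nonneg[of y] kappa height_nonneg pair_dist_nonneg
  by (intro add_nonneg_nonneg mult_nonneg_nonneg) auto

lemma displacement_nonneg: "0 \<le> displacement y" by (simp add: displacement_def)

lemma cost_density_measurable [measurable]:
  assumes [measurable]: "a \<in> borel_measurable borel"
  shows "(\<lambda>y. cost_density s (a y) y) \<in> borel_measurable borel"
proof -
  have [measurable]: "arctan \<in> borel_measurable borel"
    by (intro borel_measurable_continuous_onI continuous_intros)
  show ?thesis unfolding cost_density_def pair_dist_def by measurable
qed

lemma fun_measurable: "u \<in> borel_measurable borel" "v \<in> borel_measurable borel"
  "char_pos u t \<in> borel_measurable borel" "char_pos v t \<in> borel_measurable borel"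
  "char_val u t \<in> borel_measurable borel" "char_val v t \<in> borel_measurable borel"
  using u v has_density_measurable_fun[OF char_pos_density[OF u t]] has_density_measurable_fun[OF char_pos_density[OF v t]]
    has_increments_continuous[OF char_val_increments[OF u t]] has_increments_continuous[OF char_val_increments[OF v t]]
  by (auto simp: X_space_def intro: borel_measurable_continuous_onI)

text \<open>After integration over the labels the gain is energy u / 4 * \<rho>, and the error is
  the total matched energy times \<rho> / 4, which is no larger.\<close>

lemma cost_integral_estimate:
  "ennreal (exp (- t)) * (\<integral>\<^sup>+y. ennreal (cost_density t (displacement y) y) \<partial>lborel)
     \<le> (\<integral>\<^sup>+y. ennreal (cost_density 0 (\<bar>y - \<psi> y\<bar> + \<bar>u y - v (\<psi> y)\<bar>) y) \<partial>lborel)"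
proof -
  note [measurable] = fun_measurable
  have [measurable]: "displacement \<in> borel_measurable borel" unfolding displacement_def[abs_def] by measurable
  let ?S = "\<lambda>y. cost_density t (displacement y) y" and ?Z = "\<lambda>y. cost_density 0 (\<bar>y - \<psi> y\<bar> + \<bar>u y - v (\<psi> y)\<bar>) y"
  let ?m = "energy u / 4"
  have m: "0 \<le> ?m" by (simp add: energy_def)
  have nn: "0 \<le> ?S y" "0 \<le> ?Z y" for y by (auto intro!: cost_density_nonneg displacement_nonneg)
  have loss: "(\<integral>\<^sup>+y. ennreal (loss y) \<partial>lborel) = ennreal \<rho>"
    unfolding \<rho>_def by (rule nn_integral_eq_integral[OF loss_integrable]) (simp add: loss_bounds)
  have "(\<integral>\<^sup>+y. ennreal (matched y) \<partial>lborel) \<le> (\<integral>\<^sup>+y. ennreal ((dx u y)\<^sup>2) \<partial>lborel)"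
  proof (rule nn_integral_mono, rule ennreal_leI)
    fix y show "matched y \<le> (dx u y)\<^sup>2" using mass_split(1)[of y] mass_nonneg[of y] by linarith
  qed
  also have "\<dots> = ennreal (energy u)"
    unfolding energy_def by (rule nn_integral_eq_integral[OF dx_integrable[OF u]]) simp
  finally have mat: "(\<integral>\<^sup>+y. ennreal (matched y) \<partial>lborel) \<le> ennreal (energy u)" .
  \<comment> \<open>The gain is kept as a summand on the left; being finite, it cancels at the end
    without subtraction of extended reals.\<close>
  have "ennreal (?m * \<rho>) + ennreal (exp (- t)) * (\<integral>\<^sup>+y. ennreal (?S y) \<partial>lborel)
     = (\<integral>\<^sup>+y. ennreal ?m * ennreal (loss y) + ennreal (exp (- t)) * ennreal (?S y) \<partial>lborel)"
  proof -
    have "ennreal (?m * \<rho>) = ennreal ?m * ennreal \<rho>" using m rho_nonneg by (rule ennreal_mult)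
    then show ?thesis by (simp add: nn_integral_add nn_integral_cmult loss)
  qed
  also have "\<dots> \<le> (\<integral>\<^sup>+y. ennreal (?Z y) + ennreal (matched y) * ennreal (\<rho> / 4) \<partial>lborel)"
  proof (rule nn_integral_mono)
    fix y
    have "ennreal ?m * ennreal (loss y) + ennreal (exp (- t)) * ennreal (?S y) = ennreal (exp (- t) * ?S y + ?m * loss y)"
      using m loss_bounds[of y] nn[of y] by (simp add: ennreal_mult[symmetric] ennreal_plus[symmetric] add.commute del: ennreal_plus)
    also have "\<dots> \<le> ennreal (?Z y + matched y * (\<rho> / 4))" by (rule ennreal_leI[OF cost_density_estimate])
    also have "\<dots> = ennreal (?Z y) + ennreal (matched y) * ennreal (\<rho> / 4)"
      using nn[of y] rho_nonneg mass_nonneg[of y] by (simp add: ennreal_mult[symmetric] ennreal_plus[symmetric] del: ennreal_plus)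
    finally show "ennreal ?m * ennreal (loss y) + ennreal (exp (- t)) * ennreal (?S y) \<le> ennreal (?Z y) + ennreal (matched y) * ennreal (\<rho> / 4)" .
  qed
  also have "\<dots> = (\<integral>\<^sup>+y. ennreal (?Z y) \<partial>lborel) + (\<integral>\<^sup>+y. ennreal (matched y) \<partial>lborel) * ennreal (\<rho> / 4)"
    by (simp add: nn_integral_add nn_integral_multc)
  also have "\<dots> \<le> (\<integral>\<^sup>+y. ennreal (?Z y) \<partial>lborel) + ennreal (energy u) * ennreal (\<rho> / 4)"
    by (intro add_left_mono mult_right_mono mat) auto
  also have "ennreal (energy u) * ennreal (\<rho> / 4) = ennreal (?m * \<rho>)"
    using m rho_nonneg by (simp add: ennreal_mult[symmetric])
  finally have "ennreal (?m * \<rho>) + ennreal (exp (- t)) * (\<integral>\<^sup>+y. ennreal (?S y) \<partial>lborel) \<le> ennreal (?m * \<rho>) + (\<integral>\<^sup>+y. ennreal (?Z y) \<partial>lborel)"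
    by (simp only: add.commute)
  then show ?thesis by (simp add: ennreal_add_left_cancel_le)
qed

lemma initial_cost:
  "(\<integral>\<^sup>+y. ennreal (cost_density 0 (\<bar>y - \<psi> y\<bar> + \<bar>u y - v (\<psi> y)\<bar>) y) \<partial>lborel) \<le> transport_cost \<kappa> u v (\<psi>, \<phi>1, \<phi>2)"
proof -
  note [measurable] = measurable_aux_dist_graph[OF u v] measurable_aux_dist_graph(2)[OF v u]
  let ?d = "\<lambda>y. aux_dist \<kappa> (graph_point u y) (graph_point v (\<psi> y))"
  let ?du = "\<lambda>y. aux_dist \<kappa> (graph_point u y) Infty" and ?dv = "\<lambda>y. aux_dist \<kappa> (graph_point v (\<psi> y)) Infty"
  let ?T1 = "\<lambda>y. ?d y * \<phi>1 y * (dx u y)\<^sup>2" and ?T2 = "\<lambda>y. ?du y * (1 - \<phi>1 y) * (dx u y)\<^sup>2"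
  let ?T3 = "\<lambda>y. ?dv y * (1 - \<phi>2 (\<psi> y)) * (dx v (\<psi> y))\<^sup>2 * p y"
  have abs_pi: "\<bar>pi / 2 + arctan x\<bar> = pi / 2 + arctan x" for x using arctan_lbound[of x] by simp
  have "(\<integral>\<^sup>+y. ennreal (cost_density 0 (\<bar>y - \<psi> y\<bar> + \<bar>u y - v (\<psi> y)\<bar>) y) \<partial>lborel) \<le> (\<integral>\<^sup>+y. ennreal (?T1 y) + ennreal (?T2 y) + ennreal (?T3 y) \<partial>lborel)"
  proof (rule nn_integral_mono)
    fix y
    have "?d y = pair_dist \<kappa> 0 (\<bar>y - \<psi> y\<bar> + \<bar>u y - v (\<psi> y)\<bar>) (dx u y) (l y)"
      by (simp add: graph_point_def pair_dist_def alive_def slope_at_def height_0 l_def abs_pi)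
    moreover have "?du y = \<kappa> * height 0 (dx u y)" "?dv y = \<kappa> * height 0 (l y)"
      by (simp_all add: graph_point_def height_0 l_def abs_pi)
    ultimately have "cost_density 0 (\<bar>y - \<psi> y\<bar> + \<bar>u y - v (\<psi> y)\<bar>) y = ?T1 y + ?T2 y + ?T3 y"
      by (simp only: cost_density_def matched_def free_u_def free_v_def l_def) (simp only: ac_simps)
    then show "ennreal (cost_density 0 (\<bar>y - \<psi> y\<bar> + \<bar>u y - v (\<psi> y)\<bar>) y) \<le> ennreal (?T1 y) + ennreal (?T2 y) + ennreal (?T3 y)"
      using phi_bounds aux_dist_nonneg[OF kappa(1)] p_nonneg[of y] by (simp only:) (subst ennreal_plus; simp)+
  qed
  also have "\<dots> = (\<integral>\<^sup>+y. ennreal (?T1 y) \<partial>lborel) + (\<integral>\<^sup>+y. ennreal (?T2 y) \<partial>lborel) + (\<integral>\<^sup>+y. ennreal (?T3 y) \<partial>lborel)"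
    by (subst nn_integral_add; (subst nn_integral_add)?) measurable
  also have "(\<integral>\<^sup>+y. ennreal (?T3 y) \<partial>lborel) = (\<integral>\<^sup>+y. ennreal (?dv y * (1 - \<phi>2 (\<psi> y)) * (dx v (\<psi> y))\<^sup>2 * deriv \<psi> y) \<partial>lborel)"
  proof (rule nn_integral_cong_AE)
    show "AE y in lborel. ennreal (?T3 y) = ennreal (?dv y * (1 - \<phi>2 (\<psi> y)) * (dx v (\<psi> y))\<^sup>2 * deriv \<psi> y)"
      using has_density_DERIV[OF p] by eventually_elim (simp add: DERIV_imp_deriv)
  qed
  finally show ?thesis unfolding transport_cost_def nn_integral_completion by simp
qed

definition both_alive :: "real set" where
  "both_alive = {y. alive t (dx u y) \<and> alive t (l y)}"

text \<open>The plan at time t keeps the old weights where both partners live and is switched off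
  elsewhere. A survivor then pays its distance to \<open>Infty\<close> in full, as the last branch
  of \<open>pair_dist\<close> prescribes. Label by label the cost of this coupling is the integrand
  on the right.\<close>

lemma evolved_cost:
  "J \<kappa> (dissipative_solution u t) (dissipative_solution v t) \<le> (\<integral>\<^sup>+y. ennreal (cost_density t (displacement y) y) \<partial>lborel)"
proof -
  let ?ut = "dissipative_solution u t" and ?vt = "dissipative_solution v t"
  let ?F = "char_pos u t" and ?H = "\<lambda>y. char_pos v t (\<psi> y)"
  let ?f = "\<lambda>y. stretch t (dx u y)" and ?h = "\<lambda>y. stretch t (dx v (\<psi> y)) * p y"
  let ?\<theta>1 = "\<lambda>y. \<phi>1 y * indicator both_alive y" and ?\<theta>2 = "\<lambda>y. \<phi>2 (\<psi> y) * indicator both_alive y"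
  note [measurable] = fun_measurable
  have ut: "?ut \<in> X_space" and vt: "?vt \<in> X_space"
    using dissipative_solution_X_space u v t by auto
  have [measurable]: "both_alive \<in> sets borel" unfolding both_alive_def by measurable
  have F: "has_density ?F ?f" by (rule char_pos_density[OF u t])
  have H: "has_density ?H ?h" by (rule has_density_compose[OF char_pos_density[OF v t] p surj])
  have surjF: "surj ?F" by (rule surj_char_pos[OF u t])
  have surjH: "surj ?H" using comp_surj[OF surj surj_char_pos[OF v t]] by (simp only: comp_def)
  have au: "AE y in lborel. alive t (dx u y) \<longrightarrow> dx ?ut (?F y) = slope_at t (dx u y)"
    by (rule dx_dissipative_solution_char_pos[OF u t])
  have av: "AE y in lborel. 0 < p y \<longrightarrow> alive t (l y) \<longrightarrow> dx ?vt (?H y) = slope_at t (l y)"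
    using AE_has_density[OF p surj dx_dissipative_solution_char_pos[OF v t]] unfolding l_def .
  have eu: "AE y in lborel. (dx ?ut (?F y))\<^sup>2 * ?f y = (if alive t (dx u y) then (dx u y)\<^sup>2 else 0)"
    using au
  proof eventually_elim
    case (elim y)
    then show ?case using slope_at_stretch(2)[of t "dx u y"]
      by (cases "alive t (dx u y)") (simp_all, simp add: stretch_def)
  qed
  have ev: "AE y in lborel. (dx ?vt (?H y))\<^sup>2 * ?h y = (if alive t (l y) then (l y)\<^sup>2 * p y else 0)"
    using av
  proof eventually_elim
    case (elim y)
    show ?case
    proof (cases "alive t (l y) \<and> 0 < p y")
      case True
      then have "(dx ?vt (?H y))\<^sup>2 * ?h y = ((slope_at t (l y))\<^sup>2 * stretch t (l y)) * p y" using elim by (simp add: l_def)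
      then show ?thesis using True slope_at_stretch(2)[of t "l y"] by simp
    next
      case False
      then have "p y = 0 \<or> stretch t (l y) = 0" using p_nonneg[of y] by (auto simp: stretch_def)
      then show ?thesis using False p_nonneg[of y] by (auto simp: l_def[symmetric])
    qed
  qed
  have simple: "simple_function borel ?\<theta>1" "simple_function borel ?\<theta>2"
  proof -
    have "range ?\<theta>1 \<subseteq> insert 0 (range \<phi>1)" "range ?\<theta>2 \<subseteq> insert 0 (range \<phi>2)" by (auto split: split_indicator)
    moreover have "finite (range \<phi>1)" "finite (range \<phi>2)"
      using simple_functionD(1)[OF phi1(1)] simple_functionD(1)[OF phi2(1)] by auto
    ultimately have "finite (range ?\<theta>1)" "finite (range ?\<theta>2)" by (meson finite_insert finite_subset)+
    then show "simple_function borel ?\<theta>1" "simple_function borel ?\<theta>2"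
      by (intro simple_function_borel_measurable; simp)+
  qed
  have c: "coupling ?ut ?vt ?F ?f ?H ?h ?\<theta>1 ?\<theta>2 \<kappa>"
  proof (unfold_locales, goal_cases)
    \<comment> \<open>The matching condition: on living pairs both energies per label equal their
      initial values, so the initial matching persists.\<close>
    case 11
    show ?case using eu ev match
    proof eventually_elim
      case (elim y)
      show ?case
      proof (cases "y \<in> both_alive")
        case True
        then have a: "alive t (dx u y)" "alive t (l y)" by (simp_all add: both_alive_def)
        have "?\<theta>1 y * (dx ?ut (?F y))\<^sup>2 * ?f y = \<phi>1 y * ((dx ?ut (?F y))\<^sup>2 * ?f y)" using True by simp
        also have "\<dots> = \<phi>2 (\<psi> y) * ((l y)\<^sup>2 * p y)" using elim(1,3) a(1) by (simp add: l_def)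
        also have "\<dots> = \<phi>2 (\<psi> y) * ((dx ?vt (?H y))\<^sup>2 * ?h y)" unfolding elim(2) using a(2) by simp
        finally show ?thesis using True by simp
      qed simp
    qed
  qed (use ut vt F surjF H surjH simple phi_bounds kappa in \<open>auto split: split_indicator\<close>)
  have "J \<kappa> ?ut ?vt \<le> coupling_cost \<kappa> ?ut ?vt ?F ?f ?H ?h ?\<theta>1 ?\<theta>2" by (rule coupling.J_le_coupling_cost[OF c])
  also have "\<dots> \<le> (\<integral>\<^sup>+y. ennreal (cost_density t (displacement y) y) \<partial>lborel)"
  proof -
    note [measurable] = measurable_aux_dist_graph[OF ut vt] measurable_aux_dist_graph(2)[OF vt ut]
      dx_measurable[OF ut] dx_measurable[OF vt]
    let ?d = "\<lambda>y. aux_dist \<kappa> (graph_point ?ut (?F y)) (graph_point ?vt (?H y))"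
    let ?du = "\<lambda>y. aux_dist \<kappa> (graph_point ?ut (?F y)) Infty" and ?dv = "\<lambda>y. aux_dist \<kappa> (graph_point ?vt (?H y)) Infty"
    let ?T1 = "\<lambda>y. ?d y * ?\<theta>1 y * (dx ?ut (?F y))\<^sup>2 * ?f y" and ?T2 = "\<lambda>y. ?du y * (1 - ?\<theta>1 y) * (dx ?ut (?F y))\<^sup>2 * ?f y"
    let ?T3 = "\<lambda>y. ?dv y * (1 - ?\<theta>2 y) * (dx ?vt (?H y))\<^sup>2 * ?h y"
    have abs_pi: "\<bar>pi / 2 + arctan x\<bar> = pi / 2 + arctan x" for x using arctan_lbound[of x] by simp
    have "coupling_cost \<kappa> ?ut ?vt ?F ?f ?H ?h ?\<theta>1 ?\<theta>2 = (\<integral>\<^sup>+y. ennreal (?T1 y) + ennreal (?T2 y) + ennreal (?T3 y) \<partial>lborel)"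
      unfolding coupling_cost_def by (subst nn_integral_add; (subst nn_integral_add)?) measurable
    also have "\<dots> \<le> (\<integral>\<^sup>+y. ennreal (cost_density t (displacement y) y) \<partial>lborel)"
    proof (rule nn_integral_mono_AE)
      show "AE y in lborel. ennreal (?T1 y) + ennreal (?T2 y) + ennreal (?T3 y) \<le> ennreal (cost_density t (displacement y) y)"
        using au av eu ev match match_v
      proof eventually_elim
        case (elim y)
        let ?k = "dx u y"
        have P: "graph_point ?ut (?F y) = Fin (?F y) (char_val u t y) (arctan (dx ?ut (?F y)))"
          "graph_point ?vt (?H y) = Fin (?H y) (char_val v t (\<psi> y)) (arctan (dx ?vt (?H y)))"
          by (simp_all add: graph_point_def dissipative_solution_char_pos u v t)
        have du: "?du y * ((dx ?ut (?F y))\<^sup>2 * ?f y) = \<kappa> * height t ?k * ?k\<^sup>2"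
          using elim(1) unfolding elim(3) P by (simp add: height_def abs_pi)
        have dv: "?dv y * ((dx ?vt (?H y))\<^sup>2 * ?h y) = \<kappa> * height t (l y) * ((l y)\<^sup>2 * p y)"
        proof (cases "0 < p y")
          case True
          then show ?thesis using elim(2) unfolding elim(4) P by (simp add: height_def abs_pi)
        next
          case False
          then have "p y = 0" using p_nonneg[of y] by simp
          then show ?thesis by simp
        qed
        have T2: "?T2 y = (1 - ?\<theta>1 y) * (\<kappa> * height t ?k * ?k\<^sup>2)" unfolding du[symmetric] by (simp only: ac_simps)
        have T3: "?T3 y = (1 - ?\<theta>2 y) * (\<kappa> * height t (l y) * ((l y)\<^sup>2 * p y))" unfolding dv[symmetric] by (simp only: ac_simps)
        have mv: "\<phi>2 (\<psi> y) * ((l y)\<^sup>2 * p y) = matched y" using elim(5) by (simp add: matched_def l_def)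
        have "?T1 y + ?T2 y + ?T3 y = cost_density t (displacement y) y"
        proof (cases "y \<in> both_alive")
          case True
          have T1: "?T1 y = matched y * pair_dist \<kappa> t (displacement y) ?k (l y)"
          proof (cases "0 < p y")
            case p: True
            have sl: "dx ?ut (?F y) = slope_at t ?k" "dx ?vt (?H y) = slope_at t (l y)"
              using True elim(1,2) p by (auto simp: both_alive_def)
            have d: "?d y = pair_dist \<kappa> t (displacement y) ?k (l y)"
              unfolding P sl using True by (simp add: pair_dist_def both_alive_def displacement_def height_def abs_pi)
            have "?T1 y = ?d y * (\<phi>1 y * ((dx ?ut (?F y))\<^sup>2 * ?f y))" using True by simp
            also have "\<dots> = ?d y * matched y" unfolding elim(3) using True by (simp add: both_alive_def matched_def)
            finally show ?thesis unfolding d by (simp only: mult.commute)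
          next
            case False
            then have "p y = 0" using p_nonneg[of y] by simp
            \<comment> \<open>Where p y = 0 nothing is known about the slope of the second solution,
              but such a label has no matched energy.\<close>
            then have m0: "matched y = 0" using mv by simp
            have "?T1 y = ?d y * (\<phi>1 y * ((dx ?ut (?F y))\<^sup>2 * ?f y))" using True by simp
            also have "\<dots> = ?d y * matched y" unfolding elim(3) using True by (simp add: both_alive_def matched_def)
            finally show ?thesis unfolding m0 by simp
          qed
          have "?T2 y = free_u y * (\<kappa> * height t ?k)" "?T3 y = free_v y * (\<kappa> * height t (l y))"
            unfolding T2 T3 free_u_def free_v_def using True by simp_all
          then show ?thesis unfolding cost_density_def T1 by simp
        next
          case False
          have pd: "pair_dist \<kappa> t (displacement y) ?k (l y) = \<kappa> * height t ?k + \<kappa> * height t (l y)"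
            using False by (auto simp: pair_dist_def both_alive_def)
          have T23: "?T2 y = (\<kappa> * height t ?k) * (matched y + free_u y)" "?T3 y = (\<kappa> * height t (l y)) * (matched y + free_v y)"
            unfolding T2 T3 mass_split(1) elim(6)[symmetric] using False by simp_all
          have "?T1 y = 0" using False by simp
          then show ?thesis unfolding cost_density_def pd T23 by (simp add: algebra_simps)
        qed
        moreover have "0 \<le> ?T1 y" "0 \<le> ?T2 y" "0 \<le> ?T3 y"
        proof -
          have th: "0 \<le> 1 - ?\<theta>1 y" "0 \<le> 1 - ?\<theta>2 y" using coupling.th_bounds[OF c, of y] by simp_all
          show "0 \<le> ?T1 y" "0 \<le> ?T2 y" "0 \<le> ?T3 y"
            by (intro mult_nonneg_nonneg aux_dist_nonneg[OF kappa(1)] zero_le_power2 stretch_nonneg p_nonneg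
              phi_bounds(1) indicator_pos_le th)+
        qed
        ultimately show ?case
          by (simp only: ennreal_plus[symmetric] add_nonneg_nonneg order_refl)
      qed
    qed
    finally show ?thesis .
  qed
  finally show ?thesis .
qed

lemma J_evolution:
  "ennreal (exp (- t)) * J \<kappa> (dissipative_solution u t) (dissipative_solution v t) \<le> transport_cost \<kappa> u v (\<psi>, \<phi>1, \<phi>2)"
  by (rule order_trans[OF mult_left_mono[OF evolved_cost] order_trans[OF cost_integral_estimate initial_cost]]) simp

end

section \<open>Infimum over all plans and choice of the constants\<close>

lemma J_exponential_bound:
  assumes u: "u \<in> X_space" and v: "v \<in> X_space" and k: "0 < \<kappa>" "energy u \<le> \<kappa>" and t: "0 \<le> t"
  shows "J \<kappa> (dissipative_solution u t) (dissipative_solution v t) \<le> ennreal (exp t) * J \<kappa> u v"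
proof -
  let ?J = "J \<kappa> (dissipative_solution u t) (dissipative_solution v t)"
  have "ennreal (exp (- t)) * ?J \<le> J \<kappa> u v"
    unfolding J_def[of \<kappa> u v]
  proof (rule INF_greatest)
    fix plan assume "plan \<in> admissible u v"
    moreover obtain \<psi> \<phi>1 \<phi>2 where plan: "plan = (\<psi>, \<phi>1, \<phi>2)" by (cases plan)
    ultimately have adm: "simple_function borel \<phi>1" "range \<phi>1 \<subseteq> {0..1}" "simple_function borel \<phi>2" "range \<phi>2 \<subseteq> {0..1}"
      "mono \<psi>" "abs_continuous_on UNIV \<psi>" "surj \<psi>"
      "AE x in lebesgue. \<phi>1 x * (dx u x)\<^sup>2 = deriv \<psi> x * \<phi>2 (\<psi> x) * (dx v (\<psi> x))\<^sup>2"
      by (auto simp: admissible_def transport_triples_def)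
    obtain p where p: "has_density \<psi> p" using abs_continuous_has_density[OF adm(6,5)] .
    have "AE x in lborel. \<phi>1 x * (dx u x)\<^sup>2 = deriv \<psi> x * \<phi>2 (\<psi> x) * (dx v (\<psi> x))\<^sup>2"
      using adm(8) by (simp add: AE_completion_iff)
    with has_density_DERIV[OF p] have "AE x in lborel. \<phi>1 x * (dx u x)\<^sup>2 = p x * \<phi>2 (\<psi> x) * (dx v (\<psi> x))\<^sup>2"
      by eventually_elim (simp add: DERIV_imp_deriv)
    then interpret plan_evolution u v \<psi> \<phi>1 \<phi>2 p \<kappa> t
      using u v p adm k t by unfold_locales auto
    show "ennreal (exp (- t)) * ?J \<le> transport_cost \<kappa> u v plan" unfolding plan by (rule J_evolution)
  qed
  then have "ennreal (exp t) * (ennreal (exp (- t)) * ?J) \<le> ennreal (exp t) * J \<kappa> u v"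
    by (intro mult_left_mono) auto
  then show ?thesis by (simp add: mult.assoc[symmetric] ennreal_mult[symmetric] exp_minus)
qed

theorem mainTheorem3:
  fixes M :: real
  shows "\<exists>\<kappa>\<^sub>0>0. \<exists>C\<^sub>M::real.
    \<forall>ubar\<in>X_space. \<forall>vbar\<in>X_space.
      L2_norm (dx ubar) \<le> M \<longrightarrow> L2_norm (dx vbar) \<le> M \<longrightarrow>
      (\<forall>t\<ge>0. J \<kappa>\<^sub>0 (dissipative_solution ubar t) (dissipative_solution vbar t)
             \<le> ennreal (exp (C\<^sub>M * t)) * J \<kappa>\<^sub>0 ubar vbar)"
proof (rule exI[of _ "M\<^sup>2 + 1"], intro conjI exI[of _ 1] ballI impI allI)
  \<comment> \<open>The summand 1 keeps the constant positive when M = 0; the energy bound itself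
    only asks for M^2.\<close>
  show "0 < M\<^sup>2 + 1" by (simp add: add_nonneg_pos)
  fix ubar vbar t assume X: "ubar \<in> X_space" "vbar \<in> X_space" and M: "L2_norm (dx ubar) \<le> M" and t: "0 \<le> (t::real)"
  have "sqrt (energy ubar) \<le> M" using M by (simp add: L2_norm_def energy_def)
  moreover have "0 \<le> energy ubar" by (simp add: energy_def)
  ultimately have "energy ubar \<le> M\<^sup>2" by (simp add: real_le_lsqrt sqrt_le_D)
  then show "J (M\<^sup>2 + 1) (dissipative_solution ubar t) (dissipative_solution vbar t) \<le> ennreal (exp (1 * t)) * J (M\<^sup>2 + 1) ubar vbar"
    unfolding mult_1 using X t by (intro J_exponential_bound) (auto simp: add_nonneg_pos)
qed

end
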